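(* (Mixed reciprocity relation.) For the scattering of plane waves $u^i(\cdot,d)$, $d\in S$, and of point sources located at $z\in\Omega_0\cup\Omega_1$, one has $$\Phi^\infty(\widehat x,z)=\begin{cases}\dfrac1{4\pi}u^s(z,-\widehat x), & z\in\Omega_0,\ \widehat x\in S,\\[2mm] \dfrac{\lambda_0}{4\pi}v(z,-\widehat x), & z\in\Omega_1,\ \widehat x\in S.\end{cases}$$ Here $u^s(\cdot,d)$ and $v(\cdot,d)$ are the scattered field in $\Omega_0$ and the field in $\Omega_1$ for the incident plane wave with direction $d$, and $\Phi^\infty(\cdot,z)$ is the far field pattern of the scattered field for the incident point source at $z$.
   Context: $S=\{x\in\mathbb R^3:|x|=1\}$. Fix $0<\alpha<1$ and positive numbers $k_0,k_1,k_2,\lambda_0,\lambda_1$. $\Omega_2\subset\mathbb R^3$ is an open bounded region with $C^2$ boundary $S_1$; $S_0$ is a closed $C^2$ surface dividing $\mathbb R^3\setminus\overline{\Omega_2}$ into two connected domains, the unbounded domain $\Omega_0$ with $\partial\Omega_0=S_0$ and the bounded domain $\Omega_1$ with $\partial\Omega_1=S_0\cup S_1$, $S_0\cap S_1=\emptyset$. The vector $\nu$ is the unit normal on $S_0$ pointing into $\Omega_0$ and on $S_1$ pointing into $\Omega_1$. The refractive index $n\in C^{0,\alpha}(\overline{\Omega_2})$ satisfies $\Re(n)>0$, $\Im(n)\ge0$. Standing assumption: $k_2^2$ is not a Neumann eigenvalue, i.e. the only solution of $\Delta w+k_2^2nw=0$ in $\Omega_2$ with $\partial w/\partial\nu=0$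 on $S_1$ is $w=0$. Transmission problem with data $(f,g,p,q)$: find $u^s\in C^2(\Omega_0)\cap C^{1,\alpha}(\overline{\Omega_0})$, $v\in C^2(\Omega_1)\cap C^{1,\alpha}(\overline{\Omega_1})$, $w\in C^2(\Omega_2)\cap C^{1,\alpha}(\overline{\Omega_2})$ with $\Delta u^s+k_0^2u^s=0$ in $\Omega_0$, $\Delta v+k_1^2v=0$ in $\Omega_1$, $\Delta w+k_2^2nw=0$ in $\Omega_2$; $u^s-v=f$, $\frac{\partial u^s}{\partial\nu}-\lambda_0\frac{\partial v}{\partial\nu}=g$ on $S_0$; $v-w=p$, $\frac{\partial v}{\partial\nu}-\lambda_1\frac{\partial w}{\partial\nu}=q$ on $S_1$; and $\lim_{r\to\infty}r(\frac{\partial u^s}{\partial r}-ik_0u^s)=0$, $r=|x|$, uniformly in all directions. It is uniquely solvable for $f\in C^{1,\alpha}(S_0)$, $g\in C^{0,\alpha}(S_0)$, $p\in C^{1,\alpha}(S_1)$, $q\in C^{0,\alpha}(S_1)$. The far field pattern $u^\infty$ of $u^s$ is defined by $u^s(x)=\frac{e^{ik_0|x|}}{|x|}\{u^\infty(\widehat x)+O(1/|x|)\}$ as $|x|\to\infty$, uniformly in $\widehat x=x/|x|$. Let $\Phi_j(x,y)=\frac{e^{ik_j|x-y|}}{4\pi|x-y|}$, $x\ne y$, $j=0,1$. (i) Incident plane wave $u^i(x,d)=e^{ik_0x\cdot d}$, $d\in S$: $(u^s(\cdot,d),v(\cdot,d),w(\cdot,d))$ is the solution with $f=-u^i|_{S_0}$,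 $g=-\partial u^i/\partial\nu|_{S_0}$, $p=q=0$. (ii) Incident point source $\Phi_0(\cdot,z)$, $z\in\Omega_0$: $(u^s(\cdot,z),v(\cdot,z),w(\cdot,z))$ is the solution with $f=-\Phi_0(\cdot,z)|_{S_0}$, $g=-\partial\Phi_0(\cdot,z)/\partial\nu|_{S_0}$, $p=q=0$. (iii) Incident point source $\Phi_1(\cdot,z)$, $z\in\Omega_1$: $(u^s(\cdot,z),v(\cdot,z),w(\cdot,z))$ is the solution with $f=\Phi_1(\cdot,z)|_{S_0}$, $g=\lambda_0\,\partial\Phi_1(\cdot,z)/\partial\nu|_{S_0}$, $p=-\Phi_1(\cdot,z)|_{S_1}$, $q=-\partial\Phi_1(\cdot,z)/\partial\nu|_{S_1}$. In cases (ii), (iii), $\Phi^\infty(\cdot,z)$ denotes the far field pattern of $u^s(\cdot,z)$. *)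

theory Defs
  imports "HOL-Analysis.Analysis" "HOL-Library.Landau_Symbols"
begin

section \<open>Function spaces\<close>

definition partial_deriv :: "3 \<Rightarrow> (real^3 \<Rightarrow> 'a::real_normed_vector) \<Rightarrow> real^3 \<Rightarrow> 'a" where
  "partial_deriv i u x = frechet_derivative u (at x) (axis i 1)"

definition laplacian :: "(real^3 \<Rightarrow> complex) \<Rightarrow> real^3 \<Rightarrow> complex" where
  "laplacian u x = (\<Sum>i\<in>UNIV. partial_deriv i (partial_deriv i u) x)"

text \<open>The following two predicates are meant for open sets \<open>D\<close> only.\<close>

definition C1_on :: "(real^3) set \<Rightarrow> (real^3 \<Rightarrow> 'a::real_normed_vector) \<Rightarrow> bool" where
  "C1_on D u \<longleftrightarrow> (\<forall>x\<in>D. u differentiable (at x)) \<and> (\<forall>i. continuous_on D (partial_deriv i u))"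

definition C2_on :: "(real^3) set \<Rightarrow> (real^3 \<Rightarrow> 'a::real_normed_vector) \<Rightarrow> bool" where
  "C2_on D u \<longleftrightarrow> C1_on D u \<and> (\<forall>i. C1_on D (partial_deriv i u))"

text \<open>\<open>C\<^sup>0\<^sup>,\<^sup>\<alpha>(G)\<close>: bounded and uniformly Hoelder continuous functions on \<open>G\<close>.\<close>

definition holder_on :: "real \<Rightarrow> (real^3) set \<Rightarrow> (real^3 \<Rightarrow> complex) \<Rightarrow> bool" where
  "holder_on \<alpha> G u \<longleftrightarrow> bounded (u ` G) \<and>
     (\<exists>C. \<forall>x\<in>G. \<forall>y\<in>G. norm (u x - u y) \<le> C * dist x y powr \<alpha>)"

text \<open>\<open>C\<^sup>1\<^sup>,\<^sup>\<alpha>\<close> of the closure of the open set \<open>D\<close>: the first derivatives, which exist in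
  \<open>D\<close>, extend to \<open>C\<^sup>0\<^sup>,\<^sup>\<alpha>\<close> functions on the closure. Functions are total, but only their
  values on the closure of \<open>D\<close> matter.\<close>

definition C1_holder_closure :: "real \<Rightarrow> (real^3) set \<Rightarrow> (real^3 \<Rightarrow> complex) \<Rightarrow> bool" where
  "C1_holder_closure \<alpha> D u \<longleftrightarrow>
     C1_on D u \<and> continuous_on (closure D) u \<and> bounded (u ` closure D) \<and>
     (\<forall>i. \<exists>g. (\<forall>x\<in>D. g x = partial_deriv i u x) \<and> holder_on \<alpha> (closure D) g)"


section \<open>Surfaces and normals\<close>

text \<open>\<open>C\<^sup>2\<close> boundaries and surfaces are locally graphs, over the plane orthogonal to a coordinate
  axis \<open>i\<close>, of a \<open>C\<^sup>2\<close> function of the two other coordinates; such a function is encoded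
  as a function on the whole space that does not depend on the \<open>i\<close>-th coordinate.\<close>

definition C2_graph_function :: "3 \<Rightarrow> (real^3 \<Rightarrow> real) \<Rightarrow> bool" where
  "C2_graph_function i \<gamma> \<longleftrightarrow> C2_on UNIV \<gamma> \<and> (\<forall>y t. \<gamma> (y + t *\<^sub>R axis i 1) = \<gamma> y)"

definition C2_boundary :: "(real^3) set \<Rightarrow> bool" where
  "C2_boundary D \<longleftrightarrow>
     (\<forall>x\<in>frontier D. \<exists>r>0. \<exists>i \<gamma>. \<exists>s\<in>{1, -1}. C2_graph_function i \<gamma> \<and>
        D \<inter> ball x r = {y \<in> ball x r. s * y $ i > \<gamma> y})"

definition closed_C2_surface :: "(real^3) set \<Rightarrow> bool" where
  "closed_C2_surface S \<longleftrightarrow> compact S \<and>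
     (\<forall>x\<in>S. \<exists>r>0. \<exists>i \<gamma>. C2_graph_function i \<gamma> \<and>
        S \<inter> ball x r = {y \<in> ball x r. y $ i = \<gamma> y})"

text \<open>Velocities at \<open>x\<close> of curves in \<open>S\<close>. A curve that is only defined near \<open>t = 0\<close> can be
  extended by the constant \<open>x\<close>, as nothing is required of it away from \<open>0\<close>.\<close>

definition tangent_vectors :: "(real^3) set \<Rightarrow> real^3 \<Rightarrow> (real^3) set" where
  "tangent_vectors S x =
     {\<tau>. \<exists>c. (\<forall>t. c t \<in> S) \<and> c 0 = x \<and> (c has_vector_derivative \<tau>) (at (0::real))}"

definition unit_normal_into :: "(real^3) set \<Rightarrow> (real^3) set \<Rightarrow> (real^3 \<Rightarrow> real^3) \<Rightarrow> bool" where
  "unit_normal_into S D \<nu> \<longleftrightarrow>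
     (\<forall>x\<in>S. norm (\<nu> x) = 1 \<and> (\<forall>\<tau>\<in>tangent_vectors S x. \<nu> x \<bullet> \<tau> = 0) \<and>
        (\<exists>\<epsilon>>0. \<forall>t. 0 < t \<and> t < \<epsilon> \<longrightarrow> x + t *\<^sub>R \<nu> x \<in> D))"

text \<open>The one-sided normal derivative at a boundary point \<open>x\<close> of \<open>D\<close>, by means of the continuous
  extension of the gradient from \<open>D\<close> to its closure.\<close>

definition normal_deriv_from ::
  "(real^3) set \<Rightarrow> (real^3 \<Rightarrow> real^3) \<Rightarrow> (real^3 \<Rightarrow> complex) \<Rightarrow> real^3 \<Rightarrow> complex" where
  "normal_deriv_from D \<nu> u x = Lim (at x within D) (\<lambda>y. frechet_derivative u (at y) (\<nu> x))"

text \<open>The normal derivative of a function that is differentiable at the boundary point.\<close>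

definition normal_deriv :: "(real^3 \<Rightarrow> real^3) \<Rightarrow> (real^3 \<Rightarrow> complex) \<Rightarrow> real^3 \<Rightarrow> complex" where
  "normal_deriv \<nu> u x = frechet_derivative u (at x) (\<nu> x)"


section \<open>The scatterer\<close>

definition scatterer_geometry ::
  "(real^3) set \<Rightarrow> (real^3) set \<Rightarrow> (real^3) set \<Rightarrow> (real^3) set \<Rightarrow> (real^3) set \<Rightarrow> bool" where
  "scatterer_geometry \<Omega>0 \<Omega>1 \<Omega>2 S0 S1 \<longleftrightarrow>
     open \<Omega>2 \<and> bounded \<Omega>2 \<and> \<Omega>2 \<noteq> {} \<and> frontier \<Omega>2 = S1 \<and> C2_boundary \<Omega>2 \<and>
     closed_C2_surface S0 \<and> S0 \<inter> S1 = {} \<and>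
     S0 \<subseteq> - closure \<Omega>2 \<and> - closure \<Omega>2 - S0 = \<Omega>0 \<union> \<Omega>1 \<and> \<Omega>0 \<inter> \<Omega>1 = {} \<and>
     open \<Omega>0 \<and> connected \<Omega>0 \<and> \<not> bounded \<Omega>0 \<and> frontier \<Omega>0 = S0 \<and>
     open \<Omega>1 \<and> connected \<Omega>1 \<and> bounded \<Omega>1 \<and> frontier \<Omega>1 = S0 \<union> S1"

definition not_neumann_eigenvalue ::
  "real \<Rightarrow> (real^3) set \<Rightarrow> (real^3 \<Rightarrow> real^3) \<Rightarrow> (real^3 \<Rightarrow> complex) \<Rightarrow> real \<Rightarrow> bool" where
  "not_neumann_eigenvalue \<alpha> \<Omega>2 \<nu> n k2 \<longleftrightarrow>
     (\<forall>w. C2_on \<Omega>2 w \<and> C1_holder_closure \<alpha> \<Omega>2 w \<and>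
          (\<forall>x\<in>\<Omega>2. laplacian w x + of_real (k2\<^sup>2) * n x * w x = 0) \<and>
          (\<forall>x\<in>frontier \<Omega>2. normal_deriv_from \<Omega>2 \<nu> w x = 0)
          \<longrightarrow> (\<forall>x\<in>closure \<Omega>2. w x = 0))"


section \<open>The transmission problem\<close>

text \<open>The filter \<^term>\<open>at_infinity\<close> makes the limit uniform in all directions.\<close>

definition radiating :: "real \<Rightarrow> (real^3 \<Rightarrow> complex) \<Rightarrow> bool" where
  "radiating k u \<longleftrightarrow>
     ((\<lambda>x. of_real (norm x) * (frechet_derivative u (at x) (x /\<^sub>R norm x) - \<i> * of_real k * u x))
        \<longlongrightarrow> 0) at_infinity"

definition far_field_pattern :: "real \<Rightarrow> (real^3 \<Rightarrow> complex) \<Rightarrow> (real^3 \<Rightarrow> complex) \<Rightarrow> bool" where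
  "far_field_pattern k u u_inf \<longleftrightarrow>
     (\<exists>E. E \<in> O[at_infinity](\<lambda>x. of_real (1 / norm x)) \<and>
        (\<forall>\<^sub>F x in at_infinity. u x = exp (\<i> * of_real (k * norm x)) / of_real (norm x)
                                      * (u_inf (x /\<^sub>R norm x) + E x)))"

definition transmission_solution ::
  "real \<Rightarrow> real \<Rightarrow> real \<Rightarrow> real \<Rightarrow> real \<Rightarrow> real \<Rightarrow>
   (real^3) set \<Rightarrow> (real^3) set \<Rightarrow> (real^3) set \<Rightarrow> (real^3) set \<Rightarrow> (real^3) set \<Rightarrow>
   (real^3 \<Rightarrow> real^3) \<Rightarrow> (real^3 \<Rightarrow> complex) \<Rightarrow>
   (real^3 \<Rightarrow> complex) \<Rightarrow> (real^3 \<Rightarrow> complex) \<Rightarrow> (real^3 \<Rightarrow> complex) \<Rightarrow> (real^3 \<Rightarrow> complex) \<Rightarrow>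
   (real^3 \<Rightarrow> complex) \<Rightarrow> (real^3 \<Rightarrow> complex) \<Rightarrow> (real^3 \<Rightarrow> complex) \<Rightarrow> bool" where
  "transmission_solution \<alpha> k0 k1 k2 lam0 lam1 \<Omega>0 \<Omega>1 \<Omega>2 S0 S1 \<nu> n f g p q us v w \<longleftrightarrow>
     C2_on \<Omega>0 us \<and> C1_holder_closure \<alpha> \<Omega>0 us \<and>
     C2_on \<Omega>1 v \<and> C1_holder_closure \<alpha> \<Omega>1 v \<and>
     C2_on \<Omega>2 w \<and> C1_holder_closure \<alpha> \<Omega>2 w \<and>
     (\<forall>x\<in>\<Omega>0. laplacian us x + of_real (k0\<^sup>2) * us x = 0) \<and>
     (\<forall>x\<in>\<Omega>1. laplacian v x + of_real (k1\<^sup>2) * v x = 0) \<and>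
     (\<forall>x\<in>\<Omega>2. laplacian w x + of_real (k2\<^sup>2) * n x * w x = 0) \<and>
     (\<forall>x\<in>S0. us x - v x = f x \<and>
        normal_deriv_from \<Omega>0 \<nu> us x - of_real lam0 * normal_deriv_from \<Omega>1 \<nu> v x = g x) \<and>
     (\<forall>x\<in>S1. v x - w x = p x \<and>
        normal_deriv_from \<Omega>1 \<nu> v x - of_real lam1 * normal_deriv_from \<Omega>2 \<nu> w x = q x) \<and>
     radiating k0 us"


section \<open>Incident fields\<close>

definition plane_wave :: "real \<Rightarrow> real^3 \<Rightarrow> real^3 \<Rightarrow> complex" where
  "plane_wave k d x = exp (\<i> * of_real (k * (x \<bullet> d)))"

definition point_source :: "real \<Rightarrow> real^3 \<Rightarrow> real^3 \<Rightarrow> complex" where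
  "point_source k z x = exp (\<i> * of_real (k * norm (x - z))) / of_real (4 * pi * norm (x - z))"

end

theory Submission imports Defs
begin

text \<open>For two total fields \<open>U\<close>, \<open>W\<close> the field \<open>a (W \<nabla>U - U \<nabla>W)\<close>, with the weight \<open>a = 1\<close>, \<open>\<lambda>\<^sub>0\<close>,
  \<open>\<lambda>\<^sub>0 \<lambda>\<^sub>1\<close> in \<open>\<Omega>\<^sub>0\<close>, \<open>\<Omega>\<^sub>1\<close>, \<open>\<Omega>\<^sub>2\<close>, is divergence free off the sources and has matching normal
  components on the interfaces. Surface integrals are avoided: such a field is divergence free in the
  sense of distributions, as one sees by testing with cutoffs of width \<open>\<epsilon>\<close> on both sides of an
  interface and shifting one collar onto the other. Flux through a closed surface then becomes the
  pairing with the gradient of a cutoff function.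

  For \<open>U\<close> due to the plane wave with direction \<open>-d\<close> and \<open>W\<close> due to the point source at \<open>z\<close>, a
  cutoff that is 1 near the scatterer and \<open>z\<close> gives \<open>a \<kappa> U(z)\<close> from the singularity at \<open>z\<close>. The
  same pairing lives in a shell outside the scatterer; there the scattered part of \<open>U\<close> contributes
  nothing, because it radiates like \<open>W\<close>. The plane wave part is the limit, for \<open>\<rho> \<rightarrow> \<infinity>\<close>, of
  \<open>4 \<pi> \<rho> exp (- i k \<rho>)\<close> times point sources at \<open>\<rho> d\<close>, whose pairing with \<open>W\<close> is \<open>\<kappa> W(\<rho> d)\<close>, so it
  gives \<open>4 \<pi> \<kappa>\<close> times the far field of \<open>W\<close>. The constant \<open>\<kappa>\<close> occurs on both sides, and all that is
  needed about it is \<open>\<kappa> \<noteq> 0\<close>.\<close>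

section \<open>Functions with continuous gradient\<close>

text \<open>Up to an interface the fields are only known to be C^1 from each side; their second
  derivatives are not controlled there, and normal derivatives are one-sided limits. So the Green
  identity is available only inside the regions. Tested against compactly supported C^1 functions it
  needs nothing more at the interface than continuity from each side and agreement of the normal
  fluxes. The weights are forced by the transmission conditions: the normal derivative on S0 jumps
  by the factor \<open>lam0\<close>, that on S1 by \<open>lam1\<close>, and the weights turn these
  jumps into equal fluxes. A source in \<Omega>1 thus has a residue with the weight of \<Omega>1,
  which is the origin of the factor \<open>lam0\<close> in the second formula. For z in \<Omega>0
  the field W contains the point source itself, whose far field is 1 / (4 \<pi>) times a plane wave
  in z. The same plane wave value is part of U(z), so it cancels and the scattered fields alone
  remain. For z in \<Omega>1 nothing is added to the scattered field in \<Omega>0 and there is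
  nothing to cancel.\<close>

definition C1_grad :: "(real^3) set \<Rightarrow> (real^3 \<Rightarrow> 'a::real_normed_vector) \<Rightarrow> (3 \<Rightarrow> real^3 \<Rightarrow> 'a) \<Rightarrow> bool" where
  "C1_grad D u G \<longleftrightarrow>
     (\<forall>x\<in>D. (u has_derivative (\<lambda>h. \<Sum>j\<in>UNIV. h $ j *\<^sub>R G j x)) (at x)) \<and>
     (\<forall>j. continuous_on D (G j))"

lemma C1_gradD:
  assumes "C1_grad D u G" "x \<in> D"
  shows "(u has_derivative (\<lambda>h. \<Sum>j\<in>UNIV. h $ j *\<^sub>R G j x)) (at x)"
  using assms unfolding C1_grad_def by blast

lemma C1_grad_continuous_grad: "C1_grad D u G \<Longrightarrow> continuous_on D (G j)"
  unfolding C1_grad_def by blast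

lemma C1_grad_continuous: "C1_grad D u G \<Longrightarrow> continuous_on D u"
  by (meson C1_gradD continuous_at_imp_continuous_on has_derivative_continuous)

lemma C1_grad_subset: "C1_grad D u G \<Longrightarrow> E \<subseteq> D \<Longrightarrow> C1_grad E u G"
  unfolding C1_grad_def by (meson continuous_on_subset subsetD)

lemma sum_axis: "(\<Sum>j\<in>UNIV. axis i (1::real) $ j *\<^sub>R f j) = (f i :: 'a::real_vector)"
proof -
  have "(\<Sum>j\<in>UNIV. axis i (1::real) $ j *\<^sub>R f j) = (\<Sum>j\<in>UNIV. if j = i then f j else 0)"
    by (intro sum.cong) (auto simp: axis_def)
  then show ?thesis by simp
qed

lemma C1_grad_frechet:
  assumes "C1_grad D u G" "x \<in> D"
  shows "frechet_derivative u (at x) h = (\<Sum>j\<in>UNIV. h $ j *\<^sub>R G j x)"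
  by (subst frechet_derivative_at[OF C1_gradD[OF assms], symmetric]) simp

lemma C1_grad_partial_deriv:
  assumes "C1_grad D u G" "x \<in> D"
  shows "partial_deriv j u x = G j x"
  unfolding partial_deriv_def C1_grad_frechet[OF assms] by (rule sum_axis)

lemma linear_vec_expansion:
  assumes "linear (f :: real^3 \<Rightarrow> 'a::real_vector)"
  shows "f h = (\<Sum>j\<in>UNIV. h $ j *\<^sub>R f (axis j 1))"
proof -
  have "h = (\<Sum>j\<in>UNIV. h $ j *\<^sub>R axis j 1)"
    using basis_expansion[of h] by (simp add: scalar_mult_eq_scaleR)
  then have "f h = f (\<Sum>j\<in>UNIV. h $ j *\<^sub>R axis j 1)" by simp
  also have "\<dots> = (\<Sum>j\<in>UNIV. h $ j *\<^sub>R f (axis j 1))"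
    by (simp add: linear_sum[OF assms] linear_cmul[OF assms])
  finally show ?thesis .
qed

lemma C1_gradI_partial:
  assumes "\<And>x. x \<in> D \<Longrightarrow> (u has_derivative L x) (at x)"
    and "\<And>x j. x \<in> D \<Longrightarrow> L x (axis j 1) = G j x"
    and "\<And>j. continuous_on D (G j)"
  shows "C1_grad D u G"
  unfolding C1_grad_def
proof (intro conjI ballI allI)
  fix x assume x: "x \<in> D"
  have "L x h = (\<Sum>j\<in>UNIV. h $ j *\<^sub>R G j x)" for h
    using linear_vec_expansion[OF has_derivative_linear[OF assms(1)[OF x]], of h] assms(2)[OF x] by simp
  then show "(u has_derivative (\<lambda>h. \<Sum>j\<in>UNIV. h $ j *\<^sub>R G j x)) (at x)"
    using assms(1)[OF x] by presburger
qed (use assms(3) in auto)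

lemma C1_on_imp_C1_grad: "C1_on D u \<Longrightarrow> C1_grad D u (\<lambda>j. partial_deriv j u)"
  unfolding C1_on_def
  by (rule C1_gradI_partial[where L = "\<lambda>x. frechet_derivative u (at x)"])
     (auto simp: frechet_derivative_works partial_deriv_def)

lemma C1_grad_cong:
  assumes "C1_grad D u G" "open D" "\<And>x. x \<in> D \<Longrightarrow> u x = v x" "\<And>x j. x \<in> D \<Longrightarrow> G j x = H j x"
  shows "C1_grad D v H"
  unfolding C1_grad_def
proof (intro conjI ballI allI)
  fix x assume x: "x \<in> D"
  show "(v has_derivative (\<lambda>h. \<Sum>j\<in>UNIV. h $ j *\<^sub>R H j x)) (at x)"
    using has_derivative_transform_within_open[OF C1_gradD[OF assms(1) x] assms(2) x] assms(3,4) x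
    by simp
next
  fix j show "continuous_on D (H j)"
    using C1_grad_continuous_grad[OF assms(1), of j] assms(4) by (metis continuous_on_cong)
qed

lemma C1_grad_const: "C1_grad D (\<lambda>x. c) (\<lambda>j x. 0)"
  unfolding C1_grad_def by simp

lemma C1_grad_add:
  assumes "C1_grad D u G" "C1_grad D v H"
  shows "C1_grad D (\<lambda>x. u x + v x) (\<lambda>j x. G j x + H j x)"
  by (rule C1_gradI_partial[where L = "\<lambda>x h. (\<Sum>j\<in>UNIV. h $ j *\<^sub>R G j x) + (\<Sum>j\<in>UNIV. h $ j *\<^sub>R H j x)"])
     (use assms in \<open>auto intro!: derivative_eq_intros continuous_intros dest: C1_gradD simp: C1_grad_continuous_grad sum_axis\<close>)

lemma C1_grad_bilinear:
  assumes b: "bounded_bilinear B" and u: "C1_grad D u G" and v: "C1_grad D v H"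
  shows "C1_grad D (\<lambda>x. B (u x) (v x)) (\<lambda>j x. B (u x) (H j x) + B (G j x) (v x))"
proof (rule C1_gradI_partial)
  fix x assume x: "x \<in> D"
  show "((\<lambda>x. B (u x) (v x)) has_derivative
      (\<lambda>h. B (u x) (\<Sum>j\<in>UNIV. h $ j *\<^sub>R H j x) + B (\<Sum>j\<in>UNIV. h $ j *\<^sub>R G j x) (v x))) (at x)"
    by (rule bounded_bilinear.FDERIV[OF b C1_gradD[OF u x] C1_gradD[OF v x]])
next
  fix j
  show "continuous_on D (\<lambda>x. B (u x) (H j x) + B (G j x) (v x))"
    by (intro continuous_on_add bounded_bilinear.continuous_on[OF b]
        C1_grad_continuous_grad[OF u] C1_grad_continuous_grad[OF v] C1_grad_continuous[OF u] C1_grad_continuous[OF v])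
qed (simp add: sum_axis)

lemmas C1_grad_mult = C1_grad_bilinear[OF bounded_bilinear_mult]
lemmas C1_grad_scaleR = C1_grad_bilinear[OF bounded_bilinear_scaleR]

lemma C1_grad_linear:
  assumes f: "bounded_linear f" and u: "C1_grad D u G"
  shows "C1_grad D (\<lambda>x. f (u x)) (\<lambda>j x. f (G j x))"
proof (rule C1_gradI_partial)
  fix x assume x: "x \<in> D"
  show "((\<lambda>x. f (u x)) has_derivative (\<lambda>h. f (\<Sum>j\<in>UNIV. h $ j *\<^sub>R G j x))) (at x)"
    by (rule bounded_linear.has_derivative[OF f C1_gradD[OF u x]])
qed (simp_all add: sum_axis bounded_linear.continuous_on[OF f C1_grad_continuous_grad[OF u]])

lemma C1_grad_cmult:
  fixes u :: "real^3 \<Rightarrow> 'a::real_normed_algebra"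
  shows "C1_grad D u G \<Longrightarrow> C1_grad D (\<lambda>x. c * u x) (\<lambda>j x. c * G j x)"
  by (rule C1_grad_linear[OF bounded_linear_mult_right])

lemma C1_grad_minus: "C1_grad D u G \<Longrightarrow> C1_grad D (\<lambda>x. - u x) (\<lambda>j x. - G j x)"
  by (rule C1_grad_linear[OF bounded_linear_minus[OF bounded_linear_ident]])

lemma C1_grad_diff:
  assumes "C1_grad D u G" "C1_grad D v H"
  shows "C1_grad D (\<lambda>x. u x - v x) (\<lambda>j x. G j x - H j x)"
  using C1_grad_add[OF assms(1) C1_grad_minus[OF assms(2)]] by simp

lemma C1_grad_compose:
  fixes u :: "real^3 \<Rightarrow> real"
  assumes u: "C1_grad D u G"
    and f: "\<And>x. x \<in> D \<Longrightarrow> (f has_vector_derivative f' (u x)) (at (u x))"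
    and cont: "continuous_on (u ` D) f'"
  shows "C1_grad D (\<lambda>x. f (u x)) (\<lambda>j x. G j x *\<^sub>R f' (u x))"
proof (rule C1_gradI_partial)
  fix x assume x: "x \<in> D"
  show "((\<lambda>x. f (u x)) has_derivative (\<lambda>h. (\<Sum>j\<in>UNIV. h $ j *\<^sub>R G j x) *\<^sub>R f' (u x))) (at x)"
    using has_derivative_compose[OF C1_gradD[OF u x] f[OF x, unfolded has_vector_derivative_def]] .
next
  fix j show "continuous_on D (\<lambda>x. G j x *\<^sub>R f' (u x))"
    by (intro continuous_on_scaleR C1_grad_continuous_grad[OF u] continuous_on_compose2[OF cont C1_grad_continuous[OF u]]) auto
next
  fix x j
  show "(\<Sum>ja\<in>UNIV. axis j 1 $ ja *\<^sub>R G ja x) *\<^sub>R f' (u x) = G j x *\<^sub>R f' (u x)"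
    by (simp only: sum_axis)
qed

lemma C1_grad_unique:
  assumes "C1_grad D u G" "C1_grad E u H" "x \<in> D" "x \<in> E"
  shows "G j x = H j x"
  using C1_grad_partial_deriv assms by metis

lemma C1_grad_zero_outside:
  assumes "C1_grad UNIV u G" "closed K" "\<And>x. x \<notin> K \<Longrightarrow> u x = 0" "x \<notin> K"
  shows "G j x = 0"
proof -
  have "C1_grad (- K) (\<lambda>x. 0) G"
    by (rule C1_grad_cong[OF C1_grad_subset[OF assms(1)]]) (use assms in auto)
  from C1_grad_unique[OF this C1_grad_const] show ?thesis using assms(4) by blast
qed

lemma C1_grad_Un:
  assumes "C1_grad D u G" "C1_grad E u G" "open D" "open E"
  shows "C1_grad (D \<union> E) u G"
  using assms unfolding C1_grad_def by (auto intro: continuous_on_open_Un)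

lemma C1_grad_component: "C1_grad UNIV (\<lambda>x. x $ i) (\<lambda>j x. if j = i then 1 else 0)"
  by (rule C1_gradI_partial[where L = "\<lambda>x h. h $ i"])
     (auto intro!: bounded_linear_imp_has_derivative bounded_linear_vec_nth simp: axis_def)

lemma C1_grad_inner: "C1_grad UNIV (\<lambda>x. x \<bullet> d) (\<lambda>j x. d $ j)"
  by (rule C1_gradI_partial[where L = "\<lambda>x h. h \<bullet> d"])
     (auto intro!: derivative_eq_intros simp: inner_axis' )

lemma C1_grad_norm2: "C1_grad UNIV (\<lambda>x. (x - z) \<bullet> (x - z)) (\<lambda>j x. 2 * (x - z) $ j)"
  by (rule C1_gradI_partial[where L = "\<lambda>x h. 2 * ((x - z) \<bullet> h)"])
     (auto intro!: derivative_eq_intros continuous_intros simp: inner_axis inner_axis' inner_commute algebra_simps fun_eq_iff)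


section \<open>Divergence-free fields\<close>

lemma has_bochner_integral_translate:
  fixes f :: "'a::euclidean_space \<Rightarrow> 'b::{banach, second_countable_topology}"
  assumes "has_bochner_integral lborel f c"
  shows "has_bochner_integral lborel (\<lambda>x. f (x + a)) c"
proof -
  have [measurable]: "f \<in> borel_measurable borel"
    using borel_measurable_has_bochner_integral[OF assms] by simp
  have eq: "distr lborel borel (\<lambda>x. x + a) = lborel"
    using lborel_distr_plus[of a] by (subst add.commute)
  have "has_bochner_integral (distr lborel borel (\<lambda>x. x + a)) f c" using assms eq by simp
  then show ?thesis
    by (simp add: has_bochner_integral_iff integrable_distr_eq integral_distr)
qed

lemma integrable_continuous_compact_support:
  fixes f :: "'a::euclidean_space \<Rightarrow> 'b::{banach, second_countable_topology}"
  assumes "continuous_on UNIV f" "compact K" "\<And>x. x \<notin> K \<Longrightarrow> f x = 0"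
  shows "integrable lborel f"
proof -
  have "integrable lborel (\<lambda>x. indicator K x *\<^sub>R f x)"
    by (rule borel_integrable_compact[OF assms(2)]) (use assms(1) continuous_on_subset in blast)
  also have "(\<lambda>x. indicator K x *\<^sub>R f x) = f"
    using assms(3) by (auto simp: indicator_def)
  finally show ?thesis .
qed

text \<open>Translation invariance makes the integral of every difference quotient vanish, and the
  quotients converge to the derivative along \<open>e\<close> under a common bound. This gives
  integration by parts without iterated integrals.\<close>

lemma integral_directional_derivative_eq_0:
  fixes u :: "real^3 \<Rightarrow> 'b::{banach, second_countable_topology}"
  assumes u: "C1_grad UNIV u G" and K: "compact K" "\<And>x. x \<notin> K \<Longrightarrow> u x = 0"
  shows "has_bochner_integral lborel (\<lambda>x. \<Sum>j\<in>UNIV. e $ j *\<^sub>R G j x) 0"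
proof -
  define D where "D x = (\<Sum>j\<in>UNIV. e $ j *\<^sub>R G j x)" for x
  have contD: "continuous_on UNIV D"
    unfolding D_def by (intro continuous_intros C1_grad_continuous_grad[OF u])
  have D0: "D x = 0" if "x \<notin> K" for x
    unfolding D_def using C1_grad_zero_outside[OF u compact_imp_closed[OF K(1)] K(2) that] by simp
  have intD: "integrable lborel D"
    by (rule integrable_continuous_compact_support[OF contD K(1) D0])
  have contu: "continuous_on UNIV u" by (rule C1_grad_continuous[OF u])
  have intu: "integrable lborel u"
    by (rule integrable_continuous_compact_support[OF contu K(1,2)])
  \<comment> \<open>Steps of length at most 1 keep the supports of all shifted functions in the
    single ball \<open>B\<close>.\<close>
  define a where "a n = inverse (real (Suc n))" for n
  have a: "a n > 0" "a n \<le> 1" for n by (auto simp: a_def divide_simps)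
  have a0: "a \<longlonglongrightarrow> 0" unfolding a_def by (rule LIMSEQ_inverse_real_of_nat)
  define q where "q n x = (1 / a n) *\<^sub>R (u (x + a n *\<^sub>R e) - u x)" for n x
  have q_int: "has_bochner_integral lborel (q n) 0" for n
  proof -
    have 1: "has_bochner_integral lborel u (integral\<^sup>L lborel u)"
      using intu by (simp add: has_bochner_integral_iff)
    have "has_bochner_integral lborel (\<lambda>x. (1 / a n) *\<^sub>R (u (x + a n *\<^sub>R e) - u x)) ((1 / a n) *\<^sub>R (integral\<^sup>L lborel u - integral\<^sup>L lborel u))"
      by (intro has_bochner_integral_scaleR_right has_bochner_integral_diff has_bochner_integral_translate 1)
    then show ?thesis by (simp add: q_def[abs_def])
  qed
  have der: "((\<lambda>t. u (x + t *\<^sub>R e)) has_vector_derivative D (x + t *\<^sub>R e)) (at t)" for x t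
  proof -
    have "((\<lambda>t. x + t *\<^sub>R e) has_derivative (\<lambda>t. t *\<^sub>R e)) (at t)"
      by (auto intro!: derivative_eq_intros)
    from has_derivative_compose[OF this C1_gradD[OF u]]
    show ?thesis unfolding has_vector_derivative_def D_def
      by (simp add: scaleR_sum_right)
  qed
  have q_lim: "(\<lambda>n. q n x) \<longlonglongrightarrow> D x" for x
  proof -
    have "((\<lambda>t. norm (u (x + t *\<^sub>R e) - u x - t *\<^sub>R D x) / norm t) \<longlongrightarrow> 0) (at 0)"
      using der[of x 0] by (simp add: has_vector_derivative_def has_derivative_at)
    moreover have "filterlim a (at 0) sequentially"
      unfolding filterlim_at using a0 a(1) by (auto intro!: always_eventually simp: less_imp_neq[symmetric])
    ultimately have "(\<lambda>n. norm (u (x + a n *\<^sub>R e) - u x - a n *\<^sub>R D x) / norm (a n)) \<longlonglongrightarrow> 0"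
      by (rule filterlim_compose)
    moreover have "norm (u (x + a n *\<^sub>R e) - u x - a n *\<^sub>R D x) / norm (a n) = norm (q n x - D x)" for n
    proof -
      have "q n x - D x = (1 / a n) *\<^sub>R (u (x + a n *\<^sub>R e) - u x - a n *\<^sub>R D x)"
        using a(1)[of n] by (simp add: q_def scaleR_diff_right)
      then show ?thesis using a(1)[of n] by simp
    qed
    ultimately show ?thesis by (simp add: tendsto_norm_zero_iff LIM_zero_iff)
  qed
  obtain M where M: "\<And>x. norm (D x) \<le> M" "M \<ge> 0"
  proof -
    have "bounded (D ` K)" by (intro compact_imp_bounded compact_continuous_image K(1) continuous_on_subset[OF contD]) auto
    then obtain M where "\<And>x. x \<in> K \<Longrightarrow> norm (D x) \<le> M" by (auto simp: bounded_iff)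
    then have "\<And>x. norm (D x) \<le> max M 0" using D0 by (metis max.coboundedI1 max.cobounded2 norm_zero)
    then show ?thesis using that by (metis max.cobounded2)
  qed
  have q_bound: "norm (q n x) \<le> M * norm (1::real)" for n x
  proof -
    have "norm (u (x + a n *\<^sub>R e) - u (x + 0 *\<^sub>R e)) \<le> M * norm (a n - 0)"
    proof (rule differentiable_bound[where S = "{0..a n}"])
      show "((\<lambda>t. u (x + t *\<^sub>R e)) has_derivative (\<lambda>s. s *\<^sub>R D (x + t *\<^sub>R e))) (at t within {0..a n})" for t
        using der[of x t] unfolding has_vector_derivative_def by (rule has_derivative_at_withinI)
      show "onorm (\<lambda>s. s *\<^sub>R D (x + t *\<^sub>R e)) \<le> M" for t
      proof (rule onorm_le)
        fix s :: real
        show "norm (s *\<^sub>R D (x + t *\<^sub>R e)) \<le> M * norm s"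
          using mult_left_mono[OF M(1), of "norm s"] by (simp add: mult.commute)
      qed
    qed (use a[of n] in auto)
    then have "1 / a n * norm (u (x + a n *\<^sub>R e) - u x) \<le> M"
      using a[of n] by (simp add: field_simps)
    moreover have "norm (q n x) = 1 / a n * norm (u (x + a n *\<^sub>R e) - u x)"
      unfolding q_def norm_scaleR using a[of n] by simp
    ultimately show ?thesis by simp
  qed
  obtain r where r: "r > 0" "K \<subseteq> ball 0 r" 
    using compact_imp_bounded[OF K(1)] bounded_subset_ballD by blast
  define B where "B = cball (0::real^3) (r + norm e)"
  have q0: "q n x = 0" if "x \<notin> B" for n x
  proof -
    have "norm x > r + norm e" using that by (simp add: B_def)
    moreover have "norm (a n *\<^sub>R e) \<le> norm e" using a[of n] by (simp add: mult_left_le_one_le)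
    moreover have "norm x \<le> norm (x + a n *\<^sub>R e) + norm (a n *\<^sub>R e)"
      using norm_triangle_ineq4[of "x + a n *\<^sub>R e" "a n *\<^sub>R e"] by simp
    ultimately have "norm (x + a n *\<^sub>R e) \<ge> r" "norm x \<ge> r" using norm_ge_zero[of e] by linarith+
    then have "x + a n *\<^sub>R e \<notin> K" "x \<notin> K" using r(2) by auto
    then show ?thesis by (simp add: q_def K(2))
  qed
  have "(\<lambda>n. integral\<^sup>L lborel (q n)) \<longlonglongrightarrow> integral\<^sup>L lborel D"
  proof (rule integral_dominated_convergence[where w = "\<lambda>x. M * indicator B x"])
    show "integrable lborel (\<lambda>x. M * indicator B x)"
      using emeasure_bounded_finite[of B]
      by (intro integrable_mult_right integrable_real_indicator) (auto simp: B_def)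
    show "AE x in lborel. norm (q n x) \<le> M * indicator B x" for n
      using q_bound q0 by (auto simp: indicator_def)
    show "q n \<in> borel_measurable lborel" for n
      by (rule borel_measurable_has_bochner_integral[OF q_int])
    show "D \<in> borel_measurable lborel" by (rule borel_measurable_integrable[OF intD])
  qed (use q_lim in auto)
  moreover have "integral\<^sup>L lborel (q n) = 0" for n using q_int by (simp add: has_bochner_integral_iff)
  ultimately have "integral\<^sup>L lborel D = 0" by (simp add: LIMSEQ_const_iff)
  with intD show ?thesis unfolding has_bochner_integral_iff by (simp add: D_def[abs_def])
qed

definition test_function :: "(real^3) set \<Rightarrow> (real^3 \<Rightarrow> real) \<Rightarrow> (3 \<Rightarrow> real^3 \<Rightarrow> real) \<Rightarrow> bool" where
  "test_function V \<phi> X \<longleftrightarrow> C1_grad UNIV \<phi> X \<and> (\<exists>K. compact K \<and> K \<subseteq> V \<and> (\<forall>x. x \<notin> K \<longrightarrow> \<phi> x = 0))"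

text \<open>The distributional form of div F = 0. Integrability of the pairing is part of it, so
  that pairings can be added and subtracted although \<open>F\<close> may jump across an
  interface.\<close>

definition div_free :: "(real^3) set \<Rightarrow> (3 \<Rightarrow> real^3 \<Rightarrow> complex) \<Rightarrow> bool" where
  "div_free V F \<longleftrightarrow>
     (\<forall>\<phi> X. test_function V \<phi> X \<longrightarrow> has_bochner_integral lborel (\<lambda>x. \<Sum>j\<in>UNIV. X j x *\<^sub>R F j x) 0)"

lemma test_functionI:
  assumes "C1_grad UNIV \<phi> X" "compact K" "K \<subseteq> V" "\<And>x. x \<notin> K \<Longrightarrow> \<phi> x = 0"
  shows "test_function V \<phi> X"
  using assms unfolding test_function_def by blast

lemma test_functionE:
  assumes "test_function V \<phi> X"
  obtains K where "compact K" "K \<subseteq> V" "\<And>x. x \<notin> K \<Longrightarrow> \<phi> x = 0" "\<And>x j. x \<notin> K \<Longrightarrow> X j x = 0"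
    "C1_grad UNIV \<phi> X"
  using assms C1_grad_zero_outside[OF _ compact_imp_closed] unfolding test_function_def by metis

lemma div_freeD:
  "div_free V F \<Longrightarrow> test_function V \<phi> X \<Longrightarrow> has_bochner_integral lborel (\<lambda>x. \<Sum>j\<in>UNIV. X j x *\<^sub>R F j x) 0"
  unfolding div_free_def by blast

lemma test_function_subset: "test_function V \<phi> X \<Longrightarrow> V \<subseteq> W \<Longrightarrow> test_function W \<phi> X"
  unfolding test_function_def by blast

lemma div_free_subset: "div_free W F \<Longrightarrow> V \<subseteq> W \<Longrightarrow> div_free V F"
  unfolding div_free_def using test_function_subset by blast

lemma div_free_cong:
  assumes "div_free V F" "\<And>x j. x \<in> V \<Longrightarrow> F j x = G j x"
  shows "div_free V G"
  unfolding div_free_def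
proof (intro allI impI)
  fix \<phi> X assume t: "test_function V \<phi> X"
  then obtain K where K: "K \<subseteq> V" "\<And>x j. x \<notin> K \<Longrightarrow> X j x = 0" by (rule test_functionE) blast
  have "(\<Sum>j\<in>UNIV. X j x *\<^sub>R G j x) = (\<Sum>j\<in>UNIV. X j x *\<^sub>R F j x)" for x
  proof (cases "x \<in> V")
    case False
    then have "X j x = 0" for j using K by blast
    then show ?thesis by simp
  qed (simp add: assms(2))
  then show "has_bochner_integral lborel (\<lambda>x. \<Sum>j\<in>UNIV. X j x *\<^sub>R G j x) 0"
    using div_freeD[OF assms(1) t] by simp
qed

text \<open>The open sets \<open>D\<close> and the complement of \<open>K\<close> cover the space,
  and on their overlap the function vanishes together with its gradient.\<close>

lemma C1_grad_extend_zero: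
  fixes u :: "real^3 \<Rightarrow> 'a::real_normed_vector"
  assumes u: "C1_grad D u G" and "open D" "compact K" "K \<subseteq> D" "\<And>x. x \<in> D - K \<Longrightarrow> u x = 0"
  shows "C1_grad UNIV (\<lambda>x. if x \<in> D then u x else 0) (\<lambda>j x. if x \<in> D then G j x else 0)"
proof -
  have K: "open (- K)" using assms(3) by (simp add: compact_imp_closed open_Compl)
  have G0: "G j x = 0" if "x \<in> D - K" for x j
  proof -
    have "C1_grad (D - K) (\<lambda>x. 0) G"
      by (rule C1_grad_cong[OF C1_grad_subset[OF u]]) (use assms K in \<open>auto simp: Diff_eq\<close>)
    from C1_grad_unique[OF this C1_grad_const[of "D - K"]] show ?thesis using that by blast
  qed
  have "C1_grad (D \<union> - K) (\<lambda>x. if x \<in> D then u x else 0) (\<lambda>j x. if x \<in> D then G j x else 0)"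
  proof (rule C1_grad_Un)
    show "C1_grad D (\<lambda>x. if x \<in> D then u x else 0) (\<lambda>j x. if x \<in> D then G j x else 0)"
      by (rule C1_grad_cong[OF u assms(2)]) auto
    show "C1_grad (- K) (\<lambda>x. if x \<in> D then u x else 0) (\<lambda>j x. if x \<in> D then G j x else 0)"
      by (rule C1_grad_cong[OF C1_grad_const[of _ 0] K]) (use assms G0 in auto)
  qed (use assms K in auto)
  moreover have "D \<union> - K = UNIV" using assms(4) by blast
  ultimately show ?thesis by simp
qed

text \<open>By the product rule the pairing is the integral of the divergence of
  \<open>\<phi> F\<close>, a sum of derivatives of compactly supported functions.\<close>

lemma classical_div_free:
  assumes "open D" and F: "\<And>j. C1_grad D (F j) (DF j)" and div: "\<And>x. x \<in> D \<Longrightarrow> (\<Sum>j\<in>UNIV. DF j j x) = 0"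
  shows "div_free D F"
  unfolding div_free_def
proof (intro allI impI)
  fix \<phi> X assume "test_function D \<phi> X"
  then obtain K where K: "compact K" "K \<subseteq> D" "\<And>x. x \<notin> K \<Longrightarrow> \<phi> x = 0" "\<And>x j. x \<notin> K \<Longrightarrow> X j x = 0"
    "C1_grad UNIV \<phi> X" by (rule test_functionE) blast
  \<comment> \<open>\<open>H j i\<close> is the derivative in direction \<open>i\<close> of
    \<open>\<phi> F j\<close>, extended by 0; the divergence is the sum of its diagonal.\<close>
  define H where "H j i x = (if x \<in> D then \<phi> x *\<^sub>R DF j i x + X i x *\<^sub>R F j x else 0)" for j i x
  have H: "C1_grad UNIV (\<lambda>x. if x \<in> D then \<phi> x *\<^sub>R F j x else 0) (H j)" for j
    unfolding H_def
    by (rule C1_grad_extend_zero[OF C1_grad_scaleR[OF C1_grad_subset[OF K(5)] F] assms(1) K(1,2)]) (use K in auto)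
  have "has_bochner_integral lborel (\<lambda>x. \<Sum>j\<in>UNIV. H j j x) (\<Sum>j\<in>(UNIV::3 set). 0)"
  proof (rule has_bochner_integral_sum)
    fix j :: 3
    show "has_bochner_integral lborel (H j j) 0"
      using integral_directional_derivative_eq_0[OF H K(1), of j "axis j 1"] K(3)
      by (simp add: sum_axis)
  qed
  moreover have "(\<Sum>j\<in>UNIV. H j j x) = (\<Sum>j\<in>UNIV. X j x *\<^sub>R F j x)" for x
  proof (cases "x \<in> D")
    case True
    then show ?thesis using div[OF True]
      by (simp add: H_def sum.distrib scaleR_sum_right[symmetric])
  next
    case False
    then have "x \<notin> K" using K by blast
    then show ?thesis using False K(4) by (simp add: H_def)
  qed
  ultimately show "has_bochner_integral lborel (\<lambda>x. \<Sum>j\<in>UNIV. X j x *\<^sub>R F j x) 0" by simp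
qed

section \<open>Cutoff functions\<close>

text \<open>A quotient a^2 / (a^2 + b^2) of squared positive parts: squaring makes them C^1, and
  they never vanish together. The derivative is explicit and strictly negative between 1 and 2,
  which is what keeps the constant \<kappa> away from 0.\<close>

definition cutoff :: "real \<Rightarrow> real" where
  "cutoff s = (max 0 (2 - s))\<^sup>2 / ((max 0 (2 - s))\<^sup>2 + (max 0 (s - 1))\<^sup>2)"

definition cutoff' :: "real \<Rightarrow> real" where
  "cutoff' s = - (2 * max 0 (2 - s) * max 0 (s - 1) * (max 0 (s - 1) + max 0 (2 - s)))
     / ((max 0 (2 - s))\<^sup>2 + (max 0 (s - 1))\<^sup>2)\<^sup>2"

lemma cutoff_denominator_pos: "(max 0 (2 - s))\<^sup>2 + (max 0 (s - 1))\<^sup>2 > (0::real)"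
proof (cases "s < 2")
  case True
  then have "max 0 (2 - s) > 0" by simp
  then show ?thesis by (meson add_pos_nonneg zero_le_power2 zero_less_power)
next
  case False
  then have "max 0 (s - 1) > 0" by simp
  then show ?thesis by (meson add_nonneg_pos zero_le_power2 zero_less_power)
qed

lemma has_real_derivative_max_sq: "((\<lambda>s. (max 0 s)\<^sup>2) has_real_derivative 2 * max 0 x) (at (x::real))"
proof -
  consider "x > 0" | "x < 0" | "x = 0" by linarith
  then show ?thesis
  proof cases
    case 1
    have "((\<lambda>s. s\<^sup>2) has_real_derivative 2 * max 0 x) (at x)"
      using 1 by (auto intro!: derivative_eq_intros)
    then show ?thesis
      by (rule has_field_derivative_transform_within_open[where S = "{0<..}"]) (use 1 in auto)
  next
    case 2
    have "((\<lambda>s. 0) has_real_derivative 2 * max 0 x) (at x)"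
      using 2 by (auto intro!: derivative_eq_intros)
    then show ?thesis
      by (rule has_field_derivative_transform_within_open[where S = "{..<0}"]) (use 2 in auto)
  next
    case 3
    have "((\<lambda>h. max 0 h) \<longlongrightarrow> max 0 0) (at (0::real))" by (intro tendsto_intros)
    then have "((\<lambda>h. max 0 h) \<longlongrightarrow> 0) (at (0::real))" by simp
    moreover have "\<forall>\<^sub>F h in at 0. max 0 h = ((max 0 (x + h))\<^sup>2 - (max 0 x)\<^sup>2) / h"
      using 3 by (auto simp: eventually_at_filter power2_eq_square max_def)
    ultimately have "((\<lambda>h. ((max 0 (x + h))\<^sup>2 - (max 0 x)\<^sup>2) / h) \<longlongrightarrow> 0) (at 0)"
      by (rule Lim_transform_eventually)
    then show ?thesis using 3 by (simp add: DERIV_def)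
  qed
qed

lemma cutoff_derivative: "(cutoff has_real_derivative cutoff' s) (at s)"
proof -
  have 1: "((\<lambda>s. (max 0 (2 - s))\<^sup>2) has_real_derivative - (2 * max 0 (2 - s))) (at s)" for s :: real
  proof -
    have "((\<lambda>s. (max 0 (2 - s))\<^sup>2) has_real_derivative 2 * max 0 (2 - s) * (- 1)) (at s)"
      by (rule DERIV_chain2[where f = "\<lambda>s. (max 0 s)\<^sup>2" and g = "\<lambda>s. 2 - s"])
         (rule has_real_derivative_max_sq, auto intro!: derivative_eq_intros)
    then show ?thesis by simp
  qed
  have 2: "((\<lambda>s. (max 0 (s - 1))\<^sup>2) has_real_derivative 2 * max 0 (s - 1)) (at s)" for s :: real
  proof -
    have "((\<lambda>s. (max 0 (s - 1))\<^sup>2) has_real_derivative 2 * max 0 (s - 1) * 1) (at s)"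
      by (rule DERIV_chain2[where f = "\<lambda>s. (max 0 s)\<^sup>2" and g = "\<lambda>s. s - 1"])
         (rule has_real_derivative_max_sq, auto intro!: derivative_eq_intros)
    then show ?thesis by simp
  qed
  have e: "((- (2 * a)) * (a\<^sup>2 + b\<^sup>2) - a\<^sup>2 * (- (2 * a) + 2 * b)) = - (2 * a * b * (b + a))" for a b :: real
    by (simp add: algebra_simps power2_eq_square)
  have "(cutoff has_real_derivative
      ((- (2 * max 0 (2 - s))) * ((max 0 (2 - s))\<^sup>2 + (max 0 (s - 1))\<^sup>2) -
        (max 0 (2 - s))\<^sup>2 * (- (2 * max 0 (2 - s)) + 2 * max 0 (s - 1))) /
      (((max 0 (2 - s))\<^sup>2 + (max 0 (s - 1))\<^sup>2) * ((max 0 (2 - s))\<^sup>2 + (max 0 (s - 1))\<^sup>2))) (at s)"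
    unfolding cutoff_def[abs_def]
    by (rule DERIV_divide[OF 1 DERIV_add[OF 1 2]]) (use cutoff_denominator_pos[of s] in linarith)
  then show ?thesis unfolding e cutoff'_def by (simp only: power2_eq_square)
qed

lemma continuous_cutoff': "continuous_on A cutoff'"
  unfolding cutoff'_def[abs_def]
  using cutoff_denominator_pos by (intro continuous_intros) (metis less_irrefl power_zero_numeral zero_eq_power2)

lemma cutoff_eq_1: "s \<le> 1 \<Longrightarrow> cutoff s = 1"
  and cutoff_eq_0: "s \<ge> 2 \<Longrightarrow> cutoff s = 0"
  and cutoff'_eq_0: "s \<le> 1 \<or> s \<ge> 2 \<Longrightarrow> cutoff' s = 0"
  and cutoff'_nonpos: "cutoff' s \<le> 0"
  and cutoff_nonneg: "0 \<le> cutoff s"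
  and cutoff_le_1: "cutoff s \<le> 1"
  and cutoff'_neg: "1 < s \<Longrightarrow> s < 2 \<Longrightarrow> cutoff' s < 0"
proof -
  show "s \<le> 1 \<Longrightarrow> cutoff s = 1" "s \<ge> 2 \<Longrightarrow> cutoff s = 0" "s \<le> 1 \<or> s \<ge> 2 \<Longrightarrow> cutoff' s = 0"
    by (auto simp: cutoff_def cutoff'_def)
  show "cutoff' s \<le> 0" unfolding cutoff'_def by (intro divide_nonpos_nonneg) auto
  show "0 \<le> cutoff s" unfolding cutoff_def by simp
  show "cutoff s \<le> 1" unfolding cutoff_def using cutoff_denominator_pos[of s] by simp
  assume "1 < s" "s < 2"
  then show "cutoff' s < 0" unfolding cutoff'_def
    using cutoff_denominator_pos[of s]
    by (intro divide_neg_pos) (auto intro!: mult_pos_pos add_pos_pos)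
qed

text \<open>The squared distance is differentiable at the centre too. The transition takes place at
  distances between \<open>r\<close> and sqrt 2 times \<open>r\<close>; the estimates use the cruder
  outer radius \<open>2 * r\<close>.\<close>

definition radial_cutoff :: "real^3 \<Rightarrow> real \<Rightarrow> real^3 \<Rightarrow> real" where
  "radial_cutoff c r y = cutoff (((y - c) \<bullet> (y - c)) / r\<^sup>2)"

definition radial_cutoff_grad :: "real^3 \<Rightarrow> real \<Rightarrow> 3 \<Rightarrow> real^3 \<Rightarrow> real" where
  "radial_cutoff_grad c r j y = 2 * (y - c) $ j / r\<^sup>2 * cutoff' (((y - c) \<bullet> (y - c)) / r\<^sup>2)"

lemma C1_grad_radial_cutoff: "C1_grad UNIV (radial_cutoff c r) (radial_cutoff_grad c r)"
proof -
  have "C1_grad UNIV (\<lambda>y. ((y - c) \<bullet> (y - c)) / r\<^sup>2) (\<lambda>j y. 2 * (y - c) $ j / r\<^sup>2)"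
    using C1_grad_linear[OF bounded_linear_divide C1_grad_norm2] .
  from C1_grad_compose[OF this, of cutoff cutoff'] show ?thesis
    by (simp add: cutoff_derivative has_real_derivative_iff_has_vector_derivative[symmetric] continuous_cutoff'
        radial_cutoff_def[abs_def] radial_cutoff_grad_def[abs_def])
qed

lemma inner_self_divide_le: "r > 0 \<Longrightarrow> ((v::real^3) \<bullet> v) / r\<^sup>2 \<le> a\<^sup>2 \<longleftrightarrow> norm v \<le> \<bar>a\<bar> * r"
proof -
  assume r: "r > 0"
  have "(v \<bullet> v) / r\<^sup>2 \<le> a\<^sup>2 \<longleftrightarrow> (norm v)\<^sup>2 \<le> (\<bar>a\<bar> * r)\<^sup>2"
    using r by (simp add: dot_square_norm field_simps power_mult_distrib)
  also have "\<dots> \<longleftrightarrow> norm v \<le> \<bar>a\<bar> * r" using r by (intro power2_le_iff_abs_le[THEN trans]) auto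
  finally show ?thesis .
qed

lemma radial_cutoff_eq_1: "r > 0 \<Longrightarrow> norm (y - c) \<le> r \<Longrightarrow> radial_cutoff c r y = 1"
  using inner_self_divide_le[of r "y - c" 1] by (simp add: radial_cutoff_def cutoff_eq_1)

lemma radial_cutoff_eq_0: "r > 0 \<Longrightarrow> 2 * r \<le> norm (y - c) \<Longrightarrow> radial_cutoff c r y = 0"
proof -
  assume r: "r > 0" "2 * r \<le> norm (y - c)"
  then have "(2 * r)\<^sup>2 \<le> (norm (y - c))\<^sup>2" by (intro power_mono) auto
  then have "2 * r\<^sup>2 \<le> (norm (y - c))\<^sup>2"
    using zero_le_power2[of r] by (simp add: power_mult_distrib) (use zero_le_power2[of r] in linarith)
  then have "2 \<le> (norm (y - c))\<^sup>2 / r\<^sup>2" using r by (simp add: field_simps)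
  then show ?thesis by (simp add: radial_cutoff_def cutoff_eq_0 dot_square_norm)
qed

lemma radial_cutoff_grad_eq_0:
  assumes "r > 0" "norm (y - c) \<le> r \<or> 2 * r \<le> norm (y - c)"
  shows "radial_cutoff_grad c r j y = 0"
proof (cases "norm (y - c) \<le> r")
  case True
  then show ?thesis using inner_self_divide_le[of r "y - c" 1] assms by (simp add: radial_cutoff_grad_def cutoff'_eq_0)
next
  case False
  then have "(2 * r)\<^sup>2 \<le> (norm (y - c))\<^sup>2" using assms by (intro power_mono) auto
  then have "2 * r\<^sup>2 \<le> (norm (y - c))\<^sup>2"
    using zero_le_power2[of r] by (simp add: power_mult_distrib) (use zero_le_power2[of r] in linarith)
  then have "2 \<le> (norm (y - c))\<^sup>2 / r\<^sup>2" using assms by (simp add: field_simps)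
  then show ?thesis by (simp add: radial_cutoff_grad_def cutoff'_eq_0 dot_square_norm)
qed

lemma test_function_radial_cutoff:
  "r > 0 \<Longrightarrow> cball c (2 * r) \<subseteq> V \<Longrightarrow> test_function V (radial_cutoff c r) (radial_cutoff_grad c r)"
  by (rule test_functionI[OF C1_grad_radial_cutoff, of "cball c (2 * r)"])
     (auto simp: dist_norm norm_minus_commute intro!: radial_cutoff_eq_0)

text \<open>In place of a partition of unity, the balls of a finite cover of the support are removed
  one by one. A radial cutoff at \<open>c\<close> splits \<open>\<phi>\<close> into a part near
  \<open>c\<close> and a part that vanishes on the ball around \<open>c\<close>, so that the other
  balls cover the support of the latter.\<close>

lemma div_free_local:
  assumes "\<And>x. x \<in> \<Omega> \<Longrightarrow> \<exists>V. open V \<and> x \<in> V \<and> div_free V F"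
  shows "div_free \<Omega> F"
  unfolding div_free_def
proof (intro allI impI)
  fix \<phi> X assume "test_function \<Omega> \<phi> X"
  then obtain K where K: "compact K" "K \<subseteq> \<Omega>" "\<And>x. x \<notin> K \<Longrightarrow> \<phi> x = 0" "C1_grad UNIV \<phi> X"
    by (rule test_functionE) blast
  have "\<exists>r>0. div_free (cball x (2 * r)) F" if "x \<in> K" for x
  proof -
    obtain V where "open V" "x \<in> V" "div_free V F" using assms K(2) \<open>x \<in> K\<close> by blast
    moreover then obtain e where "e > 0" "cball x e \<subseteq> V" by (meson open_contains_cball)
    ultimately show ?thesis using div_free_subset by (intro exI[of _ "e / 2"]) auto
  qed
  then obtain r where r: "\<And>x. x \<in> K \<Longrightarrow> r x > 0" "\<And>x. x \<in> K \<Longrightarrow> div_free (cball x (2 * r x)) F"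
    by metis
  obtain A where A: "A \<subseteq> K" "finite A" "K \<subseteq> (\<Union>c\<in>A. ball c (r c))"
    by (rule compactE_image[OF K(1), of K "\<lambda>x. ball x (r x)"]) (use r in auto)
  \<comment> \<open>Test function and support are quantified here because both change when a ball is
    removed.\<close>
  have "\<forall>\<phi> X L. compact L \<longrightarrow> L \<subseteq> (\<Union>c\<in>A. ball c (r c)) \<longrightarrow> (\<forall>x. x \<notin> L \<longrightarrow> \<phi> x = 0) \<longrightarrow> C1_grad UNIV \<phi> X \<longrightarrow>
     has_bochner_integral lborel (\<lambda>x. \<Sum>j\<in>UNIV. X j x *\<^sub>R F j x) 0"
    using A(2,1)
  proof (induction A rule: finite_induct)
    case empty
    show ?case
    proof (intro allI impI)
      fix \<phi> :: "real^3 \<Rightarrow> real" and X L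
      assume "L \<subseteq> (\<Union>c\<in>{}. ball c (r c))" "\<forall>x. x \<notin> L \<longrightarrow> \<phi> x = 0" "C1_grad UNIV \<phi> X"
      then have "\<phi> = (\<lambda>x. 0)" by auto
      then have "X j x = 0" for j x
        using C1_grad_unique[OF \<open>C1_grad UNIV \<phi> X\<close>] C1_grad_const[of UNIV "0::real"] by blast
      then show "has_bochner_integral lborel (\<lambda>x. \<Sum>j\<in>UNIV. X j x *\<^sub>R F j x) 0" by (simp add: has_bochner_integral_zero)
    qed
  next
    case (insert c A)
    have c: "r c > 0" "div_free (cball c (2 * r c)) F" using r insert.prems by auto
    note IH = insert.IH[OF insert_subset[THEN iffD1, OF insert.prems, THEN conjunct2], rule_format]
    show ?case
    proof (intro allI impI)
      fix \<phi> :: "real^3 \<Rightarrow> real" and X L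
      assume L: "compact L" "L \<subseteq> (\<Union>c\<in>insert c A. ball c (r c))" "\<forall>x. x \<notin> L \<longrightarrow> \<phi> x = 0" "C1_grad UNIV \<phi> X"
      define \<psi> where "\<psi> = radial_cutoff c (r c)"
      define Y where "Y = radial_cutoff_grad c (r c)"
      have \<psi>: "C1_grad UNIV \<psi> Y" unfolding \<psi>_def Y_def by (rule C1_grad_radial_cutoff)
      have 1: "C1_grad UNIV (\<lambda>x. \<phi> x * \<psi> x) (\<lambda>j x. \<phi> x * Y j x + X j x * \<psi> x)"
        by (rule C1_grad_mult[OF L(4) \<psi>])
      have 2: "C1_grad UNIV (\<lambda>x. \<phi> x - \<phi> x * \<psi> x) (\<lambda>j x. X j x - (\<phi> x * Y j x + X j x * \<psi> x))"
        by (rule C1_grad_diff[OF L(4) 1])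
      have "test_function (cball c (2 * r c)) (\<lambda>x. \<phi> x * \<psi> x) (\<lambda>j x. \<phi> x * Y j x + X j x * \<psi> x)"
        by (rule test_functionI[OF 1, of "cball c (2 * r c)"])
           (use c in \<open>auto simp: \<psi>_def dist_norm norm_minus_commute intro!: radial_cutoff_eq_0\<close>)
      from div_freeD[OF c(2) this]
      have i1: "has_bochner_integral lborel (\<lambda>x. \<Sum>j\<in>UNIV. (\<phi> x * Y j x + X j x * \<psi> x) *\<^sub>R F j x) 0" .
      have i2: "has_bochner_integral lborel (\<lambda>x. \<Sum>j\<in>UNIV. (X j x - (\<phi> x * Y j x + X j x * \<psi> x)) *\<^sub>R F j x) 0"
      proof (rule IH[OF _ _ _ 2])
        show "compact (L - ball c (r c))" using L(1) by (simp add: compact_diff)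
        show "L - ball c (r c) \<subseteq> (\<Union>c\<in>A. ball c (r c))" using L(2) by auto
        show "\<phi> x - \<phi> x * \<psi> x = 0" if "x \<notin> L - ball c (r c)" for x
          using that L(3) c(1) radial_cutoff_eq_1[of "r c" x c]
          by (auto simp: \<psi>_def dist_norm norm_minus_commute)
      qed
      show "has_bochner_integral lborel (\<lambda>x. \<Sum>j\<in>UNIV. X j x *\<^sub>R F j x) 0"
        using has_bochner_integral_add[OF i1 i2]
        by (simp add: sum.distrib[symmetric] scaleR_add_left[symmetric] del: scaleR_add_left)
    qed
  qed
  then show "has_bochner_integral lborel (\<lambda>x. \<Sum>j\<in>UNIV. X j x *\<^sub>R F j x) 0"
    using K A by blast
qed

section \<open>Fields with matching normal components across a hypersurface\<close>

text \<open>The model is the signed height over a graph,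
  \<open>t y = s * y $ i - \<gamma> y\<close>, with \<open>e = s *\<^sub>R axis i 1\<close>. As a
  move by \<tau> times \<open>e\<close> raises \<open>t\<close> by exactly \<tau>, translations
  along \<open>e\<close> carry level sets to level sets, and the collars on the two sides of t = 0
  become translates of each other.\<close>

locale level_function =
  fixes t :: "real^3 \<Rightarrow> real" and T :: "3 \<Rightarrow> real^3 \<Rightarrow> real" and e :: "real^3"
  assumes C1: "C1_grad UNIV t T" and shift: "\<And>y \<tau>. t (y + \<tau> *\<^sub>R e) = t y + \<tau>"
begin

lemma grad_shift: "(\<Sum>j\<in>UNIV. e $ j * T j y) = 1"
proof -
  have "((\<lambda>\<tau>. y + \<tau> *\<^sub>R e) has_derivative (\<lambda>\<tau>. \<tau> *\<^sub>R e)) (at 0)"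
    by (auto intro!: derivative_eq_intros)
  from has_derivative_compose[OF this C1_gradD[OF C1]]
  have "((\<lambda>\<tau>. t (y + \<tau> *\<^sub>R e)) has_derivative (\<lambda>\<tau>. \<Sum>j\<in>UNIV. (\<tau> *\<^sub>R e) $ j *\<^sub>R T j y)) (at 0)" by simp
  moreover have "((\<lambda>\<tau>. t (y + \<tau> *\<^sub>R e)) has_derivative (\<lambda>\<tau>. \<tau>)) (at 0)"
    unfolding shift by (auto intro!: derivative_eq_intros)
  ultimately have "(\<lambda>\<tau>. \<Sum>j\<in>UNIV. (\<tau> *\<^sub>R e) $ j *\<^sub>R T j y) = (\<lambda>\<tau>. \<tau>)"
    by (rule has_derivative_unique)
  from fun_cong[OF this, of 1] show ?thesis by simp
qed

lemma continuous_level: "continuous_on A t"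
  using C1_grad_continuous[OF C1] continuous_on_subset by blast

text \<open>The factor of \<open>T\<close> in the gradient of the step
  \<open>1 - cutoff (t y / \<epsilon>)\<close>: a nonnegative layer carried by \<epsilon> \<le> t
  \<le> 2 \<epsilon>, which concentrates on t = 0 as \<epsilon> tends to 0.\<close>

definition collar :: "real \<Rightarrow> real^3 \<Rightarrow> real" where
  "collar \<epsilon> y = - cutoff' (t y / \<epsilon>) / \<epsilon>"

lemma collar_nonneg: "\<epsilon> > 0 \<Longrightarrow> collar \<epsilon> y \<ge> 0"
  unfolding collar_def using cutoff'_nonpos by (simp add: divide_nonpos_pos)

lemma collar_eq_0: "\<epsilon> > 0 \<Longrightarrow> t y \<le> \<epsilon> \<Longrightarrow> collar \<epsilon> y = 0"
  unfolding collar_def by (simp add: cutoff'_eq_0)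

lemma continuous_collar: "continuous_on A (collar \<epsilon>)"
  unfolding collar_def[abs_def] divide_inverse
  by (intro continuous_intros continuous_on_compose2[OF continuous_cutoff'[of UNIV]] continuous_level) auto

lemma C1_grad_step: "C1_grad UNIV (\<lambda>y. 1 - cutoff (t y / \<epsilon>)) (\<lambda>j y. T j y * collar \<epsilon> y)"
proof -
  have "C1_grad UNIV (\<lambda>y. t y / \<epsilon>) (\<lambda>j y. T j y / \<epsilon>)"
    using C1_grad_linear[OF bounded_linear_divide C1] .
  from C1_grad_compose[OF this, of cutoff cutoff']
  have "C1_grad UNIV (\<lambda>y. cutoff (t y / \<epsilon>)) (\<lambda>j y. T j y / \<epsilon> * cutoff' (t y / \<epsilon>))"
    by (simp add: cutoff_derivative has_real_derivative_iff_has_vector_derivative[symmetric] continuous_cutoff')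
  from C1_grad_diff[OF C1_grad_const[of UNIV 1] this] show ?thesis by (simp add: collar_def)
qed

text \<open>This step is 1 for t \<le> - 2 \<epsilon> and 0 for t \<ge> - \<epsilon>. The summand 3
  is chosen so that a shift by 3 \<epsilon> takes its transition layer onto the layer \<epsilon>
  \<le> t \<le> 2 \<epsilon> of \<open>collar\<close>.\<close>

lemma C1_grad_step_shifted:
  assumes "\<epsilon> > 0"
  shows "C1_grad UNIV (\<lambda>y. cutoff (t y / \<epsilon> + 3)) (\<lambda>j y. - (T j y * collar \<epsilon> (y + (3 * \<epsilon>) *\<^sub>R e)))"
proof -
  have "C1_grad UNIV (\<lambda>y. t y / \<epsilon> + 3) (\<lambda>j y. T j y / \<epsilon> + 0)"
    by (intro C1_grad_add C1_grad_const C1_grad_linear[OF bounded_linear_divide C1])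
  from C1_grad_compose[OF this, of cutoff cutoff']
  have "C1_grad UNIV (\<lambda>y. cutoff (t y / \<epsilon> + 3)) (\<lambda>j y. T j y / \<epsilon> * cutoff' (t y / \<epsilon> + 3))"
    by (simp add: cutoff_derivative has_real_derivative_iff_has_vector_derivative[symmetric] continuous_cutoff')
  then show ?thesis using assms by (simp add: collar_def shift add_divide_distrib)
qed

text \<open>The collar integral is bounded by moving the derivative in direction \<open>e\<close> to the weight.\<close>

lemma collar_integral_bound:
  assumes \<psi>: "C1_grad UNIV \<psi> Y" "compact K" "\<And>y. y \<notin> K \<Longrightarrow> \<psi> y = 0"
  shows "\<exists>M. \<forall>\<epsilon>>0. integrable lborel (\<lambda>y. \<psi> y * collar \<epsilon> y) \<and> (\<integral>y. \<psi> y * collar \<epsilon> y \<partial>lborel) \<le> M"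
proof (intro exI allI impI conjI)
  fix \<epsilon> :: real assume "\<epsilon> > 0"
  define s where "s y = 1 - cutoff (t y / \<epsilon>)" for y
  define D where "D y = (\<Sum>j\<in>UNIV. e $ j * Y j y)" for y
  have Y0: "Y j y = 0" if "y \<notin> K" for j y
    using C1_grad_zero_outside[OF \<psi>(1) compact_imp_closed[OF \<psi>(2)] \<psi>(3) that] .
  have D0: "D y = 0" if "y \<notin> K" for y using Y0[OF that] by (simp add: D_def)
  have s: "C1_grad UNIV s (\<lambda>j y. T j y * collar \<epsilon> y)" unfolding s_def by (rule C1_grad_step)
  show int: "integrable lborel (\<lambda>y. \<psi> y * collar \<epsilon> y)"
    by (rule integrable_continuous_compact_support[OF _ \<psi>(2)])
       (auto intro!: continuous_intros continuous_collar C1_grad_continuous[OF \<psi>(1)] simp: \<psi>(3))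
  have contD: "continuous_on UNIV D" unfolding D_def
    by (intro continuous_intros C1_grad_continuous_grad[OF \<psi>(1)])
  have intD: "integrable lborel D"
    by (rule integrable_continuous_compact_support[OF contD \<psi>(2) D0])
  have intsD: "integrable lborel (\<lambda>y. s y * D y)"
    by (rule integrable_continuous_compact_support[OF _ \<psi>(2)])
       (auto intro!: continuous_intros contD C1_grad_continuous[OF s] simp: D0)
  have "has_bochner_integral lborel (\<lambda>y. \<Sum>j\<in>UNIV. e $ j *\<^sub>R (\<psi> y * (T j y * collar \<epsilon> y) + Y j y * s y)) 0"
    by (rule integral_directional_derivative_eq_0[OF C1_grad_mult[OF \<psi>(1) s] \<psi>(2)]) (simp add: \<psi>(3))
  \<comment> \<open>Along \<open>e\<close> the function \<open>t\<close> grows with unit speed, so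
    the factors \<open>T\<close> sum up to 1 and leave the bare collar.\<close>
  also have "(\<lambda>y. \<Sum>j\<in>UNIV. e $ j *\<^sub>R (\<psi> y * (T j y * collar \<epsilon> y) + Y j y * s y)) = (\<lambda>y. \<psi> y * collar \<epsilon> y + s y * D y)"
  proof
    fix y
    have "(\<Sum>j\<in>UNIV. e $ j *\<^sub>R (\<psi> y * (T j y * collar \<epsilon> y) + Y j y * s y))
        = \<psi> y * collar \<epsilon> y * (\<Sum>j\<in>UNIV. e $ j * T j y) + s y * D y"
      unfolding D_def sum_distrib_left sum.distrib[symmetric] by (intro sum.cong) (auto simp: algebra_simps)
    then show "(\<Sum>j\<in>UNIV. e $ j *\<^sub>R (\<psi> y * (T j y * collar \<epsilon> y) + Y j y * s y)) = \<psi> y * collar \<epsilon> y + s y * D y"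
      by (simp add: grad_shift)
  qed
  finally have "(\<integral>y. \<psi> y * collar \<epsilon> y + s y * D y \<partial>lborel) = 0" by (simp add: has_bochner_integral_iff)
  then have "(\<integral>y. \<psi> y * collar \<epsilon> y \<partial>lborel) = - (\<integral>y. s y * D y \<partial>lborel)"
    using int intsD by simp
  also have "\<dots> \<le> norm (\<integral>y. s y * D y \<partial>lborel)" by simp
  also have "\<dots> \<le> (\<integral>y. norm (s y * D y) \<partial>lborel)" by (rule integral_norm_bound)
  also have "\<dots> \<le> (\<integral>y. norm (D y) \<partial>lborel)"
  proof (rule integral_mono)
    fix y
    have "\<bar>s y\<bar> \<le> 1" using cutoff_nonneg[of "t y / \<epsilon>"] cutoff_le_1[of "t y / \<epsilon>"] by (simp add: s_def)
    then show "norm (s y * D y) \<le> norm (D y)" by (simp add: abs_mult mult_left_le_one_le)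
  qed (use intD intsD in auto)
  finally show "(\<integral>y. \<psi> y * collar \<epsilon> y \<partial>lborel) \<le> (\<integral>y. norm (\<Sum>j\<in>UNIV. e $ j * Y j y) \<partial>lborel)"
    by (simp add: D_def)
qed

text \<open>A layer whose mass stays bounded is tested against the increment of a uniformly
  continuous function over a distance that tends to 0.\<close>

lemma collar_shift_difference_tendsto_0:
  fixes Q :: "real^3 \<Rightarrow> complex"
  assumes Q: "continuous_on UNIV Q" "compact K" "\<And>y. y \<notin> K \<Longrightarrow> Q y = 0"
    and \<epsilon>: "\<epsilon> \<longlonglongrightarrow> 0" "\<And>n. 0 < \<epsilon> n" "\<And>n. \<epsilon> n \<le> (1::real)"
  shows "(\<lambda>n. \<integral>y. collar (\<epsilon> n) y *\<^sub>R (Q y - Q (y - (3 * \<epsilon> n) *\<^sub>R e)) \<partial>lborel) \<longlonglongrightarrow> 0"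
proof -
  obtain r where r: "r > 0" "\<And>y. y \<in> K \<Longrightarrow> norm y \<le> r"
    using compact_imp_bounded[OF Q(2)] unfolding bounded_pos by blast
  \<comment> \<open>A shift has length at most \<open>3 * norm e\<close> because
    \<open>\<epsilon> n \<le> 1\<close>. So whenever \<open>y\<close> or its shift lies in
    \<open>K\<close>, both lie in the ball of radius \<open>R\<close>.\<close>
  define R where "R = r + 6 * norm e"
  have R: "R > 0" using r(1) by (simp add: R_def add_pos_nonneg)
  define \<psi> where "\<psi> = radial_cutoff (0::real^3) R"
  have \<psi>0: "\<psi> y = 0" if "y \<notin> cball 0 (2 * R)" for y
    using that radial_cutoff_eq_0[OF R, of y 0] by (simp add: \<psi>_def)
  have \<psi>1: "\<psi> y = 1" if "norm y \<le> R" for y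
    using radial_cutoff_eq_1[OF R, of y 0] that by (simp add: \<psi>_def)
  have \<psi>_nonneg: "\<psi> y \<ge> 0" for y by (simp add: \<psi>_def radial_cutoff_def cutoff_nonneg)
  obtain M where M: "\<And>\<epsilon>. \<epsilon> > 0 \<Longrightarrow> integrable lborel (\<lambda>y. \<psi> y * collar \<epsilon> y)"
     "\<And>\<epsilon>. \<epsilon> > 0 \<Longrightarrow> (\<integral>y. \<psi> y * collar \<epsilon> y \<partial>lborel) \<le> M"
    using collar_integral_bound[OF C1_grad_radial_cutoff compact_cball[of 0 "2 * R"], of 0 R] \<psi>0
    unfolding \<psi>_def by blast
  have M0: "M \<ge> 0"
  proof -
    have "0 \<le> (\<integral>y. \<psi> y * collar 1 y \<partial>lborel)"
      by (intro Bochner_Integration.integral_nonneg) (simp add: \<psi>_nonneg collar_nonneg)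
    then show ?thesis using M(2)[of 1] by simp
  qed
  have uc: "uniformly_continuous_on (cball 0 R) Q"
    by (intro compact_uniformly_continuous continuous_on_subset[OF Q(1)]) auto
  show ?thesis
  proof (rule LIMSEQ_I)
    fix \<eta> :: real assume \<eta>: "\<eta> > 0"
    \<comment> \<open>\<open>M\<close> may be 0, hence the divisor with \<open>M + 1\<close>; the
      product of \<omega> and \<open>M\<close> is still below \<eta>.\<close>
    define \<omega> where "\<omega> = \<eta> / (2 * (M + 1))"
    have \<omega>: "\<omega> > 0" using \<eta> M0 by (simp add: \<omega>_def)
    obtain d where d: "d > 0" "\<And>x y. x \<in> cball 0 R \<Longrightarrow> y \<in> cball 0 R \<Longrightarrow> dist y x < d \<Longrightarrow> dist (Q y) (Q x) < \<omega>"
      using uc \<omega> unfolding uniformly_continuous_on_def by metis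
    have "(\<lambda>n. norm ((3 * \<epsilon> n) *\<^sub>R e)) \<longlonglongrightarrow> norm ((3 * 0) *\<^sub>R e)"
      by (intro tendsto_intros \<epsilon>(1))
    then have "\<forall>\<^sub>F n in sequentially. norm ((3 * \<epsilon> n) *\<^sub>R e) < d"
      using d(1) by (intro order_tendstoD(2)) auto
    then obtain N where N: "\<And>n. n \<ge> N \<Longrightarrow> norm ((3 * \<epsilon> n) *\<^sub>R e) < d"
      unfolding eventually_sequentially by blast
    have "norm ((\<integral>y. collar (\<epsilon> n) y *\<^sub>R (Q y - Q (y - (3 * \<epsilon> n) *\<^sub>R e)) \<partial>lborel) - 0) < \<eta>" if "n \<ge> N" for n
    proof -
      have pt: "norm (collar (\<epsilon> n) y *\<^sub>R (Q y - Q (y - (3 * \<epsilon> n) *\<^sub>R e))) \<le> \<omega> * (\<psi> y * collar (\<epsilon> n) y)" for y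
      proof (cases "y \<in> K \<or> y - (3 * \<epsilon> n) *\<^sub>R e \<in> K")
        case True
        have e3: "norm ((3 * \<epsilon> n) *\<^sub>R e) \<le> 3 * norm e"
          using \<epsilon>(2,3)[of n] by (simp add: mult_left_le_one_le)
        have "norm y \<le> r + 3 * norm e"
        proof (cases "y \<in> K")
          case True then show ?thesis using r(2)[of y] norm_ge_zero[of e] by linarith
        next
          case False
          then have "norm (y - (3 * \<epsilon> n) *\<^sub>R e) \<le> r" using True r(2) by blast
          then show ?thesis using e3 norm_triangle_ineq[of "y - (3 * \<epsilon> n) *\<^sub>R e" "(3 * \<epsilon> n) *\<^sub>R e"] by simp
        qed
        moreover then have "norm (y - (3 * \<epsilon> n) *\<^sub>R e) \<le> R"
          using e3 norm_triangle_ineq4[of y "(3 * \<epsilon> n) *\<^sub>R e"] by (simp add: R_def)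
        ultimately have y: "norm y \<le> R" "norm (y - (3 * \<epsilon> n) *\<^sub>R e) \<le> R"
          using norm_ge_zero[of e] unfolding R_def by linarith+
        have "norm (Q y - Q (y - (3 * \<epsilon> n) *\<^sub>R e)) \<le> \<omega>"
          using d(2)[of "y - (3 * \<epsilon> n) *\<^sub>R e" y] y N[OF that]
          unfolding mem_cball_0 by (simp add: dist_norm)
        then show ?thesis using \<psi>1[OF y(1)] collar_nonneg[OF \<epsilon>(2)[of n], of y]
          using mult_right_mono[of "norm (Q y - Q (y - (3 * \<epsilon> n) *\<^sub>R e))" \<omega> "collar (\<epsilon> n) y"]
          by (simp add: mult.commute)
      next
        case False
        then show ?thesis using Q(3) \<psi>_nonneg collar_nonneg[OF \<epsilon>(2)[of n], of y] \<omega> by simp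
      qed
      have "norm (\<integral>y. collar (\<epsilon> n) y *\<^sub>R (Q y - Q (y - (3 * \<epsilon> n) *\<^sub>R e)) \<partial>lborel)
          \<le> (\<integral>y. \<omega> * (\<psi> y * collar (\<epsilon> n) y) \<partial>lborel)"
      proof (rule Bochner_Integration.integral_norm_bound_integral)
        show "integrable lborel (\<lambda>y. collar (\<epsilon> n) y *\<^sub>R (Q y - Q (y - (3 * \<epsilon> n) *\<^sub>R e)))"
        proof (rule integrable_continuous_compact_support[OF _ compact_cball[of 0 "2 * R"]])
          show "continuous_on UNIV (\<lambda>y. collar (\<epsilon> n) y *\<^sub>R (Q y - Q (y - (3 * \<epsilon> n) *\<^sub>R e)))"
            by (intro continuous_intros continuous_collar continuous_on_compose2[OF Q(1)]) auto
          show "collar (\<epsilon> n) y *\<^sub>R (Q y - Q (y - (3 * \<epsilon> n) *\<^sub>R e)) = 0" if "y \<notin> cball 0 (2 * R)" for y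
            using pt[of y] unfolding \<psi>0[OF that] mult_zero_left mult_zero_right norm_le_zero_iff .
        qed
      qed (use M(1) \<epsilon>(2) pt in auto)
      also have "\<dots> \<le> \<omega> * M" using M[OF \<epsilon>(2)[of n]] \<omega> by simp
      also have "\<dots> < \<eta>" using \<eta> M0 by (simp add: \<omega>_def field_simps add_nonneg_pos)
      finally show ?thesis by simp
    qed
    then show "\<exists>N. \<forall>n\<ge>N. norm ((\<integral>y. collar (\<epsilon> n) y *\<^sub>R (Q y - Q (y - (3 * \<epsilon> n) *\<^sub>R e)) \<partial>lborel) - 0) < \<eta>"
      by blast
  qed
qed

text \<open>The test function is multiplied by two steps that vanish near the interface, one for
  each side. Besides the pairing with \<open>X\<close> this leaves the normal flux weighted by a
  collar on either side. The two collar terms have opposite signs and, after the shift, differ by an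
  increment of the continuous function \<open>Q\<close>. The value 0 on t = 0 is the pointwise limit
  of the truncated fields there, so that no argument about null sets is called for.\<close>

lemma div_free_across_level_set:
  assumes "open V"
    and Fp: "\<And>j. continuous_on (V \<inter> {y. 0 \<le> t y}) (Fp j)"
    and Fm: "\<And>j. continuous_on (V \<inter> {y. t y \<le> 0}) (Fm j)"
    and dp: "div_free (V \<inter> {y. 0 < t y}) Fp"
    and dm: "div_free (V \<inter> {y. t y < 0}) Fm"
    and jump: "\<And>y. y \<in> V \<Longrightarrow> t y = 0 \<Longrightarrow>
      (\<Sum>j\<in>UNIV. T j y *\<^sub>R Fp j y) = (\<Sum>j\<in>UNIV. T j y *\<^sub>R Fm j y)"
  shows "div_free V (\<lambda>j y. if 0 < t y then Fp j y else if t y < 0 then Fm j y else 0)"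
  unfolding div_free_def
proof (intro allI impI)
  fix \<phi> X assume "test_function V \<phi> X"
  then obtain K where K: "compact K" "K \<subseteq> V" "\<And>x. x \<notin> K \<Longrightarrow> \<phi> x = 0" "\<And>x j. x \<notin> K \<Longrightarrow> X j x = 0"
    "C1_grad UNIV \<phi> X" by (rule test_functionE) blast
  have [simp]: "x \<in> V" if "x \<in> K" for x using K(2) that by blast
  have contX: "continuous_on A (X j)" and contT: "continuous_on A (T j)" for A j
    using C1_grad_continuous_grad[OF K(5)] C1_grad_continuous_grad[OF C1] continuous_on_subset by blast+
  have contphi: "continuous_on A \<phi>" for A using C1_grad_continuous[OF K(5)] continuous_on_subset by blast
  \<comment> \<open>\<open>\<phi>\<close> times the normal flux, read off from either side;
    \<open>jump\<close> makes it continuous across t = 0.\<close>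
  define Q where "Q y = (if y \<in> V then if 0 \<le> t y then \<phi> y *\<^sub>R (\<Sum>j\<in>UNIV. T j y *\<^sub>R Fp j y)
      else \<phi> y *\<^sub>R (\<Sum>j\<in>UNIV. T j y *\<^sub>R Fm j y) else 0)" for y
  have Q0: "Q y = 0" if "y \<notin> K" for y using that by (simp add: Q_def K(3))
  have contQ: "continuous_on UNIV Q"
  proof -
    have V_eq: "V = (V \<inter> {y. 0 \<le> t y}) \<union> (V \<inter> {y. t y \<le> 0})" by auto
    have "continuous_on ((V \<inter> {y. 0 \<le> t y}) \<union> (V \<inter> {y. t y \<le> 0}))
      (\<lambda>y. if 0 \<le> t y then \<phi> y *\<^sub>R (\<Sum>j\<in>UNIV. T j y *\<^sub>R Fp j y) else \<phi> y *\<^sub>R (\<Sum>j\<in>UNIV. T j y *\<^sub>R Fm j y))"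
    proof (rule continuous_on_cases_local)
      show "closedin (top_of_set ((V \<inter> {y. 0 \<le> t y}) \<union> (V \<inter> {y. t y \<le> 0}))) (V \<inter> {y. 0 \<le> t y})"
        unfolding V_eq[symmetric]
        by (intro closedin_closed_Int closed_Collect_le continuous_on_const continuous_level)
      show "closedin (top_of_set ((V \<inter> {y. 0 \<le> t y}) \<union> (V \<inter> {y. t y \<le> 0}))) (V \<inter> {y. t y \<le> 0})"
        unfolding V_eq[symmetric]
        by (intro closedin_closed_Int closed_Collect_le continuous_on_const continuous_level)
      show "continuous_on (V \<inter> {y. 0 \<le> t y}) (\<lambda>y. \<phi> y *\<^sub>R (\<Sum>j\<in>UNIV. T j y *\<^sub>R Fp j y))"
        by (intro continuous_intros contphi contT Fp)
      show "continuous_on (V \<inter> {y. t y \<le> 0}) (\<lambda>y. \<phi> y *\<^sub>R (\<Sum>j\<in>UNIV. T j y *\<^sub>R Fm j y))"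
        by (intro continuous_intros contphi contT Fm)
    qed (use jump in force)
    then have "continuous_on V Q" unfolding V_eq[symmetric] 
      by (rule continuous_on_eq) (simp add: Q_def)
    moreover have "continuous_on (- K) Q"
      by (rule continuous_on_eq[OF continuous_on_const[of _ 0]]) (simp add: Q0)
    moreover have "open (- K)" using K(1) by (simp add: compact_imp_closed open_Compl)
    ultimately have "continuous_on (V \<union> - K) Q" using assms(1) by (intro continuous_on_open_Un)
    moreover have "V \<union> - K = UNIV" using K(2) by blast
    ultimately show ?thesis by simp
  qed
  define \<epsilon> where "\<epsilon> n = inverse (real (Suc n))" for n
  have \<epsilon>: "\<And>n. 0 < \<epsilon> n" "\<And>n. \<epsilon> n \<le> 1" "\<epsilon> \<longlonglongrightarrow> 0"
    unfolding \<epsilon>_def by (simp, simp add: divide_simps, rule LIMSEQ_inverse_real_of_nat)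
  \<comment> \<open>\<open>sp\<close> rises from 0 to 1 in \<epsilon> \<le> t \<le> 2 \<epsilon>,
    and \<open>sm\<close> does so in the mirror image of this layer; both vanish between -
    \<epsilon> and \<epsilon>.\<close>
  define sp sm where "sp n y = 1 - cutoff (t y / \<epsilon> n)" and "sm n y = cutoff (t y / \<epsilon> n + 3)" for n y
  have sp0: "sp n y = 0" if "t y \<le> \<epsilon> n" for n y
    using that \<epsilon>(1)[of n] by (simp add: sp_def cutoff_eq_1)
  have sm0: "sm n y = 0" if "t y \<ge> - \<epsilon> n" for n y
    using that \<epsilon>(1)[of n] by (simp add: sm_def cutoff_eq_0 field_simps)
  define P where "P n y = (\<Sum>j\<in>UNIV. X j y *\<^sub>R (sp n y *\<^sub>R Fp j y + sm n y *\<^sub>R Fm j y))" for n y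
  have shift_t: "t (y - \<tau> *\<^sub>R e) = t y - \<tau>" for y \<tau> using shift[of y "- \<tau>"] by simp
  have P_int: "has_bochner_integral lborel (P n)
      (- (\<integral>y. collar (\<epsilon> n) y *\<^sub>R (Q y - Q (y - (3 * \<epsilon> n) *\<^sub>R e)) \<partial>lborel))" for n
  proof -
    define d where "d = collar (\<epsilon> n)"
    have d0: "d y = 0" if "t y \<le> \<epsilon> n" for y using collar_eq_0[OF \<epsilon>(1) that] by (simp add: d_def)
    have gp: "C1_grad UNIV (\<lambda>y. \<phi> y * sp n y) (\<lambda>j y. \<phi> y * (T j y * d y) + X j y * sp n y)"
      unfolding sp_def d_def by (intro C1_grad_mult[OF K(5)] C1_grad_step)
    have gm: "C1_grad UNIV (\<lambda>y. \<phi> y * sm n y)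
        (\<lambda>j y. \<phi> y * - (T j y * d (y + (3 * \<epsilon> n) *\<^sub>R e)) + X j y * sm n y)"
      unfolding sm_def d_def by (intro C1_grad_mult[OF K(5)] C1_grad_step_shifted \<epsilon>)
    have "test_function (V \<inter> {y. 0 < t y}) (\<lambda>y. \<phi> y * sp n y) (\<lambda>j y. \<phi> y * (T j y * d y) + X j y * sp n y)"
    proof (rule test_functionI[OF gp])
      show "compact (K \<inter> {y. \<epsilon> n \<le> t y})"
        by (intro compact_Int_closed K(1) closed_Collect_le continuous_on_const continuous_level)
      show "K \<inter> {y. \<epsilon> n \<le> t y} \<subseteq> V \<inter> {y. 0 < t y}" using K(2) \<epsilon>(1)[of n] by auto
    qed (use K(3) sp0 in force)
    from div_freeD[OF dp this]
    have ip: "has_bochner_integral lborel (\<lambda>y. \<Sum>j\<in>UNIV. (\<phi> y * (T j y * d y) + X j y * sp n y) *\<^sub>R Fp j y) 0" .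
    have "test_function (V \<inter> {y. t y < 0}) (\<lambda>y. \<phi> y * sm n y)
        (\<lambda>j y. \<phi> y * - (T j y * d (y + (3 * \<epsilon> n) *\<^sub>R e)) + X j y * sm n y)"
    proof (rule test_functionI[OF gm])
      show "compact (K \<inter> {y. t y \<le> - \<epsilon> n})"
        by (intro compact_Int_closed K(1) closed_Collect_le continuous_on_const continuous_level)
      show "K \<inter> {y. t y \<le> - \<epsilon> n} \<subseteq> V \<inter> {y. t y < 0}" using K(2) \<epsilon>(1)[of n] by auto
    qed (use K(3) sm0 in force)
    from div_freeD[OF dm this]
    have im: "has_bochner_integral lborel
        (\<lambda>y. \<Sum>j\<in>UNIV. (\<phi> y * - (T j y * d (y + (3 * \<epsilon> n) *\<^sub>R e)) + X j y * sm n y) *\<^sub>R Fm j y) 0" .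
    have ep: "(\<Sum>j\<in>UNIV. (\<phi> y * (T j y * d y) + X j y * sp n y) *\<^sub>R Fp j y)
        = d y *\<^sub>R Q y + sp n y *\<^sub>R (\<Sum>j\<in>UNIV. X j y *\<^sub>R Fp j y)" for y
    proof -
      have "d y *\<^sub>R Q y = (\<phi> y * d y) *\<^sub>R (\<Sum>j\<in>UNIV. T j y *\<^sub>R Fp j y)"
        using d0[of y] \<epsilon>(1)[of n] K(3)[of y] by (cases "y \<in> K"; cases "t y \<le> \<epsilon> n") (auto simp: Q_def mult.commute)
      then show ?thesis
        by (simp add: scaleR_sum_right sum.distrib[symmetric] scaleR_add_left mult.commute mult.left_commute)
    qed
    have em: "(\<Sum>j\<in>UNIV. (\<phi> y * - (T j y * d (y + (3 * \<epsilon> n) *\<^sub>R e)) + X j y * sm n y) *\<^sub>R Fm j y)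
        = - (d (y + (3 * \<epsilon> n) *\<^sub>R e) *\<^sub>R Q y) + sm n y *\<^sub>R (\<Sum>j\<in>UNIV. X j y *\<^sub>R Fm j y)" for y
    proof -
      have "d (y + (3 * \<epsilon> n) *\<^sub>R e) *\<^sub>R Q y = (\<phi> y * d (y + (3 * \<epsilon> n) *\<^sub>R e)) *\<^sub>R (\<Sum>j\<in>UNIV. T j y *\<^sub>R Fm j y)"
      proof (cases "t y < 0")
        case False
        have "d (y + (3 * \<epsilon> n) *\<^sub>R e) = - cutoff' (t y / \<epsilon> n + 3) / \<epsilon> n"
          using \<epsilon>(1)[of n] by (simp add: d_def collar_def shift add_divide_distrib)
        also have "cutoff' (t y / \<epsilon> n + 3) = 0"
          using False \<epsilon>(1)[of n] by (intro cutoff'_eq_0 disjI2) (simp add: field_simps)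
        finally show ?thesis by simp
      qed (use K(3)[of y] in \<open>cases "y \<in> K"; auto simp: Q_def mult.commute\<close>)
      then show ?thesis
        by (simp add: scaleR_sum_right sum.distrib[symmetric] scaleR_add_left mult.commute mult.left_commute
            sum_negf[symmetric] scaleR_diff_left del: scaleR_minus_left)
    qed
    have dQ: "integrable lborel (\<lambda>y. d y *\<^sub>R Q y)"
      by (rule integrable_continuous_compact_support[OF _ K(1)])
         (auto intro!: continuous_intros continuous_collar contQ simp: d_def Q0)
    have dQ': "integrable lborel (\<lambda>y. d y *\<^sub>R Q (y - (3 * \<epsilon> n) *\<^sub>R e))"
    proof (rule integrable_continuous_compact_support)
      show "compact ((\<lambda>y. y + (3 * \<epsilon> n) *\<^sub>R e) ` K)"
        by (intro compact_continuous_image continuous_intros K(1))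
      show "continuous_on UNIV (\<lambda>y. d y *\<^sub>R Q (y - (3 * \<epsilon> n) *\<^sub>R e))"
        unfolding d_def
        by (intro continuous_intros continuous_collar continuous_on_compose2[OF contQ]) auto
      show "d y *\<^sub>R Q (y - (3 * \<epsilon> n) *\<^sub>R e) = 0" if "y \<notin> (\<lambda>y. y + (3 * \<epsilon> n) *\<^sub>R e) ` K" for y
      proof -
        have "y - (3 * \<epsilon> n) *\<^sub>R e \<notin> K"
          using that by (metis diff_add_cancel image_eqI)
        then show ?thesis by (simp add: Q0)
      qed
    qed
    have "has_bochner_integral lborel (\<lambda>y. d (y + (3 * \<epsilon> n) *\<^sub>R e) *\<^sub>R Q (y + (3 * \<epsilon> n) *\<^sub>R e - (3 * \<epsilon> n) *\<^sub>R e))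
       (\<integral>y. d y *\<^sub>R Q (y - (3 * \<epsilon> n) *\<^sub>R e) \<partial>lborel)"
      using dQ' by (intro has_bochner_integral_translate) (simp add: has_bochner_integral_iff)
    then have sh: "has_bochner_integral lborel (\<lambda>y. d (y + (3 * \<epsilon> n) *\<^sub>R e) *\<^sub>R Q y)
       (\<integral>y. d y *\<^sub>R Q (y - (3 * \<epsilon> n) *\<^sub>R e) \<partial>lborel)" by simp
    have "has_bochner_integral lborel (\<lambda>y. d y *\<^sub>R Q y) (\<integral>y. d y *\<^sub>R Q y \<partial>lborel)"
      using dQ by (simp add: has_bochner_integral_iff)
    from has_bochner_integral_add[OF has_bochner_integral_diff[OF ip this] has_bochner_integral_add[OF im sh]]
    have "has_bochner_integral lborel (P n)
        (0 - (\<integral>y. d y *\<^sub>R Q y \<partial>lborel) + (0 + (\<integral>y. d y *\<^sub>R Q (y - (3 * \<epsilon> n) *\<^sub>R e) \<partial>lborel)))"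
      unfolding ep em by (simp add: P_def[abs_def] scaleR_add_right sum.distrib scaleR_sum_right mult.commute)
    moreover have "(\<integral>y. d y *\<^sub>R (Q y - Q (y - (3 * \<epsilon> n) *\<^sub>R e)) \<partial>lborel)
        = (\<integral>y. d y *\<^sub>R Q y \<partial>lborel) - (\<integral>y. d y *\<^sub>R Q (y - (3 * \<epsilon> n) *\<^sub>R e) \<partial>lborel)"
      unfolding scaleR_diff_right using dQ dQ' by simp
    ultimately show ?thesis by (simp add: d_def)
  qed
  have lim0: "(\<lambda>n. integral\<^sup>L lborel (P n)) \<longlonglongrightarrow> 0"
  proof -
    have "(\<lambda>n. - (\<integral>y. collar (\<epsilon> n) y *\<^sub>R (Q y - Q (y - (3 * \<epsilon> n) *\<^sub>R e)) \<partial>lborel)) \<longlonglongrightarrow> - 0"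
      by (intro tendsto_minus collar_shift_difference_tendsto_0[OF contQ K(1) Q0] \<epsilon>)
    then show ?thesis using P_int by (simp add: has_bochner_integral_iff)
  qed
  define F where "F y = (\<Sum>j\<in>UNIV. X j y *\<^sub>R (if 0 < t y then Fp j y else if t y < 0 then Fm j y else 0))" for y
  have P_lim: "(\<lambda>n. P n y) \<longlonglongrightarrow> F y" for y
  proof -
    have ev: "\<forall>\<^sub>F n in sequentially. \<epsilon> n < a" if "a > 0" for a using order_tendstoD(2)[OF \<epsilon>(3) that] .
    have "\<forall>\<^sub>F n in sequentially. F y = P n y"
    proof (cases "t y = 0")
      case True
      then have "P n y = 0" for n using sp0[of y n] sm0[of n y] \<epsilon>(1)[of n] by (simp add: P_def)
      then show ?thesis using True by (simp add: F_def)
    next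
      case False
      \<comment> \<open>Once |t| exceeds twice \<open>\<epsilon> n\<close> the steps have their
        final values, so every divisor from 2 on serves.\<close>
      then have "\<forall>\<^sub>F n in sequentially. \<epsilon> n < \<bar>t y\<bar> / 5" by (intro ev) auto
      then show ?thesis
      proof eventually_elim
        case (elim n)
        show ?case
        proof (cases "t y > 0")
          case True
          then have "sm n y = 0" "sp n y = 1" using sm0[of n y] \<epsilon>(1)[of n] elim
            by (auto simp: sp_def field_simps intro!: cutoff_eq_0)
          then show ?thesis using True by (simp add: F_def P_def)
        next
          case neg: False
          then have "sp n y = 0" "sm n y = 1" using sp0[of y n] \<epsilon>(1)[of n] elim False
            by (auto simp: sm_def field_simps intro!: cutoff_eq_1)
          then show ?thesis using neg False by (simp add: F_def P_def)
        qed
      qed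
    qed
    then show ?thesis by (rule tendsto_eventually[OF eventually_mono]) auto
  qed
  \<comment> \<open>A bound uniform in \<open>n\<close> exists because the one-sided fields are
    continuous up to t = 0 and therefore bounded on both closed halves of \<open>K\<close>.\<close>
  obtain B where B: "\<And>n y. norm (P n y) \<le> B * indicator K y"
  proof -
    have "bounded ((\<lambda>y. \<Sum>j\<in>UNIV. norm (X j y *\<^sub>R Fp j y)) ` (K \<inter> {y. 0 \<le> t y}))"
      by (intro compact_imp_bounded compact_continuous_image continuous_intros contX continuous_on_subset[OF Fp]
          compact_Int_closed K(1) closed_Collect_le continuous_level) auto
    then obtain b1 where b1: "\<And>y. y \<in> K \<Longrightarrow> 0 \<le> t y \<Longrightarrow> norm (\<Sum>j\<in>UNIV. norm (X j y *\<^sub>R Fp j y)) \<le> b1"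
      unfolding bounded_iff by blast
    have "bounded ((\<lambda>y. \<Sum>j\<in>UNIV. norm (X j y *\<^sub>R Fm j y)) ` (K \<inter> {y. t y \<le> 0}))"
      by (intro compact_imp_bounded compact_continuous_image continuous_intros contX continuous_on_subset[OF Fm]
          compact_Int_closed K(1) closed_Collect_le continuous_level) auto
    then obtain b2 where b2: "\<And>y. y \<in> K \<Longrightarrow> t y \<le> 0 \<Longrightarrow> norm (\<Sum>j\<in>UNIV. norm (X j y *\<^sub>R Fm j y)) \<le> b2"
      unfolding bounded_iff by blast
    have s1: "\<bar>sp n y\<bar> \<le> 1" "\<bar>sm n y\<bar> \<le> 1" for n y
      using cutoff_nonneg cutoff_le_1 by (auto simp: sp_def sm_def)
    have "norm (P n y) \<le> (\<bar>b1\<bar> + \<bar>b2\<bar>) * indicator K y" for n y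
    proof (cases "y \<in> K")
      case False then show ?thesis using K(4) by (simp add: P_def)
    next
      case True
      show ?thesis
      proof (cases "0 \<le> t y")
        case pos: True
        then have "sm n y = 0" using sm0[of n y] \<epsilon>(1)[of n] by simp
        then have "norm (P n y) \<le> (\<Sum>j\<in>UNIV. norm (X j y *\<^sub>R Fp j y))"
          unfolding P_def using s1(1)[of n y]
          by (intro order_trans[OF norm_sum] sum_mono) (auto simp: abs_mult intro!: mult_right_mono mult_left_le)
        then show ?thesis using b1[OF True pos] True by simp
      next
        case neg: False
        then have "sp n y = 0" using sp0[of y n] \<epsilon>(1)[of n] by simp
        then have "norm (P n y) \<le> (\<Sum>j\<in>UNIV. norm (X j y *\<^sub>R Fm j y))"
          unfolding P_def using s1(2)[of n y]
          by (intro order_trans[OF norm_sum] sum_mono) (auto simp: abs_mult intro!: mult_right_mono mult_left_le)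
        then show ?thesis using b2[OF True] neg True by simp
      qed
    qed
    then show ?thesis using that by blast
  qed
  have [measurable]: "P n \<in> borel_measurable lborel" for n
    by (rule borel_measurable_has_bochner_integral[OF P_int])
  have mF: "F \<in> borel_measurable lborel"
    by (rule borel_measurable_LIMSEQ_metric[OF _ P_lim]) simp
  have dom: "integrable lborel (\<lambda>y. B * indicator K y)"
    using emeasure_bounded_finite[OF compact_imp_bounded[OF K(1)]] K(1)
    by (intro integrable_mult_right integrable_real_indicator) (auto simp: borel_compact)
  have intF: "integrable lborel F"
    by (rule integrable_dominated_convergence[OF mF _ dom, of P]) (use P_lim B in auto)
  have "(\<lambda>n. integral\<^sup>L lborel (P n)) \<longlonglongrightarrow> integral\<^sup>L lborel F"
    by (rule integral_dominated_convergence[OF mF _ dom]) (use P_lim B in auto)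
  then have "integral\<^sup>L lborel F = 0" using lim0 LIMSEQ_unique by blast
  with intF show "has_bochner_integral lborel
      (\<lambda>y. \<Sum>j\<in>UNIV. X j y *\<^sub>R (if 0 < t y then Fp j y else if t y < 0 then Fm j y else 0)) 0"
    by (simp add: has_bochner_integral_iff F_def[abs_def])
qed

end

section \<open>Local geometry of the interfaces\<close>

lemma level_function_minus:
  "level_function t T e \<Longrightarrow> level_function (\<lambda>y. - t y) (\<lambda>j y. - T j y) (- e)"
proof -
  assume "level_function t T e"
  then interpret level_function t T e .
  show ?thesis
  proof
    show "C1_grad UNIV (\<lambda>y. - t y) (\<lambda>j y. - T j y)" by (rule C1_grad_minus[OF C1])
    show "- t (y + \<tau> *\<^sub>R - e) = - t y + \<tau>" for y \<tau> using shift[of y "- \<tau>"] by simp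
  qed
qed

lemma level_function_graph:
  assumes "C2_graph_function i \<gamma>" "s \<in> {1, -1::real}"
  obtains T where "level_function (\<lambda>y. s * y $ i - \<gamma> y) T (s *\<^sub>R axis i 1)"
proof
  have g: "C1_grad UNIV \<gamma> (\<lambda>j. partial_deriv j \<gamma>)"
    using assms(1) unfolding C2_graph_function_def C2_on_def by (blast intro: C1_on_imp_C1_grad)
  show "level_function (\<lambda>y. s * y $ i - \<gamma> y)
      (\<lambda>j y. s * (if j = i then 1 else 0) - partial_deriv j \<gamma> y) (s *\<^sub>R axis i 1)"
  proof
    show "C1_grad UNIV (\<lambda>y. s * y $ i - \<gamma> y) (\<lambda>j y. s * (if j = i then 1 else 0) - partial_deriv j \<gamma> y)"
      by (intro C1_grad_diff C1_grad_cmult C1_grad_component g)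
    show "s * (y + \<tau> *\<^sub>R s *\<^sub>R axis i 1) $ i - \<gamma> (y + \<tau> *\<^sub>R s *\<^sub>R axis i 1) = s * y $ i - \<gamma> y + \<tau>" for y \<tau>
      using assms unfolding C2_graph_function_def by (auto simp: algebra_simps)
  qed
qed

context level_function
begin

lemma direction_nonzero: "e \<noteq> 0"
  using shift[of 0 1] by auto

text \<open>The point is approached along \<open>e\<close>, in which direction \<open>t\<close>
  increases.\<close>

lemma zero_in_closure_positive:
  assumes "open V" "y \<in> V" "t y = 0"
  shows "y \<in> closure (V \<inter> {y. 0 < t y})"
proof -
  have "((\<lambda>\<tau>. y + \<tau> *\<^sub>R e) \<longlongrightarrow> y + 0 *\<^sub>R e) (at_right 0)" by (intro tendsto_intros)
  then have lim: "((\<lambda>\<tau>. y + \<tau> *\<^sub>R e) \<longlongrightarrow> y) (at_right 0)" by simp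
  have "\<forall>\<^sub>F \<tau> in at_right 0. y + \<tau> *\<^sub>R e \<in> V"
    by (rule topological_tendstoD[OF lim assms(1,2)])
  moreover have "\<forall>\<^sub>F \<tau> in at_right 0. (0::real) < \<tau>" by (rule eventually_at_right_less)
  ultimately have "\<forall>\<^sub>F \<tau> in at_right 0. y + \<tau> *\<^sub>R e \<in> closure (V \<inter> {y. 0 < t y})"
    by eventually_elim (use closure_subset assms(3) shift in force)
  then show ?thesis by (intro Lim_in_closed_set[OF closed_closure _ _ lim]) auto
qed

text \<open>The shear \<open>y \<mapsto> y + (l y - t y) e\<close> with \<open>l\<close> linear flattens the level set \<open>t = 0\<close> to the
  plane \<open>l = 0\<close>; images of half balls under it are connected.\<close>

lemma adapted_neighbourhood:
  assumes "r > 0"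
  obtains V where "open V" "x \<in> V" "V \<subseteq> ball x r" "connected (V \<inter> {y. 0 < t y})" "connected (V \<inter> {y. t y < 0})"
proof -
  define l where "l y = (e \<bullet> y) / (e \<bullet> e)" for y
  define \<Psi> \<Psi>' where "\<Psi> y = y + (l y - t y) *\<^sub>R e" and "\<Psi>' y = y + (t y - l y) *\<^sub>R e" for y
  have l_shift: "l (y + \<tau> *\<^sub>R e) = l y + \<tau>" for y \<tau>
    using direction_nonzero by (simp add: l_def inner_add_right add_divide_distrib)
  have t\<Psi>: "t (\<Psi> y) = l y" for y by (simp add: \<Psi>_def shift)
  have inv1: "\<Psi> (\<Psi>' y) = y" for y
  proof -
    have "t (\<Psi>' y) = t y + (t y - l y)" "l (\<Psi>' y) = l y + (t y - l y)"
      by (simp_all only: \<Psi>'_def shift l_shift)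
    then have "\<Psi> (\<Psi>' y) = \<Psi>' y + (l y - t y) *\<^sub>R e" by (simp add: \<Psi>_def)
    then show ?thesis by (simp add: \<Psi>'_def algebra_simps)
  qed
  have inv2: "\<Psi>' (\<Psi> y) = y" for y
  proof -
    have "t (\<Psi> y) = t y + (l y - t y)" "l (\<Psi> y) = l y + (l y - t y)"
      by (simp_all only: \<Psi>_def shift l_shift)
    then have "\<Psi>' (\<Psi> y) = \<Psi> y + (t y - l y) *\<^sub>R e" by (simp add: \<Psi>'_def)
    then show ?thesis by (simp add: \<Psi>_def algebra_simps)
  qed
  have cl: "continuous_on A l" for A unfolding l_def[abs_def] divide_inverse by (intro continuous_intros)
  have c1: "continuous_on A \<Psi>" for A unfolding \<Psi>_def[abs_def] by (intro continuous_intros cl continuous_level)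
  have c2: "continuous_on A \<Psi>'" for A unfolding \<Psi>'_def[abs_def] by (intro continuous_intros cl continuous_level)
  have "open (\<Psi> -` ball x r)" by (rule open_vimage[OF open_ball c1])
  then obtain \<delta> where \<delta>: "\<delta> > 0" "ball (\<Psi>' x) \<delta> \<subseteq> \<Psi> -` ball x r"
    unfolding open_contains_ball using assms inv1 by force
  define V where "V = \<Psi>' -` ball (\<Psi>' x) \<delta>"
  have V: "V = \<Psi> ` ball (\<Psi>' x) \<delta>"
  proof (intro equalityI subsetI)
    show "y \<in> \<Psi> ` ball (\<Psi>' x) \<delta>" if "y \<in> V" for y
      using that inv1[of y] unfolding V_def by (intro image_eqI[of y \<Psi> "\<Psi>' y"]) auto
    show "y \<in> V" if "y \<in> \<Psi> ` ball (\<Psi>' x) \<delta>" for y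
      using that inv2 by (auto simp: V_def)
  qed
  have lin: "linear l" unfolding l_def
    by (intro linearI) (auto simp: inner_add_right add_divide_distrib)
  show ?thesis
  proof
    show "open V" unfolding V_def by (rule open_vimage[OF open_ball c2])
    show "x \<in> V" using \<delta> by (simp add: V_def)
    show "V \<subseteq> ball x r" using \<delta>(2) unfolding V by blast
    have "V \<inter> {y. 0 < t y} = \<Psi> ` (ball (\<Psi>' x) \<delta> \<inter> {y. 0 < l y})" unfolding V by (auto simp: t\<Psi>)
    moreover have "convex {y. 0 < l y}"
      using convex_linear_vimage[OF lin, of "{0<..}"] by (simp add: vimage_def)
    ultimately show "connected (V \<inter> {y. 0 < t y})"
      by (simp add: connected_continuous_image c1 convex_connected convex_Int)
    have "V \<inter> {y. t y < 0} = \<Psi> ` (ball (\<Psi>' x) \<delta> \<inter> {y. l y < 0})" unfolding V by (auto simp: t\<Psi>)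
    moreover have "convex {y. l y < 0}"
      using convex_linear_vimage[OF lin, of "{..<0}"] by (simp add: vimage_def)
    ultimately show "connected (V \<inter> {y. t y < 0})"
      by (simp add: connected_continuous_image c1 convex_connected convex_Int)
  qed
qed

text \<open>The curves \<open>\<tau> \<mapsto> y + \<tau> a - t (y + \<tau> a) e\<close> stay in the level set.\<close>

lemma normal_parallel_grad:
  assumes "open V" "V \<inter> {y. t y = 0} \<subseteq> S" "y \<in> V" "t y = 0"
    and normal: "\<And>\<tau>. \<tau> \<in> tangent_vectors S y \<Longrightarrow> n \<bullet> \<tau> = 0"
  shows "n \<bullet> a = (n \<bullet> e) * (\<Sum>j\<in>UNIV. a $ j * T j y)"
proof -
  define d where "d = (\<Sum>j\<in>UNIV. a $ j * T j y)"
  define u where "u \<tau> = y + \<tau> *\<^sub>R a - t (y + \<tau> *\<^sub>R a) *\<^sub>R e" for \<tau> :: real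
  have u0: "u 0 = y" using assms by (simp add: u_def)
  have tu: "t (u \<tau>) = 0" for \<tau>
    using shift[of "y + \<tau> *\<^sub>R a" "- t (y + \<tau> *\<^sub>R a)"] by (simp add: u_def)
  have cont: "continuous_on UNIV u"
    unfolding u_def[abs_def] by (intro continuous_intros continuous_on_compose2[OF continuous_level[of UNIV]]) auto
  have t_der: "((\<lambda>\<tau>. t (y + \<tau> *\<^sub>R a)) has_derivative (\<lambda>\<tau>. \<tau> * d)) (at 0)"
  proof -
    have "((\<lambda>\<tau>. y + \<tau> *\<^sub>R a) has_derivative (\<lambda>\<tau>. \<tau> *\<^sub>R a)) (at 0)"
      by (auto intro!: derivative_eq_intros)
    from has_derivative_compose[OF this C1_gradD[OF C1]]
    show ?thesis by (simp add: d_def sum_distrib_left mult.assoc)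
  qed
  have "(u has_derivative (\<lambda>\<tau>. \<tau> *\<^sub>R (a - d *\<^sub>R e))) (at 0)"
    unfolding u_def[abs_def]
    by (rule derivative_eq_intros t_der refl | simp)+ (simp add: scaleR_diff_right fun_eq_iff)
  \<comment> \<open>Membership in \<open>tangent_vectors\<close> demands a curve that stays in
    \<open>S\<close> for all times, so \<open>u\<close> is replaced by the constant \<open>y\<close>
    wherever it leaves \<open>V\<close>.\<close>
  moreover define c where "c \<tau> = (if u \<tau> \<in> V then u \<tau> else y)" for \<tau>
  moreover have "open (u -` V)" by (rule open_vimage[OF assms(1) cont])
  ultimately have "(c has_derivative (\<lambda>\<tau>. \<tau> *\<^sub>R (a - d *\<^sub>R e))) (at 0)"
    using assms(3) u0
    by (intro has_derivative_transform_within_open[of u _ 0 UNIV "u -` V" c]) (auto simp: c_def)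
  moreover have "c \<tau> \<in> S" for \<tau> using assms tu by (auto simp: c_def)
  moreover have "c 0 = y" using u0 by (simp add: c_def)
  ultimately have "a - d *\<^sub>R e \<in> tangent_vectors S y"
    unfolding tangent_vectors_def has_vector_derivative_def by blast
  from normal[OF this] show ?thesis by (simp add: inner_diff_right d_def mult.commute)
qed

end

lemma connected_subset_cases:
  assumes "connected A" "A \<subseteq> B \<union> C" "open B" "open C" "B \<inter> C = {}"
  shows "A \<subseteq> B \<or> A \<subseteq> C"
  using connectedD[OF assms(1,3,4)] assms(2,5) by blast

lemma in_frontier_meets:
  assumes "x \<in> frontier D" "open V" "x \<in> V"
  shows "V \<inter> D \<noteq> {}"
proof -
  have "x \<in> closure D" using assms(1) by (simp add: frontier_def)
  then show ?thesis using assms(2,3) by (metis IntI closure_iff_nhds_not_empty inf_commute order_refl)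
qed

text \<open>That S0 is locally a graph does not tell which region lies on which side. Off the level
  t = 0 both halves of \<open>V\<close> are connected and avoid S0, so each lies in one of the two
  regions; they lie in different ones because \<open>x\<close> is in the frontier of both. With the
  wrong orientation, \<open>t\<close> is replaced by its negative.\<close>

lemma interface_outer:
  assumes geom: "scatterer_geometry \<Omega>0 \<Omega>1 \<Omega>2 S0 S1" and x: "x \<in> S0"
  obtains V t T e where "level_function t T e" "open V" "x \<in> V"
    "V \<inter> {y. 0 < t y} \<subseteq> \<Omega>0" "V \<inter> {y. t y < 0} \<subseteq> \<Omega>1" "V \<inter> {y. t y = 0} \<subseteq> S0"
proof -
  note g = geom[unfolded scatterer_geometry_def]
  obtain r i \<gamma> where r: "r > 0" "C2_graph_function i \<gamma>" "S0 \<inter> ball x r = {y \<in> ball x r. y $ i = \<gamma> y}"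
    using g x unfolding closed_C2_surface_def by blast
  define t where "t y = 1 * y $ i - \<gamma> y" for y
  obtain T where lf: "level_function t T (1 *\<^sub>R axis i 1)"
    using level_function_graph[OF r(2), of 1] unfolding t_def by blast
  interpret level_function t T "1 *\<^sub>R axis i 1" by (rule lf)
  have "open (- closure \<Omega>2)" "x \<in> - closure \<Omega>2" using g x by auto
  then obtain r2 where r2: "r2 > 0" "ball x r2 \<subseteq> - closure \<Omega>2" by (meson open_contains_ball)
  obtain V where V: "open V" "x \<in> V" "V \<subseteq> ball x (min r r2)"
    "connected (V \<inter> {y. 0 < t y})" "connected (V \<inter> {y. t y < 0})"
    using adapted_neighbourhood[of "min r r2" x] r(1) r2(1) by auto
  have S0: "y \<in> S0 \<longleftrightarrow> t y = 0" if "y \<in> V" for y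
    using r(3)[unfolded set_eq_iff, rule_format, of y] V(3) that by (auto simp: t_def)
  have sub: "V \<inter> {y. t y \<noteq> 0} \<subseteq> \<Omega>0 \<union> \<Omega>1"
    using S0 V(3) r2(2) g by fastforce
  have op: "open \<Omega>0" "open \<Omega>1" "\<Omega>0 \<inter> \<Omega>1 = {}" "x \<in> frontier \<Omega>0" "x \<in> frontier \<Omega>1" "S0 \<inter> (\<Omega>0 \<union> \<Omega>1) = {}"
    using g x by auto
  have zero: "V \<inter> {y. t y = 0} \<subseteq> S0" using S0 by blast
  have ne: "V \<inter> \<Omega>0 \<noteq> {}" "V \<inter> \<Omega>1 \<noteq> {}" using in_frontier_meets V(1,2) op by blast+
  have p: "V \<inter> {y. 0 < t y} \<subseteq> \<Omega>0 \<or> V \<inter> {y. 0 < t y} \<subseteq> \<Omega>1"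
    by (rule connected_subset_cases[OF V(4)]) (use sub op in auto)
  have m: "V \<inter> {y. t y < 0} \<subseteq> \<Omega>0 \<or> V \<inter> {y. t y < 0} \<subseteq> \<Omega>1"
    by (rule connected_subset_cases[OF V(5)]) (use sub op in auto)
  have V_split: "y \<in> V \<inter> {y. 0 < t y} \<or> y \<in> V \<inter> {y. t y < 0} \<or> y \<in> S0" if "y \<in> V" for y
    using S0[OF that] that by force
  from p m consider "V \<inter> {y. 0 < t y} \<subseteq> \<Omega>0" "V \<inter> {y. t y < 0} \<subseteq> \<Omega>1"
    | "V \<inter> {y. 0 < t y} \<subseteq> \<Omega>1" "V \<inter> {y. t y < 0} \<subseteq> \<Omega>0"
    | "V \<inter> {y. 0 < t y} \<subseteq> \<Omega>0" "V \<inter> {y. t y < 0} \<subseteq> \<Omega>0"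
    | "V \<inter> {y. 0 < t y} \<subseteq> \<Omega>1" "V \<inter> {y. t y < 0} \<subseteq> \<Omega>1" by blast
  then show ?thesis
  proof cases
    case 1 then show ?thesis using that[OF lf V(1,2)] zero by blast
  next
    case 2 then show ?thesis using that[OF level_function_minus[OF lf] V(1,2)] zero by simp
  next
    case 3
    then have "V \<inter> \<Omega>1 = {}" using V_split op by blast
    then show ?thesis using ne by blast
  next
    case 4
    then have "V \<inter> \<Omega>0 = {}" using V_split op by blast
    then show ?thesis using ne by blast
  qed
qed

text \<open>Here \<open>C2_boundary\<close> already puts \<Omega>2 on the side t > 0. The other half
  is connected and avoids S0 and the closure of \<Omega>2, so it lies in one of the outer regions,
  namely in \<Omega>1, since \<open>x\<close> is in the frontier of \<Omega>1.\<close>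

lemma interface_inner:
  assumes geom: "scatterer_geometry \<Omega>0 \<Omega>1 \<Omega>2 S0 S1" and x: "x \<in> S1"
  obtains V t T e where "level_function t T e" "open V" "x \<in> V"
    "V \<inter> {y. 0 < t y} \<subseteq> \<Omega>2" "V \<inter> {y. t y < 0} \<subseteq> \<Omega>1" "V \<inter> {y. t y = 0} \<subseteq> S1"
proof -
  note g = geom[unfolded scatterer_geometry_def]
  obtain r i \<gamma> s where r: "r > 0" "s \<in> {1, -1}" "C2_graph_function i \<gamma>"
      "\<Omega>2 \<inter> ball x r = {y \<in> ball x r. s * y $ i > \<gamma> y}"
  proof -
    have "C2_boundary \<Omega>2" "x \<in> frontier \<Omega>2" using g x by auto
    then show ?thesis using that unfolding C2_boundary_def by blast
  qed
  define t where "t y = s * y $ i - \<gamma> y" for y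
  obtain T where lf: "level_function t T (s *\<^sub>R axis i 1)"
    using level_function_graph[OF r(3,2)] unfolding t_def by blast
  interpret level_function t T "s *\<^sub>R axis i 1" by (rule lf)
  have "closed S0" using g unfolding closed_C2_surface_def by (simp add: compact_imp_closed)
  then have "open (- S0)" "x \<in> - S0" using g x by auto
  then obtain r2 where r2: "r2 > 0" "ball x r2 \<subseteq> - S0" by (meson open_contains_ball)
  obtain V where V: "open V" "x \<in> V" "V \<subseteq> ball x (min r r2)"
    "connected (V \<inter> {y. 0 < t y})" "connected (V \<inter> {y. t y < 0})"
    using adapted_neighbourhood[of "min r r2" x] r(1) r2(1) by auto
  have O2: "y \<in> \<Omega>2 \<longleftrightarrow> 0 < t y" if "y \<in> V" for y
    using r(4)[unfolded set_eq_iff, rule_format, of y] V(3) that by (auto simp: t_def)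
  have op: "open \<Omega>0" "open \<Omega>1" "open \<Omega>2" "\<Omega>0 \<inter> \<Omega>1 = {}" "x \<in> frontier \<Omega>1" "frontier \<Omega>2 = S1"
    "- closure \<Omega>2 - S0 = \<Omega>0 \<union> \<Omega>1"
    using g x by auto
  have neg: "V \<inter> {y. t y < 0} \<subseteq> - closure \<Omega>2"
  proof -
    have "open (V \<inter> {y. t y < 0})"
      by (intro open_Int V open_Collect_less continuous_on_const continuous_level)
    moreover have "V \<inter> {y. t y < 0} \<inter> \<Omega>2 = {}" using O2 by force
    ultimately show ?thesis using open_Int_closure_eq_empty by blast
  qed
  have zero: "V \<inter> {y. t y = 0} \<subseteq> S1"
  proof
    fix y assume y: "y \<in> V \<inter> {y. t y = 0}"
    have "y \<in> closure \<Omega>2"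
      using zero_in_closure_positive[OF V(1), of y] y O2 closure_mono[of "V \<inter> {y. 0 < t y}" \<Omega>2] by auto
    moreover have "y \<notin> \<Omega>2" using O2 y by auto
    ultimately have "y \<in> frontier \<Omega>2" using op(3) by (simp add: frontier_def interior_open)
    then show "y \<in> S1" using op by simp
  qed
  have sub: "V \<inter> {y. t y < 0} \<subseteq> \<Omega>0 \<union> \<Omega>1" using neg op(7) V(3) r2(2) by fastforce
  have m: "V \<inter> {y. t y < 0} \<subseteq> \<Omega>0 \<or> V \<inter> {y. t y < 0} \<subseteq> \<Omega>1"
    by (rule connected_subset_cases[OF V(5) sub]) (use op in auto)
  obtain y where y: "y \<in> V" "y \<in> \<Omega>1" using in_frontier_meets[OF op(5) V(1,2)] by blast
  have "y \<notin> closure \<Omega>2" using y op(7) by blast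
  moreover have "S1 \<subseteq> closure \<Omega>2" using op(6) by (auto simp: frontier_def)
  moreover have "\<Omega>2 \<subseteq> closure \<Omega>2" by (rule closure_subset)
  ultimately have "t y < 0" using O2[OF y(1)] zero y(1) by (cases "t y" "0::real" rule: linorder_cases) auto
  then have "V \<inter> {y. t y < 0} \<subseteq> \<Omega>1" using m y op(4) by blast
  then show ?thesis using that[OF lf V(1,2)] zero O2 by blast
qed

section \<open>Fields with one-sided boundary values\<close>

text \<open>The coefficient is a function so that the inhomogeneous region \<Omega>2 is covered as
  well. The second derivatives stay hidden behind a quantifier, as they enter the Green identity
  only through their trace.\<close>

definition helmholtz_on :: "(real^3) set \<Rightarrow> (real^3 \<Rightarrow> complex) \<Rightarrow> (real^3 \<Rightarrow> complex) \<Rightarrow> (3 \<Rightarrow> real^3 \<Rightarrow> complex) \<Rightarrow> bool" where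
  "helmholtz_on D c u G \<longleftrightarrow> C1_grad D u G \<and>
     (\<exists>H. (\<forall>j. C1_grad D (G j) (H j)) \<and> (\<forall>x\<in>D. (\<Sum>j\<in>UNIV. H j j x) + c x * u x = 0))"

text \<open>\<open>Z\<close> holds the source points. On the boundary \<open>G\<close> is the
  continuous extension of the gradient. There \<open>u\<close>, being a total function, need not be
  differentiable, which is why the gradient is carried along as separate data.\<close>

definition boundary_field ::
  "(real^3) set \<Rightarrow> (real^3) set \<Rightarrow> (real^3 \<Rightarrow> complex) \<Rightarrow> (real^3 \<Rightarrow> complex) \<Rightarrow> (3 \<Rightarrow> real^3 \<Rightarrow> complex) \<Rightarrow> bool" where
  "boundary_field D Z c u G \<longleftrightarrow> helmholtz_on (D - Z) c u G \<and>
     continuous_on (closure D - Z) u \<and> (\<forall>j. continuous_on (closure D - Z) (G j))"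

lemma helmholtz_on_subset: "helmholtz_on D c u G \<Longrightarrow> E \<subseteq> D \<Longrightarrow> helmholtz_on E c u G"
  unfolding helmholtz_on_def by (meson C1_grad_subset subsetD)

lemma helmholtz_on_C1: "helmholtz_on D c u G \<Longrightarrow> C1_grad D u G"
  unfolding helmholtz_on_def by blast

lemma helmholtz_on_add:
  assumes "helmholtz_on D c u G" "helmholtz_on D c v H"
  shows "helmholtz_on D c (\<lambda>x. u x + v x) (\<lambda>j x. G j x + H j x)"
proof -
  obtain P where P: "\<And>j. C1_grad D (G j) (P j)" "\<And>x. x \<in> D \<Longrightarrow> (\<Sum>j\<in>UNIV. P j j x) + c x * u x = 0"
    using assms(1) unfolding helmholtz_on_def by blast
  obtain R where R: "\<And>j. C1_grad D (H j) (R j)" "\<And>x. x \<in> D \<Longrightarrow> (\<Sum>j\<in>UNIV. R j j x) + c x * v x = 0"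
    using assms(2) unfolding helmholtz_on_def by blast
  have "(\<Sum>j\<in>UNIV. P j j x + R j j x) + c x * (u x + v x) = 0" if "x \<in> D" for x
    using arg_cong2[where f = "(+)", OF P(2)[OF that] R(2)[OF that]] by (simp add: sum.distrib algebra_simps)
  then show ?thesis unfolding helmholtz_on_def
    using C1_grad_add[OF helmholtz_on_C1[OF assms(1)] helmholtz_on_C1[OF assms(2)]] C1_grad_add[OF P(1) R(1)]
    by (intro conjI exI[of _ "\<lambda>j i x. P j i x + R j i x"]) auto
qed

lemma boundary_field_add:
  assumes "boundary_field D Z c u G" "boundary_field D Z c v H"
  shows "boundary_field D Z c (\<lambda>x. u x + v x) (\<lambda>j x. G j x + H j x)"
  using assms unfolding boundary_field_def by (auto intro: helmholtz_on_add continuous_on_add)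

lemma boundary_field_mono: "boundary_field D Y c u G \<Longrightarrow> Y \<subseteq> Z \<Longrightarrow> boundary_field D Z c u G"
  unfolding boundary_field_def
  by (meson Diff_mono continuous_on_subset helmholtz_on_subset order_refl)

text \<open>Green's identity in pointwise form: B \<Delta>A - A \<Delta>B vanishes because both
  fields have the same coefficient, constant or not.\<close>

lemma helmholtz_pair_div_free:
  assumes "open D" and A: "helmholtz_on D c A GA" and B: "helmholtz_on D c B GB"
  shows "div_free D (\<lambda>j x. B x * GA j x - A x * GB j x)"
proof -
  obtain P where P: "\<And>j. C1_grad D (GA j) (P j)" "\<And>x. x \<in> D \<Longrightarrow> (\<Sum>j\<in>UNIV. P j j x) + c x * A x = 0"
    using A unfolding helmholtz_on_def by blast
  obtain R where R: "\<And>j. C1_grad D (GB j) (R j)" "\<And>x. x \<in> D \<Longrightarrow> (\<Sum>j\<in>UNIV. R j j x) + c x * B x = 0"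
    using B unfolding helmholtz_on_def by blast
  show ?thesis
  proof (rule classical_div_free[OF assms(1)])
    fix j
    show "C1_grad D (\<lambda>x. B x * GA j x - A x * GB j x)
       (\<lambda>i x. (B x * P j i x + GB i x * GA j x) - (A x * R j i x + GA i x * GB j x))"
      by (intro C1_grad_diff C1_grad_mult helmholtz_on_C1[OF A] helmholtz_on_C1[OF B] P R)
  next
    fix x assume x: "x \<in> D"
    have "(\<Sum>j\<in>UNIV. (B x * P j j x + GB j x * GA j x) - (A x * R j j x + GA j x * GB j x))
      = B x * (\<Sum>j\<in>UNIV. P j j x) - A x * (\<Sum>j\<in>UNIV. R j j x)"
      by (simp add: sum_subtractf sum.distrib sum_distrib_left mult.commute)
    also have "\<dots> = B x * (- c x * A x) - A x * (- c x * B x)"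
      using P(2)[OF x] R(2)[OF x] by (simp add: add_eq_0_iff)
    finally show "(\<Sum>j\<in>UNIV. (B x * P j j x + GB j x * GA j x) - (A x * R j j x + GA j x * GB j x)) = 0" by simp
  qed
qed

lemma holder_on_continuous:
  assumes "holder_on \<alpha> G u" "\<alpha> > 0"
  shows "continuous_on G u"
proof -
  obtain C where C: "\<And>x y. x \<in> G \<Longrightarrow> y \<in> G \<Longrightarrow> norm (u x - u y) \<le> C * dist x y powr \<alpha>"
    using assms(1) unfolding holder_on_def by blast
  show ?thesis unfolding continuous_on_def
  proof
    fix x assume x: "x \<in> G"
    have "((\<lambda>y. C * dist y x powr \<alpha>) \<longlongrightarrow> 0) (at x within G)"
    proof -
      have "((\<lambda>y. dist y x) \<longlongrightarrow> dist x x) (at x within G)" by (intro tendsto_intros)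
      then have "((\<lambda>y. dist y x powr \<alpha>) \<longlongrightarrow> 0) (at x within G)"
        using assms(2) by (intro tendsto_zero_powrI) auto
      then show ?thesis by (auto intro: tendsto_mult_right_zero)
    qed
    then have "((\<lambda>y. u y - u x) \<longlongrightarrow> 0) (at x within G)"
      by (rule Lim_null_comparison[rotated]) (use C x in \<open>auto simp: eventually_at_filter\<close>)
    then show "(u \<longlongrightarrow> u x) (at x within G)" by (simp add: LIM_zero_iff)
  qed
qed

text \<open>The extensions of the partial derivatives that \<open>C1_holder_closure\<close> grants
  serve as \<open>G\<close>; being Hoelder continuous they are continuous, so the one-sided normal
  derivative is their combination at the boundary point.\<close>

lemma boundary_field_ex:
  assumes "open D" "C2_on D u" "C1_holder_closure \<alpha> D u" "\<alpha> > 0"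
    and helm: "\<And>x. x \<in> D \<Longrightarrow> laplacian u x + c x * u x = 0"
  obtains G where "boundary_field D {} c u G"
    "\<And>x \<nu>. x \<in> frontier D \<Longrightarrow> normal_deriv_from D \<nu> u x = (\<Sum>j\<in>UNIV. \<nu> x $ j *\<^sub>R G j x)"
proof -
  have "\<forall>i. \<exists>g. (\<forall>x\<in>D. g x = partial_deriv i u x) \<and> holder_on \<alpha> (closure D) g"
    using assms(3) unfolding C1_holder_closure_def by blast
  then obtain G where G: "\<And>i x. x \<in> D \<Longrightarrow> G i x = partial_deriv i u x" "\<And>i. holder_on \<alpha> (closure D) (G i)"
    by metis
  have contG: "continuous_on (closure D) (G i)" for i using holder_on_continuous G(2) assms(4) by blast
  have u: "C1_grad D u G"
    by (rule C1_grad_cong[OF C1_on_imp_C1_grad])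
       (use assms(1,2) G(1) in \<open>auto simp: C2_on_def\<close>)
  have dG: "C1_grad D (G j) (\<lambda>i. partial_deriv i (partial_deriv j u))" for j
    by (rule C1_grad_cong[OF C1_on_imp_C1_grad[of D "partial_deriv j u"]])
       (use assms(1,2) G(1) in \<open>auto simp: C2_on_def\<close>)
  have "helmholtz_on D c u G" unfolding helmholtz_on_def
    using u dG helm by (intro conjI exI[of _ "\<lambda>j i. partial_deriv i (partial_deriv j u)"]) (auto simp: laplacian_def)
  then have bf: "boundary_field D {} c u G"
    using assms(3) contG unfolding boundary_field_def C1_holder_closure_def by simp
  moreover have "normal_deriv_from D \<nu> u x = (\<Sum>j\<in>UNIV. \<nu> x $ j *\<^sub>R G j x)" if x: "x \<in> frontier D" for x \<nu>
  proof -
    have xc: "x \<in> closure D" "x \<notin> D" using x assms(1) by (auto simp: frontier_def interior_open)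
    \<comment> \<open>\<open>Lim\<close> is determined only for a nontrivial filter; a frontier
      point of an open set is a limit point of it.\<close>
    have nt: "at x within D \<noteq> bot"
      using xc by (simp add: closure_def trivial_limit_within)
    have "((\<lambda>y. \<Sum>j\<in>UNIV. \<nu> x $ j *\<^sub>R G j y) \<longlongrightarrow> (\<Sum>j\<in>UNIV. \<nu> x $ j *\<^sub>R G j x)) (at x within D)"
    proof (intro tendsto_intros)
      fix j
      have "(G j \<longlongrightarrow> G j x) (at x within closure D)" using contG xc(1) unfolding continuous_on_def by blast
      then show "(G j \<longlongrightarrow> G j x) (at x within D)" by (rule tendsto_within_subset[OF _ closure_subset])
    qed
    moreover have "\<forall>\<^sub>F y in at x within D. (\<Sum>j\<in>UNIV. \<nu> x $ j *\<^sub>R G j y) = frechet_derivative u (at y) (\<nu> x)"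
      unfolding eventually_at_filter using C1_grad_frechet[OF u] by (auto intro!: always_eventually)
    ultimately have "((\<lambda>y. frechet_derivative u (at y) (\<nu> x)) \<longlongrightarrow> (\<Sum>j\<in>UNIV. \<nu> x $ j *\<^sub>R G j x)) (at x within D)"
      by (rule Lim_transform_eventually)
    then show ?thesis unfolding normal_deriv_from_def by (rule tendsto_Lim[OF nt])
  qed
  ultimately show ?thesis using that by blast
qed

lemma div_free_cmult:
  assumes "div_free D G"
  shows "div_free D (\<lambda>j y. r * G j y)"
  unfolding div_free_def
proof (intro allI impI)
  fix \<phi> X assume "test_function D \<phi> X"
  from div_freeD[OF assms this]
  have "has_bochner_integral lborel (\<lambda>x. r * (\<Sum>j\<in>UNIV. X j x *\<^sub>R G j x)) (r * 0)"
    by (intro has_bochner_integral_mult_right)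
  then show "has_bochner_integral lborel (\<lambda>x. \<Sum>j\<in>UNIV. X j x *\<^sub>R (r * G j x)) 0"
    by (simp add: sum_distrib_left)
qed

text \<open>The normal is a nonzero multiple of the gradient of \<open>t\<close>, so matching of
  fluxes along \<open>\<nu>\<close> is matching along \<open>T\<close>. The flux is bilinear in the
  values of the fields and their weighted normal derivatives, and each of these agrees on
  \<open>S\<close>.\<close>

lemma div_free_at_interface:
  assumes lf: "level_function t T e" and "open V" "V \<inter> Z = {}"
    and sides: "V \<inter> {y. 0 < t y} \<subseteq> A" "V \<inter> {y. t y < 0} \<subseteq> B" "V \<inter> {y. t y = 0} \<subseteq> S"
    and U: "boundary_field A Z c U GU" "boundary_field B Z d U' GU'"
    and W: "boundary_field A Z c W GW" "boundary_field B Z d W' GW'"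
    and normal: "\<And>y. y \<in> S \<Longrightarrow> norm (\<nu> y) = 1" "\<And>y \<tau>. y \<in> S \<Longrightarrow> \<tau> \<in> tangent_vectors S y \<Longrightarrow> \<nu> y \<bullet> \<tau> = 0"
    and mU: "\<And>y. y \<in> S \<Longrightarrow> U y = U' y"
      "\<And>y. y \<in> S \<Longrightarrow> a * (\<Sum>j\<in>UNIV. \<nu> y $ j *\<^sub>R GU j y) = b * (\<Sum>j\<in>UNIV. \<nu> y $ j *\<^sub>R GU' j y)"
    and mW: "\<And>y. y \<in> S \<Longrightarrow> W y = W' y"
      "\<And>y. y \<in> S \<Longrightarrow> a * (\<Sum>j\<in>UNIV. \<nu> y $ j *\<^sub>R GW j y) = b * (\<Sum>j\<in>UNIV. \<nu> y $ j *\<^sub>R GW' j y)"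
    and F: "\<And>y j. y \<in> A \<Longrightarrow> F j y = a * (W y * GU j y - U y * GW j y)"
      "\<And>y j. y \<in> B \<Longrightarrow> F j y = b * (W' y * GU' j y - U' y * GW' j y)"
      "\<And>y j. y \<in> S \<Longrightarrow> F j y = 0"
  shows "div_free V F"
proof -
  interpret level_function t T e by (rule lf)
  interpret m: level_function "\<lambda>y. - t y" "\<lambda>j y. - T j y" "- e" by (rule level_function_minus[OF lf])
  have op: "open (V \<inter> {y. 0 < t y})" "open (V \<inter> {y. t y < 0})"
    by (intro open_Int assms(2) open_Collect_less continuous_on_const continuous_level)+
  have subp: "V \<inter> {y. 0 \<le> t y} \<subseteq> closure A - Z"
  proof
    fix y assume y: "y \<in> V \<inter> {y. 0 \<le> t y}"
    have "y \<in> closure A"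
    proof (cases "t y = 0")
      case True
      then show ?thesis using zero_in_closure_positive[OF assms(2), of y] y closure_mono[OF sides(1)] by auto
    qed (use y sides(1) closure_subset in force)
    then show "y \<in> closure A - Z" using y assms(3) by blast
  qed
  have subm: "V \<inter> {y. t y \<le> 0} \<subseteq> closure B - Z"
  proof
    fix y assume y: "y \<in> V \<inter> {y. t y \<le> 0}"
    have "y \<in> closure B"
    proof (cases "t y = 0")
      case True
      then show ?thesis using m.zero_in_closure_positive[OF assms(2), of y] y closure_mono[OF sides(2)] by auto
    qed (use y sides(2) closure_subset in force)
    then show "y \<in> closure B - Z" using y assms(3) by blast
  qed
  have hp: "V \<inter> {y. 0 < t y} \<subseteq> A - Z" and hm: "V \<inter> {y. t y < 0} \<subseteq> B - Z"
    using sides assms(3) by blast+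
  define Fp Fm where "Fp j y = a * (W y * GU j y - U y * GW j y)"
    and "Fm j y = b * (W' y * GU' j y - U' y * GW' j y)" for j :: 3 and y
  have "div_free V (\<lambda>j y. if 0 < t y then Fp j y else if t y < 0 then Fm j y else 0)"
  proof (rule div_free_across_level_set[OF assms(2)])
    fix j
    show "continuous_on (V \<inter> {y. 0 \<le> t y}) (Fp j)"
      unfolding Fp_def[abs_def] using U(1) W(1) unfolding boundary_field_def
      by (intro continuous_intros continuous_on_subset[OF _ subp]) auto
    show "continuous_on (V \<inter> {y. t y \<le> 0}) (Fm j)"
      unfolding Fm_def[abs_def] using U(2) W(2) unfolding boundary_field_def
      by (intro continuous_intros continuous_on_subset[OF _ subm]) auto
  next
    show "div_free (V \<inter> {y. 0 < t y}) Fp"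
      unfolding Fp_def[abs_def]
      using U(1) W(1) unfolding boundary_field_def
      by (intro div_free_cmult helmholtz_pair_div_free[OF op(1), of c] helmholtz_on_subset[OF _ hp]) auto
    show "div_free (V \<inter> {y. t y < 0}) Fm"
      unfolding Fm_def[abs_def]
      using U(2) W(2) unfolding boundary_field_def
      by (intro div_free_cmult helmholtz_pair_div_free[OF op(2), of d] helmholtz_on_subset[OF _ hm]) auto
  next
    fix y assume y: "y \<in> V" "t y = 0"
    then have yS: "y \<in> S" using sides(3) by blast
    define s where "s = \<nu> y \<bullet> e"
    have par: "\<nu> y \<bullet> h = s * (\<Sum>j\<in>UNIV. h $ j * T j y)" for h
      unfolding s_def by (rule normal_parallel_grad[OF assms(2) sides(3) y]) (use normal(2)[OF yS] in auto)
    \<comment> \<open>If \<open>s\<close> were 0, \<open>par\<close> applied to the unit normal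
      itself would give it length 0.\<close>
    have s0: "s \<noteq> 0" using par[of "\<nu> y"] normal(1)[OF yS] by (auto simp: dot_square_norm)
    have comp: "\<nu> y $ j = s * T j y" for j
      using par[of "axis j 1"] sum_axis[of j "\<lambda>j. T j y"] by (simp add: inner_axis)
    have nT: "s *\<^sub>R (\<Sum>j\<in>UNIV. T j y *\<^sub>R g j) = (\<Sum>j\<in>UNIV. \<nu> y $ j *\<^sub>R g j)" for g :: "3 \<Rightarrow> complex"
      by (simp add: comp scaleR_sum_right)
    have lin: "(\<Sum>j\<in>UNIV. \<nu> y $ j *\<^sub>R (r * (w * g j - u * h j)))
        = w * (r * (\<Sum>j\<in>UNIV. \<nu> y $ j *\<^sub>R g j)) - u * (r * (\<Sum>j\<in>UNIV. \<nu> y $ j *\<^sub>R h j))"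
      for r w u and g h :: "3 \<Rightarrow> complex"
      unfolding sum_distrib_left sum_subtractf[symmetric]
      by (intro sum.cong) (auto simp: algebra_simps scaleR_conv_of_real)
    have "s *\<^sub>R (\<Sum>j\<in>UNIV. T j y *\<^sub>R Fp j y) = s *\<^sub>R (\<Sum>j\<in>UNIV. T j y *\<^sub>R Fm j y)"
      unfolding nT Fp_def Fm_def lin mU(2)[OF yS] mW(2)[OF yS] mU(1)[OF yS] mW(1)[OF yS] ..
    then show "(\<Sum>j\<in>UNIV. T j y *\<^sub>R Fp j y) = (\<Sum>j\<in>UNIV. T j y *\<^sub>R Fm j y)" using s0 by simp
  qed
  then show ?thesis
  proof (rule div_free_cong)
    fix y j assume "y \<in> V"
    then consider "0 < t y" "y \<in> A" | "t y < 0" "y \<in> B" | "t y = 0" "y \<in> S"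
      using sides by (cases "t y" "0::real" rule: linorder_cases) auto
    then show "(if 0 < t y then Fp j y else if t y < 0 then Fm j y else 0) = F j y"
      by cases (auto simp: F Fp_def Fm_def)
  qed
qed

section \<open>Total fields in the three regions and their weighted Wronskian\<close>

definition total_field ::
  "(real^3) set \<Rightarrow> (real^3) set \<Rightarrow> (real^3) set \<Rightarrow> (real^3) set \<Rightarrow> (real^3) set \<Rightarrow> (real^3 \<Rightarrow> real^3) \<Rightarrow>
   real \<Rightarrow> real \<Rightarrow> (real^3) set \<Rightarrow> (nat \<Rightarrow> real^3 \<Rightarrow> complex) \<Rightarrow>
   (nat \<Rightarrow> real^3 \<Rightarrow> complex) \<Rightarrow> (nat \<Rightarrow> 3 \<Rightarrow> real^3 \<Rightarrow> complex) \<Rightarrow> bool" where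
  "total_field \<Omega>0 \<Omega>1 \<Omega>2 S0 S1 \<nu> lam0 lam1 Z c U G \<longleftrightarrow>
     boundary_field \<Omega>0 Z (c 0) (U 0) (G 0) \<and> boundary_field \<Omega>1 Z (c 1) (U 1) (G 1) \<and>
     boundary_field \<Omega>2 Z (c 2) (U 2) (G 2) \<and>
     (\<forall>x\<in>S0. U 0 x = U 1 x \<and>
        (\<Sum>j\<in>UNIV. \<nu> x $ j *\<^sub>R G 0 j x) = of_real lam0 * (\<Sum>j\<in>UNIV. \<nu> x $ j *\<^sub>R G 1 j x)) \<and>
     (\<forall>x\<in>S1. U 1 x = U 2 x \<and>
        (\<Sum>j\<in>UNIV. \<nu> x $ j *\<^sub>R G 1 j x) = of_real lam1 * (\<Sum>j\<in>UNIV. \<nu> x $ j *\<^sub>R G 2 j x))"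

lemma total_field_mono:
  assumes "total_field \<Omega>0 \<Omega>1 \<Omega>2 S0 S1 \<nu> lam0 lam1 Y c U G" "Y \<subseteq> Z"
  shows "total_field \<Omega>0 \<Omega>1 \<Omega>2 S0 S1 \<nu> lam0 lam1 Z c U G"
  using assms(1) boundary_field_mono[OF _ assms(2)] unfolding total_field_def by simp

definition wronskian ::
  "(real^3 \<Rightarrow> complex) \<Rightarrow> (3 \<Rightarrow> real^3 \<Rightarrow> complex) \<Rightarrow> (real^3 \<Rightarrow> complex) \<Rightarrow> (3 \<Rightarrow> real^3 \<Rightarrow> complex) \<Rightarrow>
   3 \<Rightarrow> real^3 \<Rightarrow> complex" where
  "wronskian U GU W GW j x = W x * GU j x - U x * GW j x"

text \<open>The value 0 on the interfaces agrees with that of the glued field in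
  \<open>div_free_across_level_set\<close>.\<close>

definition total_wronskian ::
  "(real^3) set \<Rightarrow> (real^3) set \<Rightarrow> (real^3) set \<Rightarrow> real \<Rightarrow> real \<Rightarrow>
   (nat \<Rightarrow> real^3 \<Rightarrow> complex) \<Rightarrow> (nat \<Rightarrow> 3 \<Rightarrow> real^3 \<Rightarrow> complex) \<Rightarrow>
   (nat \<Rightarrow> real^3 \<Rightarrow> complex) \<Rightarrow> (nat \<Rightarrow> 3 \<Rightarrow> real^3 \<Rightarrow> complex) \<Rightarrow> 3 \<Rightarrow> real^3 \<Rightarrow> complex" where
  "total_wronskian \<Omega>0 \<Omega>1 \<Omega>2 lam0 lam1 U GU W GW j x =
     (if x \<in> \<Omega>0 then wronskian (U 0) (GU 0) (W 0) (GW 0) j x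
      else if x \<in> \<Omega>1 then of_real lam0 * wronskian (U 1) (GU 1) (W 1) (GW 1) j x
      else if x \<in> \<Omega>2 then of_real (lam0 * lam1) * wronskian (U 2) (GU 2) (W 2) (GW 2) j x else 0)"

lemma scatterer_geometry_disjoint:
  assumes "scatterer_geometry \<Omega>0 \<Omega>1 \<Omega>2 S0 S1"
  shows "\<Omega>0 \<inter> \<Omega>1 = {}" "\<Omega>0 \<inter> \<Omega>2 = {}" "\<Omega>1 \<inter> \<Omega>2 = {}"
    "S0 \<inter> (\<Omega>0 \<union> \<Omega>1 \<union> \<Omega>2) = {}" "S1 \<inter> (\<Omega>0 \<union> \<Omega>1 \<union> \<Omega>2) = {}"
    "\<Omega>0 \<union> \<Omega>1 \<union> \<Omega>2 \<union> S0 \<union> S1 = UNIV"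
proof -
  note g = assms[unfolded scatterer_geometry_def]
  have b: "\<Omega>0 \<union> \<Omega>1 = - closure \<Omega>2 - S0" "S0 \<subseteq> - closure \<Omega>2" "frontier \<Omega>2 = S1" "open \<Omega>2"
    using g by auto
  have c: "closure \<Omega>2 = \<Omega>2 \<union> S1" using b(3) closure_Un_frontier by metis
  have d: "S1 \<inter> \<Omega>2 = {}" using b(3,4) frontier_disjoint_eq by blast
  have e: "(\<Omega>0 \<union> \<Omega>1) \<inter> (\<Omega>2 \<union> S1 \<union> S0) = {}" "\<Omega>0 \<union> \<Omega>1 \<union> (\<Omega>2 \<union> S1 \<union> S0) = UNIV" "S0 \<inter> (\<Omega>2 \<union> S1) = {}"
    using b(1,2) unfolding c by blast+
  show "\<Omega>0 \<inter> \<Omega>1 = {}" using g by auto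
  show "\<Omega>0 \<inter> \<Omega>2 = {}" "\<Omega>1 \<inter> \<Omega>2 = {}" "S0 \<inter> (\<Omega>0 \<union> \<Omega>1 \<union> \<Omega>2) = {}" using e(1,3) by blast+
  show "S1 \<inter> (\<Omega>0 \<union> \<Omega>1 \<union> \<Omega>2) = {}" using e(1) d by blast
  show "\<Omega>0 \<union> \<Omega>1 \<union> \<Omega>2 \<union> S0 \<union> S1 = UNIV" using e(2) by blast
qed

lemma total_wronskian_div_free:
  assumes geom: "scatterer_geometry \<Omega>0 \<Omega>1 \<Omega>2 S0 S1"
    and normals: "unit_normal_into S0 \<Omega>0 \<nu>" "unit_normal_into S1 \<Omega>1 \<nu>"
    and U: "total_field \<Omega>0 \<Omega>1 \<Omega>2 S0 S1 \<nu> lam0 lam1 Z c U GU"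
    and W: "total_field \<Omega>0 \<Omega>1 \<Omega>2 S0 S1 \<nu> lam0 lam1 Z c W GW"
    and Z: "closed Z"
  shows "div_free (- Z) (total_wronskian \<Omega>0 \<Omega>1 \<Omega>2 lam0 lam1 U GU W GW)" (is "div_free _ ?F")
proof (rule div_free_local)
  fix x assume x: "x \<in> - Z"
  note dis = scatterer_geometry_disjoint[OF geom]
  note g = geom[unfolded scatterer_geometry_def]
  note UW = U[unfolded total_field_def boundary_field_def] W[unfolded total_field_def boundary_field_def]
  have op: "open (\<Omega>0 - Z)" "open (\<Omega>1 - Z)" "open (\<Omega>2 - Z)" using g Z by auto
  consider "x \<in> \<Omega>0" | "x \<in> \<Omega>1" | "x \<in> \<Omega>2" | "x \<in> S0" | "x \<in> S1" using dis(6) by blast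
  then show "\<exists>V. open V \<and> x \<in> V \<and> div_free V ?F"
  proof cases
    case 1
    have "div_free (\<Omega>0 - Z) (wronskian (U 0) (GU 0) (W 0) (GW 0))"
      unfolding wronskian_def[abs_def] by (rule helmholtz_pair_div_free[OF op(1)]) (use UW in auto)
    then have "div_free (\<Omega>0 - Z) ?F"
      by (rule div_free_cong) (auto simp: total_wronskian_def)
    then show ?thesis using op 1 x by blast
  next
    case 2
    have "div_free (\<Omega>1 - Z) (wronskian (U 1) (GU 1) (W 1) (GW 1))"
      unfolding wronskian_def[abs_def] by (rule helmholtz_pair_div_free[OF op(2)]) (use UW in auto)
    then have "div_free (\<Omega>1 - Z) ?F"
      by (rule div_free_cong[OF div_free_cmult]) (use dis in \<open>auto simp: total_wronskian_def\<close>)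
    then show ?thesis using op 2 x by blast
  next
    case 3
    have "div_free (\<Omega>2 - Z) (wronskian (U 2) (GU 2) (W 2) (GW 2))"
      unfolding wronskian_def[abs_def] by (rule helmholtz_pair_div_free[OF op(3)]) (use UW in auto)
    then have "div_free (\<Omega>2 - Z) ?F"
      by (rule div_free_cong[OF div_free_cmult]) (use dis in \<open>auto simp: total_wronskian_def\<close>)
    then show ?thesis using op 3 x by blast
  next
    case 4
    from interface_outer[OF geom 4] obtain V t T e where V: "level_function t T e" "open V" "x \<in> V"
      "V \<inter> {y. 0 < t y} \<subseteq> \<Omega>0" "V \<inter> {y. t y < 0} \<subseteq> \<Omega>1" "V \<inter> {y. t y = 0} \<subseteq> S0" by metis
    have "div_free (V - Z) ?F"
    proof (rule div_free_at_interface[OF V(1), where A = \<Omega>0 and B = \<Omega>1 and S = S0 and Z = Z and a = 1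
          and b = "of_real lam0" and c = "c 0" and d = "c 1" and \<nu> = \<nu>])
      show "boundary_field \<Omega>0 Z (c 0) (U 0) (GU 0)" "boundary_field \<Omega>1 Z (c 1) (U 1) (GU 1)"
        "boundary_field \<Omega>0 Z (c 0) (W 0) (GW 0)" "boundary_field \<Omega>1 Z (c 1) (W 1) (GW 1)"
        using U W unfolding total_field_def by blast+
    qed (use V Z dis U W normals in
        \<open>auto simp: total_field_def unit_normal_into_def total_wronskian_def wronskian_def\<close>)
    then show ?thesis using V Z x by (intro exI[of _ "V - Z"]) auto
  next
    case 5
    from interface_inner[OF geom 5] obtain V t T e where V: "level_function t T e" "open V" "x \<in> V"
      "V \<inter> {y. 0 < t y} \<subseteq> \<Omega>2" "V \<inter> {y. t y < 0} \<subseteq> \<Omega>1" "V \<inter> {y. t y = 0} \<subseteq> S1" by metis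
    have "div_free (V - Z) ?F"
    \<comment> \<open>As \<open>t\<close> increases into \<Omega>2, this region takes the positive
      side. With the two weights below, the required matching of fluxes is the condition on S1
      multiplied by \<open>lam0\<close>.\<close>
    proof (rule div_free_at_interface[OF V(1), where A = \<Omega>2 and B = \<Omega>1 and S = S1 and Z = Z
          and a = "of_real (lam0 * lam1)" and b = "of_real lam0" and c = "c 2" and d = "c 1" and \<nu> = \<nu>])
      show "boundary_field \<Omega>2 Z (c 2) (U 2) (GU 2)" "boundary_field \<Omega>1 Z (c 1) (U 1) (GU 1)"
        "boundary_field \<Omega>2 Z (c 2) (W 2) (GW 2)" "boundary_field \<Omega>1 Z (c 1) (W 1) (GW 1)"
        using U W unfolding total_field_def by blast+
    qed (use V Z dis U W normals in
        \<open>auto simp: total_field_def unit_normal_into_def total_wronskian_def wronskian_def\<close>)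
    then show ?thesis using V Z x by (intro exI[of _ "V - Z"]) auto
  qed
qed

section \<open>Plane waves and point sources\<close>

lemma boundary_field_outside:
  assumes "helmholtz_on (- Z) c u G"
  shows "boundary_field D Z c u G"
proof -
  obtain H where H: "\<And>j. C1_grad (- Z) (G j) (H j)" using assms unfolding helmholtz_on_def by blast
  have "D - Z \<subseteq> - Z" "closure D - Z \<subseteq> - Z" by auto
  then show ?thesis unfolding boundary_field_def
    using helmholtz_on_subset[OF assms] C1_grad_continuous[OF helmholtz_on_C1[OF assms]] C1_grad_continuous[OF H]
      continuous_on_subset by blast
qed

definition plane_wave_grad :: "real \<Rightarrow> real^3 \<Rightarrow> 3 \<Rightarrow> real^3 \<Rightarrow> complex" where
  "plane_wave_grad k d j x = d $ j *\<^sub>R (\<i> * of_real k * plane_wave k d x)"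

lemma C1_grad_plane_wave: "C1_grad UNIV (plane_wave k d) (plane_wave_grad k d)"
proof -
  have "C1_grad UNIV (\<lambda>x. exp (\<i> * of_real (k * (x \<bullet> d))))
     (\<lambda>j x. d $ j *\<^sub>R (\<i> * of_real k * exp (\<i> * of_real (k * (x \<bullet> d)))))"
  proof (rule C1_grad_compose[OF C1_grad_inner[of d]])
    show "((\<lambda>s. exp (\<i> * of_real (k * s))) has_vector_derivative \<i> * of_real k * exp (\<i> * of_real (k * (x \<bullet> d)))) (at (x \<bullet> d))" for x
    proof -
      have "((\<lambda>s. exp (\<i> * (of_real k * s))) has_field_derivative \<i> * of_real k * exp (\<i> * of_real (k * (x \<bullet> d))))
          (at (of_real (x \<bullet> d)))"
        by (auto intro!: derivative_eq_intros)
      from has_vector_derivative_real_field[OF this] show ?thesis by simp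
    qed
    show "continuous_on ((\<lambda>x. x \<bullet> d) ` UNIV) (\<lambda>s. \<i> * of_real k * exp (\<i> * of_real (k * s)))"
      by (intro continuous_intros)
  qed
  then show ?thesis by (simp add: plane_wave_def[abs_def] plane_wave_grad_def[abs_def])
qed

lemma helmholtz_on_plane_wave:
  assumes "norm d = 1"
  shows "helmholtz_on UNIV (\<lambda>x. of_real (k\<^sup>2)) (plane_wave k d) (plane_wave_grad k d)"
  unfolding helmholtz_on_def
proof (intro conjI exI allI ballI)
  show "C1_grad UNIV (plane_wave k d) (plane_wave_grad k d)" by (rule C1_grad_plane_wave)
  show "C1_grad UNIV (plane_wave_grad k d j) (\<lambda>i x. d $ j *\<^sub>R (\<i> * of_real k * plane_wave_grad k d i x))" for j
    unfolding plane_wave_grad_def[of k d j, abs_def]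
    by (rule C1_grad_linear[OF bounded_linear_scaleR_right C1_grad_cmult[OF C1_grad_plane_wave]])
  fix x
  have "(\<Sum>j\<in>UNIV. d $ j *\<^sub>R (\<i> * of_real k * plane_wave_grad k d j x))
      = (\<Sum>j\<in>UNIV. d $ j * d $ j) *\<^sub>R (- of_real (k\<^sup>2) * plane_wave k d x)"
    unfolding scaleR_sum_left
    by (intro sum.cong) (auto simp: plane_wave_grad_def power2_eq_square scaleR_conv_of_real algebra_simps)
  also have "(\<Sum>j\<in>UNIV. d $ j * d $ j) = 1"
  proof -
    have "(\<Sum>j\<in>UNIV. d $ j * d $ j) = d \<bullet> d" by (simp add: inner_vec_def)
    then show ?thesis using assms by (simp add: dot_square_norm)
  qed
  finally show "(\<Sum>j\<in>UNIV. d $ j *\<^sub>R (\<i> * of_real k * plane_wave_grad k d j x)) + of_real (k\<^sup>2) * plane_wave k d x = 0"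
    by simp
qed

lemma C1_grad_norm: "C1_grad (- {z}) (\<lambda>x. norm (x - z)) (\<lambda>j x. (x - z) $ j / norm (x - z))"
proof -
  have "C1_grad (- {z}) (\<lambda>x. sqrt ((x - z) \<bullet> (x - z)))
     (\<lambda>j x. (2 * (x - z) $ j) *\<^sub>R (inverse (sqrt ((x - z) \<bullet> (x - z))) / 2))"
  proof (rule C1_grad_compose[OF C1_grad_subset[OF C1_grad_norm2]])
    show "(sqrt has_vector_derivative inverse (sqrt ((x - z) \<bullet> (x - z))) / 2) (at ((x - z) \<bullet> (x - z)))"
      if "x \<in> - {z}" for x
      using that DERIV_real_sqrt[of "(x - z) \<bullet> (x - z)"]
      by (simp add: has_real_derivative_iff_has_vector_derivative)
    show "continuous_on ((\<lambda>x. (x - z) \<bullet> (x - z)) ` (- {z})) (\<lambda>s. inverse (sqrt s) / 2)"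
      by (intro continuous_intros) auto
  qed auto
  moreover have eq: "sqrt ((x - z) \<bullet> (x - z)) = norm (x - z)" for x by (simp only: norm_eq_sqrt_inner)
  ultimately have "C1_grad (- {z}) (\<lambda>x. norm (x - z)) (\<lambda>j x. (2 * (x - z) $ j) *\<^sub>R (inverse (norm (x - z)) / 2))"
    by (simp only: eq)
  then show ?thesis by (rule C1_grad_cong) (auto simp: inverse_eq_divide field_simps)
qed

text \<open>This is g'(r) / r for g(r) = exp(i k r) / (4 \<pi> r), so that the gradient of the point
  source is \<open>x - z\<close> times the profile.\<close>

definition point_source_profile :: "real \<Rightarrow> real \<Rightarrow> complex" where
  "point_source_profile k r = exp (\<i> * of_real (k * r)) * (\<i> * of_real (k * r) - 1) / of_real (4 * pi * r ^ 3)"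

definition point_source_grad :: "real \<Rightarrow> real^3 \<Rightarrow> 3 \<Rightarrow> real^3 \<Rightarrow> complex" where
  "point_source_grad k z j x = (x - z) $ j *\<^sub>R point_source_profile k (norm (x - z))"

lemma C1_grad_point_source: "C1_grad (- {z}) (point_source k z) (point_source_grad k z)"
proof -
  have "C1_grad (- {z}) (\<lambda>x. exp (\<i> * of_real (k * norm (x - z))) / of_real (4 * pi * norm (x - z)))
     (\<lambda>j x. ((x - z) $ j / norm (x - z)) *\<^sub>R (of_real (norm (x - z)) * point_source_profile k (norm (x - z))))"
  proof (rule C1_grad_compose[OF C1_grad_norm])
    fix x assume "x \<in> - {z}"
    then have r: "norm (x - z) \<noteq> 0" by simp
    have "((\<lambda>s. exp (\<i> * (of_real k * s)) / (of_real (4 * pi) * s)) has_field_derivative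
      of_real (norm (x - z)) * point_source_profile k (norm (x - z))) (at (complex_of_real (norm (x - z))))"
      using r by (auto intro!: derivative_eq_intros simp: point_source_profile_def field_simps power2_eq_square power3_eq_cube)
    then show "((\<lambda>s. exp (\<i> * of_real (k * s)) / of_real (4 * pi * s)) has_vector_derivative
      of_real (norm (x - z)) * point_source_profile k (norm (x - z))) (at (norm (x - z)))"
      using has_vector_derivative_real_field[of "\<lambda>s. exp (\<i> * (of_real k * s)) / (of_real (4 * pi) * s)" _ "norm (x - z)" UNIV]
      by simp
  next
    show "continuous_on ((\<lambda>x. norm (x - z)) ` (- {z})) (\<lambda>s. of_real s * point_source_profile k s)"
      unfolding point_source_profile_def by (intro continuous_intros) auto
  qed
  then show ?thesis
    by (rule C1_grad_cong) (auto simp: point_source_def point_source_grad_def scaleR_conv_of_real)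
qed

text \<open>The divergence of a field \<open>x - z\<close> times q(r), with r the distance from
  \<open>z\<close>, is r q'(r) + 3 q(r). For the profile q of the gradient this is - k^2 times the
  point source.\<close>

lemma helmholtz_on_point_source:
  "helmholtz_on (- {z}) (\<lambda>x. of_real (k\<^sup>2)) (point_source k z) (point_source_grad k z)"
  unfolding helmholtz_on_def
proof (intro conjI exI allI ballI)
  show "C1_grad (- {z}) (point_source k z) (point_source_grad k z)" by (rule C1_grad_point_source)
  define q' where "q' r = exp (\<i> * of_real (k * r)) *
    (- of_real (k\<^sup>2) / of_real (r\<^sup>2) - 3 * (\<i> * of_real (k * r) - 1) / of_real (r ^ 4)) / of_real (4 * pi)" for r
  have q: "C1_grad (- {z}) (\<lambda>x. point_source_profile k (norm (x - z)))
     (\<lambda>j x. ((x - z) $ j / norm (x - z)) *\<^sub>R q' (norm (x - z)))"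
  proof (rule C1_grad_compose[OF C1_grad_norm])
    fix x assume "x \<in> - {z}"
    then have r: "norm (x - z) \<noteq> 0" by simp
    have "((\<lambda>s. exp (\<i> * (of_real k * s)) * (\<i> * (of_real k * s) - 1) / (of_real (4 * pi) * s ^ 3)) has_field_derivative
      q' (norm (x - z))) (at (complex_of_real (norm (x - z))))"
      using r by (auto intro!: derivative_eq_intros simp: q'_def)
        (simp add: field_simps power2_eq_square power3_eq_cube power4_eq_xxxx)
    then show "(point_source_profile k has_vector_derivative q' (norm (x - z))) (at (norm (x - z)))"
      using has_vector_derivative_real_field[of "\<lambda>s. exp (\<i> * (of_real k * s)) * (\<i> * (of_real k * s) - 1) / (of_real (4 * pi) * s ^ 3)" _ "norm (x - z)" UNIV]
      by (simp add: point_source_profile_def[abs_def])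
  next
    show "continuous_on ((\<lambda>x. norm (x - z)) ` (- {z})) q'"
      unfolding q'_def by (intro continuous_intros) auto
  qed
  have comp: "C1_grad (- {z}) (\<lambda>x. (x - z) $ j) (\<lambda>i x. if i = j then 1 else 0)" for j
    using C1_grad_diff[OF C1_grad_subset[OF C1_grad_component[of j]] C1_grad_const[of "- {z}" "z $ j"]] by simp
  show "C1_grad (- {z}) (point_source_grad k z j)
     (\<lambda>i x. (x - z) $ j *\<^sub>R (((x - z) $ i / norm (x - z)) *\<^sub>R q' (norm (x - z)))
       + (if i = j then 1 else 0) *\<^sub>R point_source_profile k (norm (x - z)))" for j
    unfolding point_source_grad_def[of k z j, abs_def] by (rule C1_grad_scaleR[OF comp q])
  fix x assume "x \<in> - {z}"
  define r where "r = norm (x - z)"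
  have r: "r > 0" using \<open>x \<in> - {z}\<close> by (simp add: r_def)
  have sq: "(\<Sum>j\<in>UNIV. (x - z) $ j * (x - z) $ j) = r\<^sup>2"
    unfolding r_def power2_norm_eq_inner inner_vec_def by simp
  have "(\<Sum>j\<in>UNIV. (x - z) $ j *\<^sub>R (((x - z) $ j / r) *\<^sub>R q' r) + (if j = j then 1 else 0) *\<^sub>R point_source_profile k r)
     = (\<Sum>j\<in>UNIV. ((x - z) $ j * (x - z) $ j) *\<^sub>R (q' r / of_real r)) + 3 * point_source_profile k r"
    by (simp add: sum.distrib scaleR_conv_of_real mult.assoc)
  also have "(\<Sum>j\<in>UNIV. ((x - z) $ j * (x - z) $ j) *\<^sub>R (q' r / of_real r)) = of_real r * q' r"
    unfolding scaleR_sum_left[symmetric] sq using r by (simp add: scaleR_conv_of_real power2_eq_square)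
  also have "of_real r * q' r + 3 * point_source_profile k r = - of_real (k\<^sup>2) * point_source k z x"
    using r unfolding q'_def point_source_profile_def point_source_def r_def[symmetric]
    by (simp add: field_simps power2_eq_square power3_eq_cube power4_eq_xxxx)
  finally show "(\<Sum>j\<in>UNIV. (x - z) $ j *\<^sub>R (((x - z) $ j / norm (x - z)) *\<^sub>R q' (norm (x - z)))
       + (if j = j then 1 else 0) *\<^sub>R point_source_profile k (norm (x - z))) + of_real (k\<^sup>2) * point_source k z x = 0"
    by (simp add: r_def)
qed

section \<open>The residue of a point source\<close>

text \<open>The weights remove the points where \<open>F\<close> is not controlled, such as the
  source.\<close>

lemma continuous_on_weighted_field:
  fixes F :: "3 \<Rightarrow> real^3 \<Rightarrow> complex" and X :: "3 \<Rightarrow> real^3 \<Rightarrow> real"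
  assumes "open D" "closed A" "A \<subseteq> D" "\<And>j x. x \<notin> A \<Longrightarrow> X j x = 0"
    and X: "\<And>j. continuous_on UNIV (X j)" and F: "\<And>j. continuous_on D (F j)"
  shows "continuous_on UNIV (\<lambda>x. \<Sum>j\<in>UNIV. X j x *\<^sub>R F j x)"
proof -
  have "continuous_on D (\<lambda>x. \<Sum>j\<in>UNIV. X j x *\<^sub>R F j x)"
    by (intro continuous_intros F continuous_on_subset[OF X]) auto
  moreover have "continuous_on (- A) (\<lambda>x. \<Sum>j\<in>UNIV. X j x *\<^sub>R F j x)"
    by (rule continuous_on_eq[OF continuous_on_const[of _ 0]]) (simp add: assms(4))
  ultimately have "continuous_on (D \<union> - A) (\<lambda>x. \<Sum>j\<in>UNIV. X j x *\<^sub>R F j x)"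
    using assms(1,2) by (intro continuous_on_open_Un) auto
  moreover have "D \<union> - A = UNIV" using assms(3) by blast
  ultimately show ?thesis by simp
qed

text \<open>Joint continuity on a compact product supplies the dominating constant. The parameter
  will be the radius of a shrinking cutoff and the inverse distance of a receding source.\<close>

lemma integral_parameter_limit:
  fixes P :: "real \<Rightarrow> real^3 \<Rightarrow> complex"
  assumes A: "compact A" and P: "continuous_on ({0..d} \<times> A) (\<lambda>p. P (fst p) (snd p))"
    and s: "s \<longlonglongrightarrow> 0" "\<And>n. 0 \<le> s n" "\<And>n. s n \<le> d"
  shows "(\<lambda>n. \<integral>x. indicator A x *\<^sub>R P (s n) x \<partial>lborel) \<longlonglongrightarrow> (\<integral>x. indicator A x *\<^sub>R P 0 x \<partial>lborel)"
proof -
  have d: "0 \<le> d" using s(2,3)[of 0] by linarith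
  have cont: "continuous_on A (P a)" if "0 \<le> a" "a \<le> d" for a
  proof -
    have "continuous_on A (\<lambda>x. (a, x))" by (rule continuous_on_Pair[OF continuous_on_const continuous_on_id])
    have "continuous_on A (\<lambda>x. P (fst (a, x)) (snd (a, x)))"
      by (rule continuous_on_compose2[OF P \<open>continuous_on A (\<lambda>x. (a, x))\<close>]) (use that in auto)
    then show ?thesis by simp
  qed
  have int: "integrable lborel (\<lambda>x. indicator A x *\<^sub>R P a x)" if "0 \<le> a" "a \<le> d" for a
    by (rule borel_integrable_compact[OF A cont[OF that]])
  have "bounded ((\<lambda>p. P (fst p) (snd p)) ` ({0..d} \<times> A))"
    by (intro compact_imp_bounded compact_continuous_image P compact_Times A) auto
  then obtain B where B: "\<And>a x. 0 \<le> a \<Longrightarrow> a \<le> d \<Longrightarrow> x \<in> A \<Longrightarrow> norm (P a x) \<le> B"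
    unfolding bounded_iff by force
  show ?thesis
  proof (rule integral_dominated_convergence[where w = "\<lambda>x. \<bar>B\<bar> * indicator A x"])
    show "(\<lambda>x. indicator A x *\<^sub>R P 0 x) \<in> borel_measurable lborel"
      "\<And>n. (\<lambda>x. indicator A x *\<^sub>R P (s n) x) \<in> borel_measurable lborel"
      using int d s by (auto intro: borel_measurable_integrable simp del: measurable_lborel1)
    show "integrable lborel (\<lambda>x. \<bar>B\<bar> * indicator A x)"
      using emeasure_bounded_finite[OF compact_imp_bounded[OF A]] A
      by (intro integrable_mult_right integrable_real_indicator) (auto simp: borel_compact)
    show "AE x in lborel. (\<lambda>n. indicator A x *\<^sub>R P (s n) x) \<longlonglongrightarrow> indicator A x *\<^sub>R P 0 x"
    proof (intro AE_I2)
      fix x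
      show "(\<lambda>n. indicator A x *\<^sub>R P (s n) x) \<longlonglongrightarrow> indicator A x *\<^sub>R P 0 x"
      proof (cases "x \<in> A")
        case True
        have pair: "continuous_on {0..d} (\<lambda>a. (a, x))"
          by (rule continuous_on_Pair[OF continuous_on_id continuous_on_const])
        have "continuous_on {0..d} (\<lambda>a. P (fst (a, x)) (snd (a, x)))"
          by (rule continuous_on_compose2[OF P pair]) (use True in auto)
        then have "continuous_on {0..d} (\<lambda>a. P a x)" by simp
        then have "(\<lambda>n. P (s n) x) \<longlonglongrightarrow> P 0 x"
          by (rule continuous_on_tendsto_compose[OF _ s(1)]) (use d s in auto)
        then show ?thesis using True by simp
      qed simp
    qed
    show "AE x in lborel. norm (indicator A x *\<^sub>R P (s n) x) \<le> \<bar>B\<bar> * indicator A x" for n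
      using B s(2,3)[of n] by (intro AE_I2) (fastforce simp: indicator_def)
  qed
qed

lemma integral_lborel_scale:
  fixes f :: "real^3 \<Rightarrow> complex"
  assumes "f \<in> borel_measurable borel" "a > 0"
  shows "(\<integral>x. f x \<partial>lborel) = a ^ 3 *\<^sub>R (\<integral>x. f (z + a *\<^sub>R x) \<partial>lborel)"
proof -
  have [measurable]: "f \<in> borel_measurable borel" by fact
  have "(\<integral>x. f x \<partial>lborel) = (\<integral>x. f x \<partial>density (distr lborel borel (\<lambda>x. z + a *\<^sub>R x)) (\<lambda>_. \<bar>a\<bar> ^ DIM(real^3)))"
    using lborel_affine[of a z] assms(2) by simp
  also have "\<dots> = (\<integral>x. \<bar>a\<bar> ^ 3 *\<^sub>R f x \<partial>distr lborel borel (\<lambda>x. z + a *\<^sub>R x))"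
    using assms(2) by (subst integral_density) (auto simp: ennreal_power)
  also have "\<dots> = (\<integral>x. \<bar>a\<bar> ^ 3 *\<^sub>R f (z + a *\<^sub>R x) \<partial>lborel)"
    by (subst integral_distr) auto
  finally show ?thesis using assms(2) by simp
qed

text \<open>The constant \<open>\<kappa>\<close>: the limit of the pairing of the gradient of a point source with that of a
  shrinking cutoff around it, up to sign.\<close>

definition source_const :: real where
  "source_const = (\<integral>x. 2 * cutoff' (x \<bullet> x) / (4 * pi * norm (x :: real^3)) \<partial>lborel)"

lemma annulus_compact: "compact {x :: real^3. a \<le> norm (x - c) \<and> norm (x - c) \<le> b}"
proof -
  have "{x. a \<le> norm (x - c) \<and> norm (x - c) \<le> b} = cball c b - ball c a"
    by (auto simp: dist_norm norm_minus_commute)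
  then show ?thesis by (simp add: compact_diff)
qed

lemma cutoff'_annulus: "norm (x :: real^3) \<le> 1 \<or> 2 \<le> norm x \<Longrightarrow> cutoff' (x \<bullet> x) = 0"
  using radial_cutoff_grad_eq_0[of 1 x 0] inner_self_divide_le[of 1 x 1]
proof (intro cutoff'_eq_0, elim disjE)
  assume "2 \<le> norm x"
  then have "2\<^sup>2 \<le> (norm x)\<^sup>2" by (intro power_mono) auto
  then show "x \<bullet> x \<le> 1 \<or> 2 \<le> x \<bullet> x" by (simp add: dot_square_norm)
qed auto

lemma source_const_integrand_continuous:
  "continuous_on UNIV (\<lambda>x::real^3. 2 * cutoff' (x \<bullet> x) / (4 * pi * norm x))"
proof -
  have "continuous_on (- {0}) (\<lambda>x::real^3. 2 * cutoff' (x \<bullet> x) / (4 * pi * norm x))"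
    by (intro continuous_intros continuous_on_compose2[OF continuous_cutoff'[of UNIV]]) auto
  moreover have "continuous_on (ball 0 1) (\<lambda>x::real^3. 2 * cutoff' (x \<bullet> x) / (4 * pi * norm x))"
    by (rule continuous_on_eq[OF continuous_on_const[of _ 0]]) (simp add: cutoff'_annulus)
  ultimately have "continuous_on (- {0} \<union> ball 0 1) (\<lambda>x::real^3. 2 * cutoff' (x \<bullet> x) / (4 * pi * norm x))"
    by (intro continuous_on_open_Un) auto
  moreover have "- {0} \<union> ball 0 1 = (UNIV :: (real^3) set)" by auto
  ultimately show ?thesis by simp
qed

text \<open>In polar coordinates the constant turns out to be -1. That it is not 0 follows without
  them: the integrand never changes sign and is nonzero on a ball.\<close>

lemma source_const_nonzero: "source_const \<noteq> 0"
proof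
  define f where "f x = - (2 * cutoff' (x \<bullet> x) / (4 * pi * norm x))" for x :: "real^3"
  have int: "integrable lborel f"
  proof (rule integrable_continuous_compact_support[OF _ annulus_compact[of 1 0 2]])
    show "continuous_on UNIV f" unfolding f_def[abs_def]
      by (rule continuous_on_minus[OF source_const_integrand_continuous])
    show "f x = 0" if "x \<notin> {x. 1 \<le> norm (x - 0) \<and> norm (x - 0) \<le> 2}" for x
      using that cutoff'_annulus[of x] by (auto simp: f_def)
  qed
  have nonneg: "f x \<ge> 0" for x using cutoff'_nonpos[of "x \<bullet> x"] by (simp add: f_def divide_nonpos_nonneg)
  assume "source_const = 0"
  then have "integral\<^sup>L lborel f = 0" by (simp add: source_const_def f_def[abs_def])
  then have ae: "AE x in lborel. f x = 0"
    using integral_nonneg_eq_0_iff_AE[OF int] nonneg by simp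
  \<comment> \<open>The ball of radius 1/10 around \<open>c\<close> lies where 11/10 < |x| < 13/10;
    the squares 1.21 and 1.69 of these bounds are in the interval where \<open>cutoff'\<close> is
    negative.\<close>
  define c where "c = (6/5) *\<^sub>R (axis 1 1 :: real^3)"
  have nc: "norm c = 6/5" by (simp add: c_def)
  have "f x \<noteq> 0" if "x \<in> ball c (1/10)" for x
  proof -
    have d: "norm (x - c) < 1/10" using that by (simp add: dist_norm norm_minus_commute)
    have "norm x > 11/10" "norm x < 13/10"
      using norm_triangle_ineq2[of c x] norm_triangle_ineq2[of x c] d nc by (simp_all add: norm_minus_commute)
    moreover then have "(norm x)\<^sup>2 > (11/10)\<^sup>2" "(norm x)\<^sup>2 < (13/10)\<^sup>2"
      by (intro power_strict_mono; simp)+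
    ultimately have "cutoff' (x \<bullet> x) < 0" "norm x > 0"
      by (auto intro!: cutoff'_neg simp: dot_square_norm power2_eq_square)
    then show ?thesis by (simp add: f_def)
  qed
  then have "AE x in lborel. x \<notin> ball c (1/10)" using ae by (auto elim!: eventually_mono)
  then have "ball c (1/10) \<in> null_sets lborel" by (subst AE_iff_null_sets) auto
  then have "measure lborel (ball c (1/10)) = 0" by (simp add: measure_eq_0_null_sets)
  then show False using content_ball_pos[of "1/10" c] by simp
qed

text \<open>Substitute y = z + a x with \<open>a\<close> the radius of the cutoff. The volume gives
  a^3, the gradient of the cutoff a^(-1) and the gradient of the point source a^(-2), so the product
  of \<open>U\<close> with the latter has a finite limit. The term with the point source itself is
  smaller by a factor \<open>a\<close>, those with the regular part \<open>R\<close> by a^2.\<close>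

lemma residue_limit:
  assumes D: "open D" "cball z (2 * \<delta>) \<subseteq> D"
    and U: "C1_grad D U GU" and R: "C1_grad D R GR"
    and s: "s \<longlonglongrightarrow> 0" "\<And>n. 0 < s n" "\<And>n. s n \<le> \<delta>"
    and F: "\<And>j y. y \<in> D - {z} \<Longrightarrow> F j y = wronskian U GU (\<lambda>y. R y + point_source k z y)
      (\<lambda>j y. GR j y + point_source_grad k z j y) j y"
  shows "integrable lborel (\<lambda>y. \<Sum>j\<in>UNIV. radial_cutoff_grad z (s n) j y *\<^sub>R F j y)"
    and "(\<lambda>n. \<integral>y. (\<Sum>j\<in>UNIV. radial_cutoff_grad z (s n) j y *\<^sub>R F j y) \<partial>lborel)
      \<longlonglongrightarrow> of_real source_const * U z"
proof -
  have \<delta>: "\<delta> > 0" using s(2,3)[of 0] by linarith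
  define f where "f n y = (\<Sum>j\<in>UNIV. radial_cutoff_grad z (s n) j y *\<^sub>R F j y)" for n y
  have contF: "continuous_on (D - {z}) (F j)" for j
  proof -
    note sub = continuous_on_subset[OF _ Diff_subset[of D "{z}"]]
    have "continuous_on (D - {z}) (wronskian U GU (\<lambda>y. R y + point_source k z y)
      (\<lambda>j y. GR j y + point_source_grad k z j y) j)"
      unfolding wronskian_def[abs_def]
      by (intro continuous_intros sub C1_grad_continuous[OF U] C1_grad_continuous[OF R]
          C1_grad_continuous_grad[OF U] C1_grad_continuous_grad[OF R]
          continuous_on_subset[OF C1_grad_continuous[OF C1_grad_point_source]]
          continuous_on_subset[OF C1_grad_continuous_grad[OF C1_grad_point_source]]) auto
    then show ?thesis by (rule continuous_on_eq) (simp add: F)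
  qed
  have supp: "radial_cutoff_grad z (s n) j y = 0"
    if "y \<notin> {y. s n \<le> norm (y - z) \<and> norm (y - z) \<le> 2 * s n}" for n j y
    using that s(2)[of n] by (intro radial_cutoff_grad_eq_0) auto
  have contf: "continuous_on UNIV (f n)" for n
    unfolding f_def[abs_def]
  proof (rule continuous_on_weighted_field[of "D - {z}" "{y. s n \<le> norm (y - z) \<and> norm (y - z) \<le> 2 * s n}"])
    show "{y. s n \<le> norm (y - z) \<and> norm (y - z) \<le> 2 * s n} \<subseteq> D - {z}"
    proof
      fix y assume y: "y \<in> {y. s n \<le> norm (y - z) \<and> norm (y - z) \<le> 2 * s n}"
      then have "y \<in> cball z (2 * \<delta>)" using s(3)[of n] by (simp add: dist_norm norm_minus_commute)
      then show "y \<in> D - {z}" using D(2) y s(2)[of n] by auto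
    qed
    show "closed {y. s n \<le> norm (y - z) \<and> norm (y - z) \<le> 2 * s n}"
      by (rule compact_imp_closed[OF annulus_compact])
  qed (use D supp contF C1_grad_continuous_grad[OF C1_grad_radial_cutoff] in auto)
  show int: "integrable lborel (\<lambda>y. \<Sum>j\<in>UNIV. radial_cutoff_grad z (s n) j y *\<^sub>R F j y)" for n
    unfolding f_def[symmetric]
    by (rule integrable_continuous_compact_support[OF contf annulus_compact[of "s n" z "2 * s n"]])
       (simp add: f_def supp)
  define A where "A = {x :: real^3. 1 \<le> norm (x - 0) \<and> norm (x - 0) \<le> 2}"
  \<comment> \<open>On \<open>A\<close> this is \<open>a ^ 3\<close> times the rescaled integrand,
    with all negative powers of \<open>a\<close> cancelled so that it makes sense at
    \<open>a = 0\<close>.\<close>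
  define P where "P a x = (\<Sum>j\<in>UNIV. (2 * x $ j * cutoff' (x \<bullet> x)) *\<^sub>R
      (of_real (a\<^sup>2) * (R (z + a *\<^sub>R x) * GU j (z + a *\<^sub>R x) - U (z + a *\<^sub>R x) * GR j (z + a *\<^sub>R x))
       + of_real a * (exp (\<i> * of_real (k * (a * norm x))) / of_real (4 * pi * norm x)) * GU j (z + a *\<^sub>R x)
       - U (z + a *\<^sub>R x) * (x $ j *\<^sub>R (exp (\<i> * of_real (k * (a * norm x))) * (\<i> * of_real (k * (a * norm x)) - 1)
           / of_real (4 * pi * norm x ^ 3)))))" for a x
  have contP: "continuous_on ({0..\<delta>} \<times> A) (\<lambda>p. P (fst p) (snd p))"
  proof -
    have in_D: "z + fst p *\<^sub>R snd p \<in> D" if "p \<in> {0..\<delta>} \<times> A" for p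
    proof -
      have "norm (fst p *\<^sub>R snd p) \<le> \<delta> * 2"
        unfolding norm_scaleR using that \<delta> by (intro mult_mono) (auto simp: A_def)
      then have "z + fst p *\<^sub>R snd p \<in> cball z (2 * \<delta>)" by (simp add: dist_norm)
      then show ?thesis using D by blast
    qed
    have comp: "continuous_on ({0..\<delta>} \<times> A) (\<lambda>p. g (z + fst p *\<^sub>R snd p))"
      if "continuous_on D g" for g :: "real^3 \<Rightarrow> complex"
      by (rule continuous_on_compose2[OF that]) (use in_D in \<open>auto intro!: continuous_intros\<close>)
    have nz: "norm (snd p) \<noteq> 0" if "p \<in> {0..\<delta>} \<times> A" for p using that by (auto simp: A_def)
    show ?thesis unfolding P_def
      by (intro continuous_intros comp C1_grad_continuous[OF U] C1_grad_continuous[OF R]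
          C1_grad_continuous_grad[OF U] C1_grad_continuous_grad[OF R]
          continuous_on_compose2[OF continuous_cutoff'[of UNIV]]) (use nz in auto)
  qed
  have scale: "(\<integral>y. f n y \<partial>lborel) = (\<integral>x. indicator A x *\<^sub>R P (s n) x \<partial>lborel)" for n
  proof -
    have a: "s n > 0" by (rule s(2))
    have pt: "s n ^ 3 *\<^sub>R f n (z + s n *\<^sub>R x) = indicator A x *\<^sub>R P (s n) x" for x
    proof (cases "x \<in> A")
      case False
      then have "cutoff' (x \<bullet> x) = 0" by (intro cutoff'_annulus) (auto simp: A_def)
      then have "radial_cutoff_grad z (s n) j (z + s n *\<^sub>R x) = 0" for j
        using a by (simp add: radial_cutoff_grad_def power2_eq_square)
      then show ?thesis using False by (simp add: f_def)
    next
      case True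
      then have x: "norm x > 0" "norm x \<le> 2" by (auto simp: A_def)
      have inD: "z + s n *\<^sub>R x \<in> D - {z}"
      proof -
        have "norm (s n *\<^sub>R x) \<le> \<delta> * 2"
          unfolding norm_scaleR using x s(2,3)[of n] by (intro mult_mono) auto
        then have "z + s n *\<^sub>R x \<in> cball z (2 * \<delta>)" by (simp add: dist_norm)
        then show ?thesis using D(2) x a by auto
      qed
      have nrm: "norm (s n *\<^sub>R x) = s n * norm x" using a by simp
      have X: "radial_cutoff_grad z (s n) j (z + s n *\<^sub>R x) = 2 * x $ j / s n * cutoff' (x \<bullet> x)" for j
        using a by (simp add: radial_cutoff_grad_def power2_eq_square)
      have identity: "s n ^ 3 *\<^sub>R (2 * b / s n * c) *\<^sub>R
          ((r + E / of_real (4 * pi * (s n * norm x))) * g - u * (g' + (s n * b) *\<^sub>R (E * M / of_real (4 * pi * (s n * norm x) ^ 3))))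
        = (2 * b * c) *\<^sub>R (of_real ((s n)\<^sup>2) * (r * g - u * g')
           + of_real (s n) * (E / of_real (4 * pi * norm x)) * g - u * (b *\<^sub>R (E * M / of_real (4 * pi * norm x ^ 3))))"
        for b c and r g u g' E M :: complex
        using a x(1) by (simp add: scaleR_conv_of_real field_simps power2_eq_square power3_eq_cube)
      have ind: "indicator A x = (1::real)" using True by simp
      show ?thesis unfolding ind scaleR_one f_def P_def X F[OF inD] scaleR_sum_right wronskian_def
          point_source_def point_source_grad_def point_source_profile_def add_diff_cancel_left' nrm
        by (intro sum.cong refl) (simp only: vector_scaleR_component real_scaleR_def identity)
    qed
    have "(\<integral>y. f n y \<partial>lborel) = s n ^ 3 *\<^sub>R (\<integral>x. f n (z + s n *\<^sub>R x) \<partial>lborel)"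
      by (rule integral_lborel_scale[OF borel_measurable_continuous_onI[OF contf] a])
    also have "\<dots> = (\<integral>x. s n ^ 3 *\<^sub>R f n (z + s n *\<^sub>R x) \<partial>lborel)" by simp
    finally show ?thesis unfolding pt .
  qed
  have P0: "(\<integral>x. indicator A x *\<^sub>R P 0 x \<partial>lborel) = of_real source_const * U z"
  proof -
    have "indicator A x *\<^sub>R P 0 x = of_real (2 * cutoff' (x \<bullet> x) / (4 * pi * norm x)) * U z" for x
    proof (cases "x \<in> A")
      case False
      then have "cutoff' (x \<bullet> x) = 0" by (intro cutoff'_annulus) (auto simp: A_def)
      then show ?thesis using False by simp
    next
      case True
      then have x: "norm x > 0" by (auto simp: A_def)
      \<comment> \<open>At \<open>a = 0\<close> only the last term is left. The sum of the squared
        components lowers the cube in the denominator to |x|, which gives the integrand of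
        \<open>source_const\<close>.\<close>
      have "P 0 x = (\<Sum>j\<in>UNIV. of_real (x $ j * x $ j) * (of_real (2 * cutoff' (x \<bullet> x) / (4 * pi * norm x ^ 3)) * U z))"
        unfolding P_def by (intro sum.cong) (auto simp: scaleR_conv_of_real)
      also have "\<dots> = of_real (\<Sum>j\<in>UNIV. x $ j * x $ j) * (of_real (2 * cutoff' (x \<bullet> x) / (4 * pi * norm x ^ 3)) * U z)"
        unfolding sum_distrib_right[symmetric] of_real_sum ..
      also have "(\<Sum>j\<in>UNIV. x $ j * x $ j) = norm x ^ 2"
        unfolding power2_norm_eq_inner inner_vec_def by simp
      finally show ?thesis using True x by (simp add: power2_eq_square power3_eq_cube)
    qed
    then have "(\<integral>x. indicator A x *\<^sub>R P 0 x \<partial>lborel)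
        = (\<integral>x. of_real (2 * cutoff' (x \<bullet> x) / (4 * pi * norm (x::real^3))) * U z \<partial>lborel)" by simp
    also have "\<dots> = (\<integral>x. complex_of_real (2 * cutoff' (x \<bullet> x) / (4 * pi * norm (x::real^3))) \<partial>lborel) * U z"
      by (rule integral_mult_left_zero)
    also have "\<dots> = of_real source_const * U z" unfolding source_const_def integral_complex_of_real ..
    finally show ?thesis .
  qed
  have "(\<lambda>n. \<integral>x. indicator A x *\<^sub>R P (s n) x \<partial>lborel) \<longlonglongrightarrow> (\<integral>x. indicator A x *\<^sub>R P 0 x \<partial>lborel)"
    by (rule integral_parameter_limit[OF _ contP s(1) _ s(3)])
       (use annulus_compact[of 1 0 2] s(2) in \<open>auto simp: A_def less_imp_le\<close>)
  then show "(\<lambda>n. \<integral>y. (\<Sum>j\<in>UNIV. radial_cutoff_grad z (s n) j y *\<^sub>R F j y) \<partial>lborel)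
      \<longlonglongrightarrow> of_real source_const * U z"
    unfolding P0 scale[symmetric] f_def .
qed

lemma test_function_diff:
  assumes "test_function V \<phi> X" "test_function V \<psi> Y"
  shows "test_function V (\<lambda>x. \<phi> x - \<psi> x) (\<lambda>j x. X j x - Y j x)"
proof -
  obtain K where K: "compact K" "K \<subseteq> V" "\<And>x. x \<notin> K \<Longrightarrow> \<phi> x = 0" "C1_grad UNIV \<phi> X"
    using assms(1) by (rule test_functionE) blast
  obtain L where L: "compact L" "L \<subseteq> V" "\<And>x. x \<notin> L \<Longrightarrow> \<psi> x = 0" "C1_grad UNIV \<psi> Y"
    using assms(2) by (rule test_functionE) blast
  show ?thesis
    by (rule test_functionI[OF C1_grad_diff[OF K(4) L(4)] compact_Un[OF K(1) L(1)]]) (use K L in auto)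
qed

lemma test_function_Diff:
  assumes "test_function V \<phi> X" "open N" "\<And>x. x \<in> N \<Longrightarrow> \<phi> x = 0" "Z \<subseteq> N"
  shows "test_function (V - Z) \<phi> X"
proof -
  obtain K where K: "compact K" "K \<subseteq> V" "\<And>x. x \<notin> K \<Longrightarrow> \<phi> x = 0" "C1_grad UNIV \<phi> X"
    using assms(1) by (rule test_functionE) blast
  show ?thesis
    by (rule test_functionI[OF K(4) compact_diff[OF K(1) assms(2)]]) (use K assms in auto)
qed

text \<open>\<open>\<psi>\<close> minus a small cutoff at \<open>z\<close> vanishes near
  \<open>z\<close> and is an admissible test function off \<open>z\<close>. Hence the pairing with
  \<open>Y\<close> equals the pairing with every small cutoff, and also the limit of these.\<close>

lemma residue:
  assumes "open E" "z \<in> E" "E \<subseteq> D"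
    and U: "C1_grad E U GU" and R: "C1_grad E R GR"
    and F: "\<And>j y. y \<in> E - {z} \<Longrightarrow> F j y = wronskian U GU (\<lambda>y. R y + point_source k z y)
      (\<lambda>j y. GR j y + point_source_grad k z j y) j y"
    and div: "div_free (D - {z}) F"
    and \<psi>: "test_function D \<psi> Y" "\<eta> > 0" "\<And>y. norm (y - z) < \<eta> \<Longrightarrow> \<psi> y = 1"
  shows "has_bochner_integral lborel (\<lambda>y. \<Sum>j\<in>UNIV. Y j y *\<^sub>R F j y) (of_real source_const * U z)"
proof -
  obtain r where r: "r > 0" "cball z r \<subseteq> E" using assms(1,2) by (meson open_contains_cball)
  define \<delta> where "\<delta> = r / 2"
  have \<delta>: "\<delta> > 0" "cball z (2 * \<delta>) \<subseteq> E" using r by (auto simp: \<delta>_def)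
  define s where "s n = \<delta> * inverse (real (Suc n))" for n
  have s: "s \<longlonglongrightarrow> 0" "\<And>n. 0 < s n" "\<And>n. s n \<le> \<delta>"
  proof -
    have "s \<longlonglongrightarrow> \<delta> * 0" unfolding s_def by (intro tendsto_mult tendsto_const LIMSEQ_inverse_real_of_nat)
    then show "s \<longlonglongrightarrow> 0" by simp
    show "0 < s n" for n using \<delta> by (simp add: s_def)
    show "s n \<le> \<delta>" for n using \<delta> unfolding s_def by (intro mult_left_le) (auto simp: divide_simps)
  qed
  note lim = residue_limit[OF assms(1) \<delta>(2) U R s F]
  define X where "X n = radial_cutoff_grad z (s n)" for n
  have 0: "has_bochner_integral lborel (\<lambda>y. \<Sum>j\<in>UNIV. (Y j y - X n j y) *\<^sub>R F j y) 0" for n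
  proof -
    have "cball z (2 * s n) \<subseteq> D" using s(3)[of n] \<delta>(2) assms(3) by (meson mult_left_mono order_trans subset_cball zero_le_numeral)
    then have "test_function D (radial_cutoff z (s n)) (X n)"
      unfolding X_def using s(2) by (intro test_function_radial_cutoff)
    from test_function_diff[OF \<psi>(1) this]
    have "test_function (D - {z}) (\<lambda>x. \<psi> x - radial_cutoff z (s n) x) (\<lambda>j x. Y j x - X n j x)"
    proof (rule test_function_Diff)
      show "open (ball z (min \<eta> (s n)))" by simp
      show "{z} \<subseteq> ball z (min \<eta> (s n))" using \<psi>(2) s(2) by simp
      show "\<psi> x - radial_cutoff z (s n) x = 0" if "x \<in> ball z (min \<eta> (s n))" for x
        using that \<psi>(3)[of x] radial_cutoff_eq_1[OF s(2), of x z n] by (simp add: dist_norm norm_minus_commute)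
    qed
    from div_freeD[OF div this] show ?thesis .
  qed
  have eq: "has_bochner_integral lborel (\<lambda>y. \<Sum>j\<in>UNIV. Y j y *\<^sub>R F j y)
      (\<integral>y. (\<Sum>j\<in>UNIV. X n j y *\<^sub>R F j y) \<partial>lborel)" for n
  proof -
    have "has_bochner_integral lborel (\<lambda>y. \<Sum>j\<in>UNIV. X n j y *\<^sub>R F j y) (\<integral>y. (\<Sum>j\<in>UNIV. X n j y *\<^sub>R F j y) \<partial>lborel)"
      unfolding X_def using lim(1) by (simp add: has_bochner_integral_iff)
    from has_bochner_integral_add[OF 0[of n] this] show ?thesis
      by (simp add: sum.distrib[symmetric] scaleR_add_left[symmetric] del: scaleR_add_left)
  qed
  have "(\<integral>y. (\<Sum>j\<in>UNIV. X n j y *\<^sub>R F j y) \<partial>lborel) = (\<integral>y. (\<Sum>j\<in>UNIV. Y j y *\<^sub>R F j y) \<partial>lborel)" for n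
    using eq[of n] by (simp add: has_bochner_integral_iff)
  then have "(\<lambda>n. \<integral>y. (\<Sum>j\<in>UNIV. Y j y *\<^sub>R F j y) \<partial>lborel) \<longlonglongrightarrow> of_real source_const * U z"
    using lim(2) unfolding X_def by simp
  then have "(\<integral>y. (\<Sum>j\<in>UNIV. Y j y *\<^sub>R F j y) \<partial>lborel) = of_real source_const * U z"
    by (simp add: LIMSEQ_const_iff)
  then show ?thesis using eq by (simp add: has_bochner_integral_iff)
qed

section \<open>Radiating solutions\<close>

definition radial_deriv :: "(3 \<Rightarrow> real^3 \<Rightarrow> complex) \<Rightarrow> real^3 \<Rightarrow> complex" where
  "radial_deriv G x = (\<Sum>j\<in>UNIV. (x $ j / norm x) *\<^sub>R G j x)"

text \<open>The radiation condition in terms of the carried gradient, which makes it additive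
  without conditions on differentiability.\<close>

definition radiates :: "real \<Rightarrow> (real^3 \<Rightarrow> complex) \<Rightarrow> (3 \<Rightarrow> real^3 \<Rightarrow> complex) \<Rightarrow> bool" where
  "radiates k u G \<longleftrightarrow>
     ((\<lambda>x. of_real (norm x) * (radial_deriv G x - \<i> * of_real k * u x)) \<longlongrightarrow> 0) at_infinity"

lemma radiating_imp_radiates:
  assumes "radiating k u" and u: "C1_grad {x. r < norm x} u G"
  shows "radiates k u G"
proof -
  have "\<forall>\<^sub>F x in at_infinity. of_real (norm x) * (frechet_derivative u (at x) (x /\<^sub>R norm x) - \<i> * of_real k * u x)
      = of_real (norm x) * (radial_deriv G x - \<i> * of_real k * u x)"
    unfolding eventually_at_infinity
  proof (intro exI[of _ "r + 1"] allI impI)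
    fix x :: "real^3" assume "r + 1 \<le> norm x"
    then have "x \<in> {x. r < norm x}" by simp
    from C1_grad_frechet[OF u this]
    show "of_real (norm x) * (frechet_derivative u (at x) (x /\<^sub>R norm x) - \<i> * of_real k * u x)
      = of_real (norm x) * (radial_deriv G x - \<i> * of_real k * u x)"
      by (simp add: radial_deriv_def divide_inverse mult.commute)
  qed
  then show ?thesis using assms(1) unfolding radiates_def radiating_def by (rule Lim_transform_eventually[rotated])
qed

lemma radiates_add:
  assumes "radiates k u G" "radiates k v H"
  shows "radiates k (\<lambda>x. u x + v x) (\<lambda>j x. G j x + H j x)"
  using tendsto_add[OF assms[unfolded radiates_def]] unfolding radiates_def radial_deriv_def
  by (simp add: sum.distrib algebra_simps)

text \<open>The derivative is taken along rays from the origin, but the source sits at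
  \<open>x\<close>. The component \<open>c\<close> of \<open>y - x\<close> along the ray differs
  from |y - x| by at most 2 |x|, which leaves an error of order |y|^(-2) before the multiplication
  by |y|.\<close>

lemma radiates_point_source:
  assumes "k \<ge> 0"
  shows "radiates k (point_source k x) (point_source_grad k x)"
  unfolding radiates_def
proof (rule Lim_null_comparison)
  define C where "C = (2 * k * norm x + 1) / pi"
  have "((\<lambda>y :: real^3. C * inverse (norm y)) \<longlongrightarrow> C * 0) at_infinity"
    by (intro tendsto_mult tendsto_const tendsto_inverse_0_at_top filterlim_norm_at_top)
  then show "((\<lambda>y :: real^3. C * inverse (norm y)) \<longlongrightarrow> 0) at_infinity" by simp
  show "\<forall>\<^sub>F y in at_infinity. norm (of_real (norm y) * (radial_deriv (point_source_grad k x) y - \<i> * of_real k * point_source k x y))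
      \<le> C * inverse (norm y)"
    unfolding eventually_at_infinity
  \<comment> \<open>Beyond this radius |y - x| is at least |y| / 2.\<close>
  proof (intro exI[of _ "2 * norm x + 1"] allI impI)
    fix y :: "real^3" assume y: "2 * norm x + 1 \<le> norm y"
    define \<rho> where "\<rho> = norm (y - x)"
    have ny: "norm y > 0" using y norm_ge_zero[of x] by linarith
    have \<rho>1: "norm y / 2 \<le> \<rho>" using y norm_triangle_ineq2[of y x] unfolding \<rho>_def by linarith
    have \<rho>: "\<rho> > 0" using \<rho>1 ny by linarith
    define c where "c = ((y - x) \<bullet> y) / norm y"
    have c: "\<bar>c - \<rho>\<bar> \<le> 2 * norm x"
    proof -
      have "c = norm y - (x \<bullet> y) / norm y"
        using ny by (simp add: c_def inner_diff_left diff_divide_distrib dot_square_norm power2_eq_square)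
      moreover have "\<bar>(x \<bullet> y) / norm y\<bar> \<le> norm x"
        using Cauchy_Schwarz_ineq2[of x y] ny by (simp add: field_simps)
      moreover have "\<bar>norm y - \<rho>\<bar> \<le> norm x"
        using norm_triangle_ineq3[of y "y - x"] by (simp add: \<rho>_def)
      ultimately show ?thesis by linarith
    qed
    have "radial_deriv (point_source_grad k x) y = (\<Sum>j\<in>UNIV. y $ j * (y - x) $ j / norm y) *\<^sub>R point_source_profile k \<rho>"
      unfolding radial_deriv_def point_source_grad_def scaleR_sum_left \<rho>_def by (intro sum.cong) auto
    also have "(\<Sum>j\<in>UNIV. y $ j * (y - x) $ j / norm y) = c"
      unfolding c_def inner_vec_def sum_divide_distrib by (intro sum.cong) (auto simp: mult.commute)
    finally have rd: "radial_deriv (point_source_grad k x) y = c *\<^sub>R point_source_profile k \<rho>" .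
    have "radial_deriv (point_source_grad k x) y - \<i> * of_real k * point_source k x y
        = exp (\<i> * of_real (k * \<rho>)) / of_real (4 * pi * \<rho>) * ((\<i> * of_real (k * (c - \<rho>)) - of_real (c / \<rho>)) / of_real \<rho>)"
      using \<rho> unfolding rd point_source_profile_def point_source_def \<rho>_def[symmetric]
      by (simp add: scaleR_conv_of_real field_simps power2_eq_square power3_eq_cube)
    then have "norm (radial_deriv (point_source_grad k x) y - \<i> * of_real k * point_source k x y)
        = norm (\<i> * of_real (k * (c - \<rho>)) - of_real (c / \<rho>)) / (4 * pi * \<rho>\<^sup>2)"
      using \<rho> by (simp add: norm_mult norm_divide power2_eq_square)
    also have "\<dots> \<le> (2 * k * norm x + 1) / (4 * pi * \<rho>\<^sup>2)"
    proof (rule divide_right_mono)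
      have "\<bar>c\<bar> \<le> \<rho>"
        using Cauchy_Schwarz_ineq2[of "y - x" y] ny by (simp add: c_def \<rho>_def field_simps)
      then have "\<bar>c / \<rho>\<bar> \<le> 1" using \<rho> by (simp add: field_simps)
      moreover have "\<bar>k * (c - \<rho>)\<bar> \<le> k * (2 * norm x)"
        unfolding abs_mult using assms c by (intro mult_mono) auto
      moreover have "norm (\<i> * of_real (k * (c - \<rho>)) - of_real (c / \<rho>)) \<le> \<bar>k * (c - \<rho>)\<bar> + \<bar>c / \<rho>\<bar>"
        by (rule order_trans[OF norm_triangle_ineq4]) (simp only: norm_mult norm_of_real norm_ii mult_1 order_refl)
      ultimately show "norm (\<i> * of_real (k * (c - \<rho>)) - of_real (c / \<rho>)) \<le> 2 * k * norm x + 1" by linarith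
    qed simp
    also have "\<dots> \<le> (2 * k * norm x + 1) / (4 * pi * (norm y / 2)\<^sup>2)"
      using \<rho>1 ny assms by (intro divide_left_mono mult_left_mono power_mono mult_pos_pos) auto
    also have "\<dots> = C / (norm y)\<^sup>2" by (simp add: C_def power_divide)
    finally have "norm (radial_deriv (point_source_grad k x) y - \<i> * of_real k * point_source k x y) \<le> C / (norm y)\<^sup>2" .
    then have "norm y * norm (radial_deriv (point_source_grad k x) y - \<i> * of_real k * point_source k x y)
        \<le> norm y * (C / (norm y)\<^sup>2)" by (intro mult_left_mono) auto
    moreover have "norm y * (C / (norm y)\<^sup>2) = C * inverse (norm y)"
      using ny by (simp add: power2_eq_square inverse_eq_divide)
    ultimately show "norm (of_real (norm y) * (radial_deriv (point_source_grad k x) y - \<i> * of_real k * point_source k x y))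
      \<le> C * inverse (norm y)"
      by (simp add: norm_mult)
  qed
qed

text \<open>Minus the radial derivative of \<open>radial_cutoff 0 R\<close>. Integrals with this
  weight stand in for integrals over the sphere of radius \<open>R\<close>: it is of order 1/R on a
  shell with volume of order R^3, so its mass grows like R^2, as the area does.\<close>

definition shell_weight :: "real \<Rightarrow> real^3 \<Rightarrow> real" where
  "shell_weight R y = - (2 * norm y / R\<^sup>2 * cutoff' ((y \<bullet> y) / R\<^sup>2))"

lemma shell_weight_nonneg: "shell_weight R y \<ge> 0"
proof -
  have "0 \<le> 2 * norm y / R\<^sup>2" by simp
  from mult_nonneg_nonpos[OF this cutoff'_nonpos] show ?thesis
    unfolding shell_weight_def by (simp only: neg_0_le_iff_le)
qed

lemma shell_weight_eq_0:
  assumes "R > 0" "y \<notin> {y. R \<le> norm (y - 0) \<and> norm (y - 0) \<le> 2 * R}"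
  shows "shell_weight R y = 0"
proof -
  have "(y \<bullet> y) / R\<^sup>2 = (y /\<^sub>R R) \<bullet> (y /\<^sub>R R)"
    by (simp add: power2_eq_square field_simps)
  then have "cutoff' ((y \<bullet> y) / R\<^sup>2) = cutoff' ((y /\<^sub>R R) \<bullet> (y /\<^sub>R R))" by simp
  also have "\<dots> = 0"
    using assms by (intro cutoff'_annulus) (auto simp: field_simps)
  finally show ?thesis using assms(1) by (simp add: shell_weight_def)
qed

lemma continuous_shell_weight: "continuous_on A (shell_weight R)"
  unfolding shell_weight_def[abs_def] divide_inverse
  by (intro continuous_intros continuous_on_compose2[OF continuous_cutoff'[of UNIV]]) auto

lemma radial_cutoff_grad_sum:
  "(\<Sum>j\<in>UNIV. radial_cutoff_grad 0 R j y *\<^sub>R F j y) = - (shell_weight R y *\<^sub>R radial_deriv F y)"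
  unfolding radial_deriv_def scaleR_sum_right sum_negf[symmetric] scaleR_scaleR scaleR_minus_left[symmetric]
  by (intro sum.cong) (auto simp: radial_cutoff_grad_def shell_weight_def)

lemma integrable_shell:
  fixes g :: "real^3 \<Rightarrow> 'b::{banach, second_countable_topology}"
  assumes "0 < R" "r < R" "continuous_on {y. r < norm y} g"
  shows "integrable lborel (\<lambda>y. shell_weight R y *\<^sub>R g y)"
proof (rule integrable_continuous_compact_support[OF _ annulus_compact[of R 0 "2 * R"]])
  have op: "open {y :: real^3. r < norm y}" by (intro open_Collect_less continuous_intros)
  have "continuous_on {y. r < norm y} (\<lambda>y. shell_weight R y *\<^sub>R g y)"
    by (intro continuous_intros continuous_shell_weight assms(3))
  moreover have "continuous_on (ball 0 R) (\<lambda>y. shell_weight R y *\<^sub>R g y)"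
    by (rule continuous_on_eq[OF continuous_on_const[of _ 0]]) (use shell_weight_eq_0[OF assms(1)] in auto)
  ultimately have "continuous_on ({y. r < norm y} \<union> ball 0 R) (\<lambda>y. shell_weight R y *\<^sub>R g y)"
    by (rule continuous_on_open_Un[OF op open_ball])
  moreover have "{y. r < norm y} \<union> ball 0 R = (UNIV :: (real^3) set)" using assms(2) by auto
  ultimately show "continuous_on UNIV (\<lambda>y. shell_weight R y *\<^sub>R g y)" by simp
qed (use shell_weight_eq_0[OF assms(1)] in auto)

lemma cutoff'_bounded: "\<exists>M>0. \<forall>s. \<bar>cutoff' s\<bar> \<le> M"
proof -
  have "bounded (cutoff' ` {1..2})"
    by (intro compact_imp_bounded compact_continuous_image continuous_cutoff') auto
  then obtain M where "\<forall>s\<in>{1..2}. \<bar>cutoff' s\<bar> \<le> M" unfolding bounded_iff by auto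
  then have M: "\<And>s. 1 \<le> s \<Longrightarrow> s \<le> 2 \<Longrightarrow> \<bar>cutoff' s\<bar> \<le> M" by simp
  have "\<bar>cutoff' s\<bar> \<le> \<bar>M\<bar> + 1" for s
    using M[of s] cutoff'_eq_0[of s] by (cases "1 \<le> s \<and> s \<le> 2") force+
  then show ?thesis by (intro exI[of _ "\<bar>M\<bar> + 1"]) auto
qed

text \<open>A mass of order R^2 meets an integrand of smaller order than R^(-2).\<close>

lemma shell_integral_tendsto_0:
  fixes g :: "real^3 \<Rightarrow> real"
  assumes g: "continuous_on {y. r < norm y} g" "\<And>y. g y \<ge> 0"
    and lim: "((\<lambda>y. (norm y)\<^sup>2 * g y) \<longlongrightarrow> 0) at_infinity"
    and R: "filterlim R at_top sequentially" "\<And>n. 0 < R n" "\<And>n. r < R n"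
  shows "(\<lambda>n. \<integral>y. shell_weight (R n) y * g y \<partial>lborel) \<longlonglongrightarrow> 0"
proof -
  obtain M where M: "M > 0" "\<And>s. \<bar>cutoff' s\<bar> \<le> M" using cutoff'_bounded by blast
  \<comment> \<open>32 is 4 times 8: on the shell the weight is at most 4 M / R, and the ball of
    radius 2 R has 8 R^3 times the volume of the unit ball.\<close>
  define V where "V = 32 * M * unit_ball_vol 3"
  have V: "V > 0" unfolding V_def using M(1) by simp
  show ?thesis
  proof (rule LIMSEQ_I)
    fix \<epsilon> :: real assume \<epsilon>: "\<epsilon> > 0"
    define \<eta> where "\<eta> = \<epsilon> / (2 * V)"
    have \<eta>: "\<eta> > 0" using \<epsilon> V by (simp add: \<eta>_def)
    obtain b where b: "\<And>y. b \<le> norm y \<Longrightarrow> (norm y)\<^sup>2 * g y < \<eta>"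
    proof -
      have "\<forall>\<^sub>F y in at_infinity. (norm y)\<^sup>2 * g y < \<eta>" by (rule order_tendstoD(2)[OF lim \<eta>])
      then show ?thesis using that unfolding eventually_at_infinity by blast
    qed
    obtain N where N: "\<And>n. n \<ge> N \<Longrightarrow> b \<le> R n"
      using R(1) unfolding filterlim_at_top eventually_sequentially by blast
    have "norm ((\<integral>y. shell_weight (R n) y * g y \<partial>lborel) - 0) < \<epsilon>" if "n \<ge> N" for n
    proof -
      define a where "a = R n"
      have a: "a > 0" "b \<le> a" "r < a" using R N that by (auto simp: a_def)
      have pt: "shell_weight a y * g y \<le> 4 * M / a ^ 3 * \<eta> * indicator (cball 0 (2 * a)) y" for y
      proof (cases "y \<in> {y. a \<le> norm (y - 0) \<and> norm (y - 0) \<le> 2 * a}")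
        case False
        then show ?thesis using shell_weight_eq_0[OF a(1) False] M(1) \<eta> a by (simp add: indicator_def)
      next
        case True
        then have y: "a \<le> norm y" "norm y \<le> 2 * a" by auto
        have "a\<^sup>2 * g y \<le> (norm y)\<^sup>2 * g y" using y a g(2)[of y] by (intro mult_right_mono power_mono) auto
        also have "\<dots> \<le> \<eta>" using b[of y] y a by simp
        finally have 1: "g y \<le> \<eta> / a\<^sup>2" using a by (simp add: field_simps)
        have "shell_weight a y = 2 * norm y / a\<^sup>2 * \<bar>cutoff' ((y \<bullet> y) / a\<^sup>2)\<bar>"
          using cutoff'_nonpos[of "(y \<bullet> y) / a\<^sup>2"] by (simp add: shell_weight_def)
        also have "\<dots> \<le> (2 * (2 * a) / a\<^sup>2) * M"
          using y a M(2) by (intro mult_mono divide_right_mono) auto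
        also have "\<dots> = 4 * M / a" using a by (simp add: power2_eq_square)
        finally have "shell_weight a y * g y \<le> 4 * M / a * (\<eta> / a\<^sup>2)"
          using 1 g(2) M(1) a by (intro mult_mono) auto
        also have "\<dots> = 4 * M / a ^ 3 * \<eta> * indicator (cball 0 (2 * a)) y"
          using y a by (simp add: power2_eq_square power3_eq_cube)
        finally show ?thesis .
      qed
      have "0 \<le> (\<integral>y. shell_weight a y * g y \<partial>lborel)"
        by (intro Bochner_Integration.integral_nonneg mult_nonneg_nonneg shell_weight_nonneg g(2))
      moreover have "(\<integral>y. shell_weight a y * g y \<partial>lborel)
          \<le> (\<integral>y. 4 * M / a ^ 3 * \<eta> * indicator (cball 0 (2 * a)) (y :: real^3) \<partial>lborel)"
      proof (rule integral_mono[OF _ _ pt])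
        show "integrable lborel (\<lambda>y. shell_weight a y * g y)"
          using integrable_shell[OF a(1,3) g(1)] by simp
        show "integrable lborel (\<lambda>y. 4 * M / a ^ 3 * \<eta> * indicator (cball 0 (2 * a)) (y :: real^3))"
          using emeasure_bounded_finite[of "cball (0 :: real^3) (2 * a)"]
          by (intro integrable_mult_right integrable_real_indicator) auto
      qed
      moreover have "(\<integral>y. 4 * M / a ^ 3 * \<eta> * indicator (cball 0 (2 * a)) (y :: real^3) \<partial>lborel)
          = 4 * M / a ^ 3 * \<eta> * (unit_ball_vol 3 * (2 * a) ^ 3)"
        using content_cball[of "2 * a" "0 :: real^3"] a by simp
      moreover have "4 * M / a ^ 3 * \<eta> * (unit_ball_vol 3 * (2 * a) ^ 3) = \<eta> * V"
        using a by (simp add: V_def power3_eq_cube)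
      moreover have "\<eta> * V < \<epsilon>" using \<epsilon> V by (simp add: \<eta>_def)
      ultimately show ?thesis by (simp add: a_def)
    qed
    then show "\<exists>N. \<forall>n\<ge>N. norm ((\<integral>y. shell_weight (R n) y * g y \<partial>lborel) - 0) < \<epsilon>" by blast
  qed
qed

section \<open>Flux of Wronskians through large shells\<close>

lemma helmholtz_on_cnj:
  assumes "helmholtz_on D (\<lambda>x. of_real c) u G"
  shows "helmholtz_on D (\<lambda>x. of_real c) (\<lambda>x. cnj (u x)) (\<lambda>j x. cnj (G j x))"
proof -
  obtain H where H: "\<And>j. C1_grad D (G j) (H j)" "\<And>x. x \<in> D \<Longrightarrow> (\<Sum>j\<in>UNIV. H j j x) + of_real c * u x = 0"
    using assms unfolding helmholtz_on_def by blast
  show ?thesis unfolding helmholtz_on_def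
  proof (intro conjI exI[of _ "\<lambda>j i x. cnj (H j i x)"] allI ballI)
    show "C1_grad D (\<lambda>x. cnj (u x)) (\<lambda>j x. cnj (G j x))"
      by (rule C1_grad_linear[OF bounded_linear_cnj helmholtz_on_C1[OF assms]])
    show "C1_grad D (\<lambda>x. cnj (G j x)) (\<lambda>i x. cnj (H j i x))" for j
      by (rule C1_grad_linear[OF bounded_linear_cnj H(1)])
    show "(\<Sum>j\<in>UNIV. cnj (H j j x)) + of_real c * cnj (u x) = 0" if "x \<in> D" for x
      using arg_cong[OF H(2)[OF that], of cnj] by simp
  qed
qed

text \<open>Two cutoffs that are 1 on the same ball differ by a test function supported outside a
  smaller ball; this is why pairings do not depend on the cutoff.\<close>

lemma exterior_test_function:
  assumes "test_function UNIV \<phi> X" "test_function UNIV \<psi> Y" "r < s"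
    and "\<And>y. norm y < s \<Longrightarrow> \<phi> y = 1" "\<And>y. norm y < s \<Longrightarrow> \<psi> y = 1"
  shows "test_function {y. r < norm y} (\<lambda>x. \<phi> x - \<psi> x) (\<lambda>j x. X j x - Y j x)"
proof -
  have "test_function (UNIV - cball 0 r) (\<lambda>x. \<phi> x - \<psi> x) (\<lambda>j x. X j x - Y j x)"
    by (rule test_function_Diff[OF test_function_diff[OF assms(1,2)] open_ball[of 0 s]]) (use assms in auto)
  moreover have "UNIV - cball 0 r = {y :: real^3. r < norm y}" by auto
  ultimately show ?thesis by simp
qed

lemma continuous_radial_deriv:
  assumes "r \<ge> 0" "\<And>j. continuous_on {y. r < norm y} (G j)"
  shows "continuous_on {y. r < norm y} (radial_deriv G)"
  unfolding radial_deriv_def[abs_def]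
  by (intro continuous_intros assms(2)) (use assms(1) in auto)

text \<open>Conservation of flux: for every cutoff the pairing is the smoothed flux through the
  shell at \<open>R\<close>, which is therefore the same for all \<open>R\<close>.\<close>

lemma wronskian_shell_constant:
  assumes div: "div_free {y. r < norm y} F" and F: "\<And>j. continuous_on {y. r < norm y} (F j)" and "0 \<le> r"
    and \<psi>: "test_function UNIV \<psi> Y" "r < s" "\<And>y. norm y < s \<Longrightarrow> \<psi> y = 1" and R: "s \<le> R"
  shows "has_bochner_integral lborel (\<lambda>y. \<Sum>j\<in>UNIV. Y j y *\<^sub>R F j y)
     (- (\<integral>y. shell_weight R y *\<^sub>R radial_deriv F y \<partial>lborel))"
proof -
  have R0: "0 < R" using assms by linarith
  have 0: "test_function UNIV (radial_cutoff 0 R) (radial_cutoff_grad 0 R)"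
    by (rule test_function_radial_cutoff[OF R0]) simp
  have "test_function {y. r < norm y} (\<lambda>y. \<psi> y - radial_cutoff 0 R y) (\<lambda>j y. Y j y - radial_cutoff_grad 0 R j y)"
    by (rule exterior_test_function[OF \<psi>(1) 0 \<psi>(2,3)]) (use R R0 in \<open>auto intro: radial_cutoff_eq_1\<close>)
  from div_freeD[OF div this]
  have 1: "has_bochner_integral lborel (\<lambda>y. \<Sum>j\<in>UNIV. (Y j y - radial_cutoff_grad 0 R j y) *\<^sub>R F j y) 0" .
  have "integrable lborel (\<lambda>y. shell_weight R y *\<^sub>R radial_deriv F y)"
    by (rule integrable_shell[OF R0 _ continuous_radial_deriv[OF _ F]]) (use assms in auto)
  then have "has_bochner_integral lborel (\<lambda>y. - (shell_weight R y *\<^sub>R radial_deriv F y))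
     (- (\<integral>y. shell_weight R y *\<^sub>R radial_deriv F y \<partial>lborel))"
    by (simp add: has_bochner_integral_iff)
  then have 2: "has_bochner_integral lborel (\<lambda>y. \<Sum>j\<in>UNIV. radial_cutoff_grad 0 R j y *\<^sub>R F j y)
     (- (\<integral>y. shell_weight R y *\<^sub>R radial_deriv F y \<partial>lborel))"
    by (simp only: radial_cutoff_grad_sum)
  show ?thesis using has_bochner_integral_add[OF 1 2]
    by (simp add: sum.distrib[symmetric] scaleR_add_left[symmetric] del: scaleR_add_left)
qed

text \<open>Sommerfeld's argument: \<open>Im (cnj u \<partial>\<^sub>r u)\<close> has constant flux, and
  \<open>|\<partial>\<^sub>r u - i k u|\<^sup>2 = |\<partial>\<^sub>r u|\<^sup>2 + k\<^sup>2 |u|\<^sup>2 - 2 k Im (cnj u \<partial>\<^sub>r u)\<close>.\<close>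

lemma radiating_shell_bounded:
  assumes "k > 0" "0 \<le> r" and u: "helmholtz_on {y. r < norm y} (\<lambda>x. of_real (k\<^sup>2)) u G" "radiates k u G"
    and R: "filterlim R at_top sequentially" "\<And>n. r + 1 \<le> R n"
  shows "(\<lambda>n. \<integral>y. shell_weight (R n) y * (norm (radial_deriv G y - \<i> * of_real k * u y))\<^sup>2 \<partial>lborel) \<longlonglongrightarrow> 0"
    and "\<exists>B. \<forall>n. (\<integral>y. shell_weight (R n) y * (norm (u y))\<^sup>2 \<partial>lborel) \<le> B"
proof -
  define D where "D y = radial_deriv G y - \<i> * of_real k * u y" for y
  have contu: "continuous_on {y. r < norm y} u" and contG: "continuous_on {y. r < norm y} (G j)" for j
    using C1_grad_continuous[OF helmholtz_on_C1[OF u(1)]] C1_grad_continuous_grad[OF helmholtz_on_C1[OF u(1)]] by auto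
  have contdr: "continuous_on {y. r < norm y} (radial_deriv G)"
    by (rule continuous_radial_deriv[OF assms(2) contG])
  have contD: "continuous_on {y. r < norm y} D"
    unfolding D_def[abs_def] by (intro continuous_intros contu contdr)
  have Rn: "0 < R n" "r < R n" for n using R(2)[of n] assms(2) by linarith+
  show lim: "(\<lambda>n. \<integral>y. shell_weight (R n) y * (norm (radial_deriv G y - \<i> * of_real k * u y))\<^sup>2 \<partial>lborel) \<longlonglongrightarrow> 0"
    unfolding D_def[symmetric]
  proof (rule shell_integral_tendsto_0[OF _ _ _ R(1) Rn])
    show "continuous_on {y. r < norm y} (\<lambda>y. (norm (D y))\<^sup>2)" by (intro continuous_intros contD)
    have "((\<lambda>y. (norm (of_real (norm y) * D y))\<^sup>2) \<longlongrightarrow> (norm (0::complex))\<^sup>2) at_infinity"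
      using u(2) unfolding radiates_def D_def by (intro tendsto_intros)
    then show "((\<lambda>y. (norm y)\<^sup>2 * (norm (D y))\<^sup>2) \<longlongrightarrow> 0) at_infinity"
      by (simp add: norm_mult power_mult_distrib)
  qed auto
  define J where "J y = Im (cnj (u y) * radial_deriv G y)" for y
  have contJ: "continuous_on {y. r < norm y} J"
    unfolding J_def[abs_def] by (intro continuous_intros contu contdr)
  \<comment> \<open>As k^2 is real, the conjugate of \<open>u\<close> solves the same equation. The
    radial component of this Wronskian is 2 i times \<open>J\<close>, so conservation of flux
    applies to \<open>J\<close>.\<close>
  define F where "F = wronskian u G (\<lambda>x. cnj (u x)) (\<lambda>j x. cnj (G j x))"
  have contF: "continuous_on {y. r < norm y} (F j)" for j
    unfolding F_def wronskian_def[abs_def] by (intro continuous_intros contu contG)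
  have divF: "div_free {y. r < norm y} F"
    unfolding F_def wronskian_def[abs_def]
    by (rule helmholtz_pair_div_free[OF _ u(1) helmholtz_on_cnj[OF u(1)]])
       (intro open_Collect_less continuous_intros)
  have rF: "radial_deriv F y = 2 * \<i> * of_real (J y)" for y
  proof -
    have "radial_deriv F y = cnj (u y) * radial_deriv G y - u y * cnj (radial_deriv G y)"
      unfolding radial_deriv_def F_def wronskian_def
      by (simp add: scaleR_diff_right sum_subtractf sum_distrib_left scaleR_conv_of_real algebra_simps)
    also have "\<dots> = 2 * \<i> * of_real (J y)"
      unfolding J_def by (simp add: complex_eq_iff algebra_simps)
    finally show ?thesis .
  qed
  have s1: "0 < r + 1" using assms(2) by linarith
  have const: "(\<integral>y. shell_weight (R n) y * J y \<partial>lborel) = (\<integral>y. shell_weight (r + 1) y * J y \<partial>lborel)" for n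
  proof -
    have t: "test_function UNIV (radial_cutoff 0 (r + 1)) (radial_cutoff_grad 0 (r + 1))"
      by (rule test_function_radial_cutoff[OF s1]) simp
    have c1: "\<And>y. norm y < r + 1 \<Longrightarrow> radial_cutoff (0::real^3) (r + 1) y = 1"
      using s1 by (intro radial_cutoff_eq_1) auto
    have "- (\<integral>y. shell_weight (R n) y *\<^sub>R radial_deriv F y \<partial>lborel) = - (\<integral>y. shell_weight (r + 1) y *\<^sub>R radial_deriv F y \<partial>lborel)"
      using has_bochner_integral_eq[OF wronskian_shell_constant[OF divF contF assms(2) t _ c1 R(2)]
          wronskian_shell_constant[OF divF contF assms(2) t _ c1 order_refl]] by simp
    moreover have "shell_weight a y *\<^sub>R radial_deriv F y = 2 * \<i> * of_real (shell_weight a y * J y)" for a y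
      by (simp add: rF scaleR_conv_of_real)
    ultimately have "(\<integral>y. 2 * \<i> * of_real (shell_weight (R n) y * J y) \<partial>lborel)
       = (\<integral>y. 2 * \<i> * of_real (shell_weight (r + 1) y * J y) \<partial>lborel)"
      by simp
    then show ?thesis by (simp only: integral_mult_right_zero integral_complex_of_real) simp
  qed
  \<comment> \<open>The nonnegative term with the radial derivative is dropped from Sommerfeld's
    identity.\<close>
  have id: "k\<^sup>2 * (norm (u y))\<^sup>2 \<le> (norm (D y))\<^sup>2 + 2 * k * J y" for y
  proof -
    have "(norm (D y))\<^sup>2 = (norm (radial_deriv G y))\<^sup>2 + k\<^sup>2 * (norm (u y))\<^sup>2 - 2 * k * J y"
      unfolding D_def J_def cmod_power2 by (simp add: power2_eq_square algebra_simps)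
    then show ?thesis by simp
  qed
  obtain C where C: "\<And>n. (\<integral>y. shell_weight (R n) y * (norm (D y))\<^sup>2 \<partial>lborel) \<le> C"
  proof -
    have "Bseq (\<lambda>n. \<integral>y. shell_weight (R n) y * (norm (D y))\<^sup>2 \<partial>lborel)"
      using lim unfolding D_def by (intro convergent_imp_Bseq convergentI)
    then show ?thesis using that unfolding Bseq_def by (metis abs_le_D1 real_norm_def)
  qed
  define c where "c = (\<integral>y. shell_weight (r + 1) y * J y \<partial>lborel)"
  have "(\<integral>y. shell_weight (R n) y * (norm (u y))\<^sup>2 \<partial>lborel) \<le> (C + 2 * k * c) / k\<^sup>2" for n
  proof -
    have iu: "integrable lborel (\<lambda>y. shell_weight (R n) y * (norm (u y))\<^sup>2)"
      using integrable_shell[OF Rn, of "\<lambda>y. (norm (u y))\<^sup>2"] by (simp add: continuous_intros contu)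
    have iD: "integrable lborel (\<lambda>y. shell_weight (R n) y * (norm (D y))\<^sup>2)"
      using integrable_shell[OF Rn, of "\<lambda>y. (norm (D y))\<^sup>2"] by (simp add: continuous_intros contD)
    have iJ: "integrable lborel (\<lambda>y. shell_weight (R n) y * J y)"
      using integrable_shell[OF Rn contJ] by simp
    have "k\<^sup>2 * (\<integral>y. shell_weight (R n) y * (norm (u y))\<^sup>2 \<partial>lborel)
        = (\<integral>y. k\<^sup>2 * (shell_weight (R n) y * (norm (u y))\<^sup>2) \<partial>lborel)" by simp
    also have "\<dots> \<le> (\<integral>y. shell_weight (R n) y * (norm (D y))\<^sup>2 + 2 * k * (shell_weight (R n) y * J y) \<partial>lborel)"
    proof (rule integral_mono)
      show "k\<^sup>2 * (shell_weight (R n) y * (norm (u y))\<^sup>2)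
          \<le> shell_weight (R n) y * (norm (D y))\<^sup>2 + 2 * k * (shell_weight (R n) y * J y)" for y
        using mult_left_mono[OF id shell_weight_nonneg[of "R n" y], of y] by (simp add: algebra_simps)
    qed (use iu iD iJ in auto)
    also have "\<dots> = (\<integral>y. shell_weight (R n) y * (norm (D y))\<^sup>2 \<partial>lborel) + 2 * k * c"
      using iD iJ const[of n] by (simp add: c_def)
    also have "\<dots> \<le> C + 2 * k * c" using C by simp
    finally show ?thesis using assms(1) by (simp add: field_simps)
  qed
  then show "\<exists>B. \<forall>n. (\<integral>y. shell_weight (R n) y * (norm (u y))\<^sup>2 \<partial>lborel) \<le> B" by blast
qed

text \<open>In the radial component of the Wronskian the derivatives may be replaced by
  \<open>DA\<close> and \<open>DB\<close>, since the terms i k A B cancel. The shell integrals of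
  |A|^2 and |B|^2 stay bounded and those of |DA|^2 and |DB|^2 tend to 0. The inequality a b \<le>
  \<epsilon> a^2 + b^2 / \<epsilon> combines them, with the radius sent to infinity before
  \<epsilon> is sent to 0.\<close>

lemma radiating_wronskian_integral_eq_0:
  assumes k: "k > 0" "0 \<le> r"
    and A: "helmholtz_on {y. r < norm y} (\<lambda>x. of_real (k\<^sup>2)) A GA" "radiates k A GA"
    and B: "helmholtz_on {y. r < norm y} (\<lambda>x. of_real (k\<^sup>2)) B GB" "radiates k B GB"
    and \<psi>: "test_function UNIV \<psi> Y" "r < s" "\<And>y. norm y < s \<Longrightarrow> \<psi> y = 1"
  shows "has_bochner_integral lborel (\<lambda>y. \<Sum>j\<in>UNIV. Y j y *\<^sub>R wronskian A GA B GB j y) 0"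
proof -
  \<comment> \<open>The offset puts every shell beyond \<open>s\<close>, where the cutoff may be
    exchanged, and beyond \<open>r + 1\<close>, as \<open>radiating_shell_bounded\<close>
    demands.\<close>
  define R where "R n = max s (r + 1) + real n" for n
  have R: "filterlim R at_top sequentially" "\<And>n. r + 1 \<le> R n" "\<And>n. s \<le> R n" "\<And>n. 0 < R n" "\<And>n. r < R n"
  proof -
    show "filterlim R at_top sequentially"
      unfolding R_def by (rule filterlim_tendsto_add_at_top[OF tendsto_const filterlim_real_sequentially])
    fix n
    show "r + 1 \<le> R n" "s \<le> R n" "0 < R n" "r < R n" using k \<psi>(2) by (auto simp: R_def)
  qed
  define F where "F = wronskian A GA B GB"
  define DA DB where "DA y = radial_deriv GA y - \<i> * of_real k * A y"
    and "DB y = radial_deriv GB y - \<i> * of_real k * B y" for y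
  have cont: "continuous_on {y. r < norm y} A" "continuous_on {y. r < norm y} B"
    "continuous_on {y. r < norm y} (GA j)" "continuous_on {y. r < norm y} (GB j)" for j
    using C1_grad_continuous[OF helmholtz_on_C1] C1_grad_continuous_grad[OF helmholtz_on_C1] A B by blast+
  have contD: "continuous_on {y. r < norm y} DA" "continuous_on {y. r < norm y} DB"
    unfolding DA_def[abs_def] DB_def[abs_def]
    by (intro continuous_intros cont continuous_radial_deriv k)+
  have contF: "continuous_on {y. r < norm y} (F j)" for j
    unfolding F_def wronskian_def[abs_def] by (intro continuous_intros cont)
  have divF: "div_free {y. r < norm y} F"
    unfolding F_def wronskian_def[abs_def]
    by (rule helmholtz_pair_div_free[OF _ A(1) B(1)]) (intro open_Collect_less continuous_intros)
  have rF: "radial_deriv F y = B y * DA y - A y * DB y" for y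
    unfolding radial_deriv_def F_def wronskian_def DA_def DB_def
    by (simp add: scaleR_diff_right sum_subtractf sum_distrib_left scaleR_conv_of_real algebra_simps)
  define v where "v = (\<integral>y. (\<Sum>j\<in>UNIV. Y j y *\<^sub>R F j y) \<partial>lborel)"
  have main: "has_bochner_integral lborel (\<lambda>y. \<Sum>j\<in>UNIV. Y j y *\<^sub>R F j y)
     (- (\<integral>y. shell_weight (R n) y *\<^sub>R radial_deriv F y \<partial>lborel))" for n
    by (rule wronskian_shell_constant[OF divF contF k(2) \<psi> R(3)])
  have v: "v = - (\<integral>y. shell_weight (R n) y *\<^sub>R radial_deriv F y \<partial>lborel)" for n
    unfolding v_def by (rule has_bochner_integral_integral_eq[OF main])
  note LA = radiating_shell_bounded[OF k A R(1,2)]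
  note LB = radiating_shell_bounded[OF k B R(1,2)]
  obtain CA where CA: "\<And>n. (\<integral>y. shell_weight (R n) y * (norm (A y))\<^sup>2 \<partial>lborel) \<le> CA" using LA(2) by blast
  obtain CB where CB: "\<And>n. (\<integral>y. shell_weight (R n) y * (norm (B y))\<^sup>2 \<partial>lborel) \<le> CB" using LB(2) by blast
  have bound: "norm v \<le> \<epsilon> * (CA + CB)" if \<epsilon>: "\<epsilon> > 0" for \<epsilon>
  proof -
    have step: "norm v \<le> \<epsilon> * (CA + CB) + ((\<integral>y. shell_weight (R n) y * (norm (DA y))\<^sup>2 \<partial>lborel)
        + (\<integral>y. shell_weight (R n) y * (norm (DB y))\<^sup>2 \<partial>lborel)) / \<epsilon>" for n
    proof -
      have int: "integrable lborel (\<lambda>y. shell_weight (R n) y * (norm (A y))\<^sup>2)"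
        "integrable lborel (\<lambda>y. shell_weight (R n) y * (norm (B y))\<^sup>2)"
        "integrable lborel (\<lambda>y. shell_weight (R n) y * (norm (DA y))\<^sup>2)"
        "integrable lborel (\<lambda>y. shell_weight (R n) y * (norm (DB y))\<^sup>2)"
        using integrable_shell[OF R(4,5), where g = "\<lambda>y. (norm (A y))\<^sup>2"]
          integrable_shell[OF R(4,5), where g = "\<lambda>y. (norm (B y))\<^sup>2"]
          integrable_shell[OF R(4,5), where g = "\<lambda>y. (norm (DA y))\<^sup>2"]
          integrable_shell[OF R(4,5), where g = "\<lambda>y. (norm (DB y))\<^sup>2"]
        by (simp_all add: continuous_intros cont contD)
      have ab: "a * b \<le> \<epsilon> * a\<^sup>2 + b\<^sup>2 / \<epsilon>" if "0 \<le> a" "0 \<le> b" for a b :: real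
      proof -
        have "0 \<le> (\<epsilon> * a - b)\<^sup>2 + \<epsilon>\<^sup>2 * a\<^sup>2 + b\<^sup>2" by simp
        then have "\<epsilon> * (a * b) \<le> \<epsilon>\<^sup>2 * a\<^sup>2 + b\<^sup>2" by (simp add: power2_eq_square algebra_simps)
        then show ?thesis using \<epsilon> by (simp add: field_simps power2_eq_square)
      qed
      have "norm v \<le> (\<integral>y. \<epsilon> * (shell_weight (R n) y * (norm (A y))\<^sup>2 + shell_weight (R n) y * (norm (B y))\<^sup>2)
          + (shell_weight (R n) y * (norm (DA y))\<^sup>2 + shell_weight (R n) y * (norm (DB y))\<^sup>2) / \<epsilon> \<partial>lborel)"
        unfolding v[of n] norm_minus_cancel
      proof (rule Bochner_Integration.integral_norm_bound_integral)
        show "integrable lborel (\<lambda>y. shell_weight (R n) y *\<^sub>R radial_deriv F y)"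
          by (rule integrable_shell[OF R(4,5) continuous_radial_deriv[OF k(2) contF]])
        fix y
        have "norm (radial_deriv F y) \<le> norm (B y) * norm (DA y) + norm (A y) * norm (DB y)"
          unfolding rF norm_mult[symmetric] by (rule norm_triangle_ineq4)
        also have "\<dots> \<le> (\<epsilon> * (norm (B y))\<^sup>2 + (norm (DA y))\<^sup>2 / \<epsilon>) + (\<epsilon> * (norm (A y))\<^sup>2 + (norm (DB y))\<^sup>2 / \<epsilon>)"
          by (intro add_mono ab) auto
        finally have "shell_weight (R n) y * norm (radial_deriv F y)
           \<le> shell_weight (R n) y * ((\<epsilon> * (norm (B y))\<^sup>2 + (norm (DA y))\<^sup>2 / \<epsilon>) + (\<epsilon> * (norm (A y))\<^sup>2 + (norm (DB y))\<^sup>2 / \<epsilon>))"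
          by (rule mult_left_mono[OF _ shell_weight_nonneg])
        then show "norm (shell_weight (R n) y *\<^sub>R radial_deriv F y)
          \<le> \<epsilon> * (shell_weight (R n) y * (norm (A y))\<^sup>2 + shell_weight (R n) y * (norm (B y))\<^sup>2)
            + (shell_weight (R n) y * (norm (DA y))\<^sup>2 + shell_weight (R n) y * (norm (DB y))\<^sup>2) / \<epsilon>"
          using shell_weight_nonneg[of "R n" y] by (simp add: algebra_simps add_divide_distrib)
      qed (use int in auto)
      also have "\<dots> = \<epsilon> * ((\<integral>y. shell_weight (R n) y * (norm (A y))\<^sup>2 \<partial>lborel) + (\<integral>y. shell_weight (R n) y * (norm (B y))\<^sup>2 \<partial>lborel))
          + ((\<integral>y. shell_weight (R n) y * (norm (DA y))\<^sup>2 \<partial>lborel) + (\<integral>y. shell_weight (R n) y * (norm (DB y))\<^sup>2 \<partial>lborel)) / \<epsilon>"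
        using int by simp
      also have "\<dots> \<le> \<epsilon> * (CA + CB) + ((\<integral>y. shell_weight (R n) y * (norm (DA y))\<^sup>2 \<partial>lborel) + (\<integral>y. shell_weight (R n) y * (norm (DB y))\<^sup>2 \<partial>lborel)) / \<epsilon>"
        using CA[of n] CB[of n] \<epsilon> by (intro add_right_mono mult_left_mono add_mono) auto
      finally show ?thesis .
    qed
    have "(\<lambda>n. \<epsilon> * (CA + CB) + ((\<integral>y. shell_weight (R n) y * (norm (DA y))\<^sup>2 \<partial>lborel)
        + (\<integral>y. shell_weight (R n) y * (norm (DB y))\<^sup>2 \<partial>lborel)) / \<epsilon>) \<longlonglongrightarrow> \<epsilon> * (CA + CB) + (0 + 0) / \<epsilon>"
      using LA(1) LB(1) \<epsilon> unfolding DA_def DB_def by (intro tendsto_intros) auto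
    then show ?thesis using step by (intro LIMSEQ_le_const[of _ "\<epsilon> * (CA + CB)" "norm v"]) auto
  qed
  have "norm v \<le> 0"
  proof (rule field_le_epsilon)
    fix \<delta> :: real assume \<delta>: "\<delta> > 0"
    \<comment> \<open>The sign of \<open>CA + CB\<close> is not at hand, and the summand 1 keeps the
      divisor positive.\<close>
    define C where "C = \<bar>CA + CB\<bar> + 1"
    have C: "C > 0" "CA + CB \<le> C" by (auto simp: C_def)
    have "norm v \<le> \<delta> / C * (CA + CB)" using bound[of "\<delta> / C"] \<delta> C by simp
    also have "\<dots> \<le> \<delta> / C * C" using \<delta> C by (intro mult_left_mono) auto
    finally show "norm v \<le> 0 + \<delta>" using C by simp
  qed
  then have "- (\<integral>y. shell_weight (R 0) y *\<^sub>R radial_deriv F y \<partial>lborel) = 0" using v[of 0] by simp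
  with main[of 0] show ?thesis unfolding F_def by simp
qed

section \<open>Far fields\<close>

text \<open>With \<open>s = 1 / \<rho>\<close>, these are \<open>4 \<pi> \<rho> e\<^sup>-\<^sup>i\<^sup>k\<^sup>\<rho>\<close> times the point source at \<open>\<rho> d\<close> and its gradient,
  written so that they extend continuously to \<open>s = 0\<close>.\<close>

definition far_phase :: "real^3 \<Rightarrow> real \<Rightarrow> real^3 \<Rightarrow> real" where
  "far_phase d s y = (s * (y \<bullet> y) - 2 * (y \<bullet> d)) / (norm (s *\<^sub>R y - d) + 1)"

definition far_source :: "real \<Rightarrow> real^3 \<Rightarrow> real \<Rightarrow> real^3 \<Rightarrow> complex" where
  "far_source k d s y = exp (\<i> * of_real (k * far_phase d s y)) / of_real (norm (s *\<^sub>R y - d))"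

definition far_source_grad :: "real \<Rightarrow> real^3 \<Rightarrow> real \<Rightarrow> 3 \<Rightarrow> real^3 \<Rightarrow> complex" where
  "far_source_grad k d s j y = (s *\<^sub>R y - d) $ j *\<^sub>R
     (exp (\<i> * of_real (k * far_phase d s y)) * (\<i> * of_real (k * norm (s *\<^sub>R y - d)) - of_real s)
       / of_real (norm (s *\<^sub>R y - d) ^ 3))"

lemma far_source_0:
  assumes "norm d = 1"
  shows "far_source k d 0 y = plane_wave k (- d) y" "far_source_grad k d 0 j y = plane_wave_grad k (- d) j y"
  using assms by (simp_all add: far_source_def far_source_grad_def far_phase_def plane_wave_def plane_wave_grad_def mult.commute)

text \<open>The phase |y - \<rho> d| - \<rho> is a difference of two large numbers. With m = |y /
  \<rho> - d| it is \<rho> (m - 1) = \<rho> (m^2 - 1) / (m + 1), and expanding m^2 cancels the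
  factor \<rho>; this is \<open>far_phase\<close>. The bound on |y| keeps \<open>y\<close> off the
  source.\<close>

lemma far_source_eq:
  assumes "norm d = 1" "\<rho> > 0" "norm y < \<rho>"
  shows "of_real (4 * pi * \<rho>) * exp (- \<i> * of_real (k * \<rho>)) * point_source k (\<rho> *\<^sub>R d) y = far_source k d (1 / \<rho>) y"
    and "of_real (4 * pi * \<rho>) * exp (- \<i> * of_real (k * \<rho>)) * point_source_grad k (\<rho> *\<^sub>R d) j y = far_source_grad k d (1 / \<rho>) j y"
proof -
  define m where "m = norm ((1 / \<rho>) *\<^sub>R y - d)"
  have e: "y - \<rho> *\<^sub>R d = \<rho> *\<^sub>R ((1 / \<rho>) *\<^sub>R y - d)" using assms(2) by (simp add: scaleR_diff_right)
  have n: "norm (y - \<rho> *\<^sub>R d) = \<rho> * m" using assms(2) unfolding e m_def by simp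
  have m: "m > 0"
  proof -
    have "norm ((1 / \<rho>) *\<^sub>R y) < 1" using assms by simp
    then have "(1 / \<rho>) *\<^sub>R y \<noteq> d" using assms(1) by (metis less_irrefl)
    then show ?thesis by (simp add: m_def)
  qed
  have "m\<^sup>2 = ((1 / \<rho>) *\<^sub>R y - d) \<bullet> ((1 / \<rho>) *\<^sub>R y - d)"
    unfolding m_def power2_norm_eq_inner ..
  also have "\<dots> = (1 / \<rho>)\<^sup>2 * (y \<bullet> y) - 2 * (1 / \<rho>) * (y \<bullet> d) + d \<bullet> d"
    by (simp add: inner_diff_left inner_diff_right inner_commute power2_eq_square)
  also have "d \<bullet> d = 1" using assms(1) by (simp add: dot_square_norm)
  finally have "m\<^sup>2 = (1 / \<rho>)\<^sup>2 * (y \<bullet> y) - 2 * (1 / \<rho>) * (y \<bullet> d) + 1" .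
  then have "\<rho> * (m\<^sup>2 - 1) = (1 / \<rho>) * (y \<bullet> y) - 2 * (y \<bullet> d)"
    using assms(2) by (simp add: field_simps power2_eq_square)
  moreover have "\<rho> * (m\<^sup>2 - 1) = (\<rho> * m - \<rho>) * (m + 1)" by (simp add: power2_eq_square algebra_simps)
  ultimately have ph: "far_phase d (1 / \<rho>) y = \<rho> * m - \<rho>"
    using m unfolding far_phase_def m_def[symmetric] by (simp add: field_simps)
  have ex: "exp (- \<i> * of_real (k * \<rho>)) * exp (\<i> * of_real (k * (\<rho> * m))) = exp (\<i> * of_real (k * far_phase d (1 / \<rho>) y))"
    unfolding ph exp_add[symmetric] by (simp add: algebra_simps)
  have "of_real (4 * pi * \<rho>) * exp (- \<i> * of_real (k * \<rho>)) * point_source k (\<rho> *\<^sub>R d) y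
     = (exp (- \<i> * of_real (k * \<rho>)) * exp (\<i> * of_real (k * (\<rho> * m)))) / of_real m"
    using assms(2) m unfolding point_source_def n by (simp add: field_simps)
  then show "of_real (4 * pi * \<rho>) * exp (- \<i> * of_real (k * \<rho>)) * point_source k (\<rho> *\<^sub>R d) y = far_source k d (1 / \<rho>) y"
    unfolding ex unfolding far_source_def m_def .
  have comp: "(y - \<rho> *\<^sub>R d) $ j = \<rho> * ((1 / \<rho>) *\<^sub>R y - d) $ j" unfolding e by simp
  have "of_real (4 * pi * \<rho>) * exp (- \<i> * of_real (k * \<rho>)) * point_source_grad k (\<rho> *\<^sub>R d) j y
     = ((1 / \<rho>) *\<^sub>R y - d) $ j *\<^sub>R ((exp (- \<i> * of_real (k * \<rho>)) * exp (\<i> * of_real (k * (\<rho> * m))))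
         * (\<i> * of_real (k * m) - of_real (1 / \<rho>)) / of_real (m ^ 3))"
    using assms(2) m unfolding point_source_grad_def point_source_profile_def n comp
    by (simp add: scaleR_conv_of_real field_simps power3_eq_cube)
  then show "of_real (4 * pi * \<rho>) * exp (- \<i> * of_real (k * \<rho>)) * point_source_grad k (\<rho> *\<^sub>R d) j y = far_source_grad k d (1 / \<rho>) j y"
    unfolding ex unfolding far_source_grad_def m_def .
qed

lemma far_source_tendsto:
  assumes "norm d = 1" "s \<longlonglongrightarrow> 0"
  shows "(\<lambda>n. far_source k d (s n) y) \<longlonglongrightarrow> plane_wave k (- d) y"
  unfolding far_source_0(1)[OF assms(1), symmetric] far_source_def far_phase_def
  using assms(1) by (intro tendsto_intros assms(2)) (auto simp: add_nonneg_eq_0_iff)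

text \<open>On the shell the normalised integrand depends on \<rho> only through 1/\<rho> and is
  continuous down to 1/\<rho> = 0, where the plane wave with direction \<open>- d\<close> takes the
  place of the point source.\<close>

lemma point_source_wronskian_far:
  assumes d: "norm d = 1" and R: "0 < R" "r < R"
    and W: "continuous_on {y. r < norm y} W" "\<And>j. continuous_on {y. r < norm y} (GW j)"
    and \<rho>: "filterlim \<rho> at_top sequentially" "\<And>n. 4 * R < \<rho> n"
  shows "(\<lambda>n. of_real (4 * pi * \<rho> n) * exp (- \<i> * of_real (k * \<rho> n)) *
      (\<integral>y. (\<Sum>j\<in>UNIV. radial_cutoff_grad 0 R j y *\<^sub>R
        wronskian (point_source k (\<rho> n *\<^sub>R d)) (point_source_grad k (\<rho> n *\<^sub>R d)) W GW j y) \<partial>lborel))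
    \<longlonglongrightarrow> (\<integral>y. (\<Sum>j\<in>UNIV. radial_cutoff_grad 0 R j y *\<^sub>R
        wronskian (plane_wave k (- d)) (plane_wave_grad k (- d)) W GW j y) \<partial>lborel)"
proof -
  define A where "A = {y :: real^3. R \<le> norm (y - 0) \<and> norm (y - 0) \<le> 2 * R}"
  define P where "P s y = (\<Sum>j\<in>UNIV. radial_cutoff_grad 0 R j y *\<^sub>R
      wronskian (far_source k d s) (far_source_grad k d s) W GW j y)" for s y
  define s where "s n = 1 / \<rho> n" for n
  have \<rho>0: "\<rho> n > 0" for n using \<rho>(2)[of n] R by linarith
  have s: "s \<longlonglongrightarrow> 0" "\<And>n. 0 \<le> s n" "\<And>n. s n \<le> 1 / (4 * R)"
  proof -
    show "s \<longlonglongrightarrow> 0" unfolding s_def using tendsto_inverse_0_at_top[OF \<rho>(1)] by (simp add: inverse_eq_divide)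
    show "0 \<le> s n" for n using \<rho>0[of n] by (simp add: s_def)
    show "s n \<le> 1 / (4 * R)" for n using \<rho>(2)[of n] R unfolding s_def by (intro divide_left_mono) auto
  qed
  have supp: "radial_cutoff_grad 0 R j y = 0" if "y \<notin> A" for j y
    using that R by (intro radial_cutoff_grad_eq_0) (auto simp: A_def)
  have "continuous_on ({0..1 / (4 * R)} \<times> A) (\<lambda>p. P (fst p) (snd p))"
  proof -
    have nz: "norm (fst p *\<^sub>R snd p - d) \<noteq> 0" if "p \<in> {0..1 / (4 * R)} \<times> A" for p
    proof -
      \<comment> \<open>Here 4 R < \<rho> is used: the vector has length at most 1/2 on the shell
        and so stays away from the unit vector \<open>d\<close>.\<close>
      have "norm (fst p *\<^sub>R snd p) \<le> 1 / (4 * R) * (2 * R)"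
        unfolding norm_scaleR using that R by (intro mult_mono) (auto simp: A_def)
      also have "\<dots> < 1" using R by simp
      finally show ?thesis using d by auto
    qed
    have nz1: "norm (fst p *\<^sub>R snd p - d) + 1 \<noteq> 0" for p :: "real \<times> (real^3)"
      using norm_ge_zero[of "fst p *\<^sub>R snd p - d"] by linarith
    have W': "continuous_on ({0..1 / (4 * R)} \<times> A) (\<lambda>p. g (snd p))"
      if "continuous_on {y. r < norm y} g" for g :: "real^3 \<Rightarrow> complex"
      by (rule continuous_on_compose2[OF that]) (use R in \<open>auto simp: A_def intro!: continuous_intros\<close>)
    have X': "continuous_on ({0..1 / (4 * R)} \<times> A) (\<lambda>p. radial_cutoff_grad 0 R j (snd p))" for j
      by (rule continuous_on_compose2[OF C1_grad_continuous_grad[OF C1_grad_radial_cutoff]])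
         (auto intro!: continuous_intros)
    show ?thesis
      unfolding P_def wronskian_def far_source_def far_source_grad_def far_phase_def
      by (intro continuous_intros W' W X') (use nz nz1 in auto)
  qed
  from integral_parameter_limit[OF _ this s]
  have lim: "(\<lambda>n. \<integral>y. indicator A y *\<^sub>R P (s n) y \<partial>lborel) \<longlonglongrightarrow> (\<integral>y. indicator A y *\<^sub>R P 0 y \<partial>lborel)"
    using annulus_compact[of R 0 "2 * R"] by (simp add: A_def)
  have ind: "indicator A y *\<^sub>R P a y = P a y" for a y
    using supp[of y] by (cases "y \<in> A") (auto simp: P_def)
  have eq: "of_real (4 * pi * \<rho> n) * exp (- \<i> * of_real (k * \<rho> n)) *
      (\<integral>y. (\<Sum>j\<in>UNIV. radial_cutoff_grad 0 R j y *\<^sub>R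
        wronskian (point_source k (\<rho> n *\<^sub>R d)) (point_source_grad k (\<rho> n *\<^sub>R d)) W GW j y) \<partial>lborel)
      = (\<integral>y. P (s n) y \<partial>lborel)" for n
  proof -
    define c where "c = of_real (4 * pi * \<rho> n) * exp (- \<i> * of_real (k * \<rho> n))"
    have "c * (\<Sum>j\<in>UNIV. radial_cutoff_grad 0 R j y *\<^sub>R
        wronskian (point_source k (\<rho> n *\<^sub>R d)) (point_source_grad k (\<rho> n *\<^sub>R d)) W GW j y) = P (s n) y" for y
    proof (cases "y \<in> A")
      case False then show ?thesis by (simp add: P_def supp)
    next
      case True
      then have "norm y < \<rho> n" using \<rho>(2)[of n] R by (simp add: A_def)
      note fs = far_source_eq[OF d \<rho>0 this, of k, folded c_def]
      show ?thesis
        unfolding P_def sum_distrib_left s_def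
        by (intro sum.cong refl) (simp add: wronskian_def fs[symmetric] algebra_simps)
    qed
    then show ?thesis unfolding c_def[symmetric] by (simp flip: integral_mult_right_zero)
  qed
  have P0: "P 0 y = (\<Sum>j\<in>UNIV. radial_cutoff_grad 0 R j y *\<^sub>R
        wronskian (plane_wave k (- d)) (plane_wave_grad k (- d)) W GW j y)" for y
    unfolding P_def wronskian_def far_source_0[OF d] ..
  show ?thesis using lim unfolding eq ind unfolding P0 .
qed

text \<open>A cutoff that is 1 on a large ball but vanishes inside the shell sees only the source at \<open>x\<close>,
  and its part far out contributes nothing by the radiation condition.\<close>

lemma radiating_representation:
  assumes k: "k > 0" "0 \<le> r" and W: "helmholtz_on {y. r < norm y} (\<lambda>x. of_real (k\<^sup>2)) W GW" "radiates k W GW"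
    and R: "r < R" "2 * R < norm x"
  shows "has_bochner_integral lborel (\<lambda>y. \<Sum>j\<in>UNIV. radial_cutoff_grad 0 R j y *\<^sub>R
      wronskian (point_source k x) (point_source_grad k x) W GW j y) (of_real source_const * W x)"
proof -
  define F where "F = wronskian W GW (point_source k x) (point_source_grad k x)"
  define D where "D = {y :: real^3. r < norm y}"
  define R2 where "R2 = norm x + 1"
  have R2: "R2 > 0" "R > 0" using k R by (simp_all add: R2_def add_nonneg_pos)
  have D: "open D" "x \<in> D" using R k unfolding D_def by (auto intro!: open_Collect_less continuous_intros)
  have t: "test_function UNIV (radial_cutoff 0 R2) (radial_cutoff_grad 0 R2)"
    "test_function UNIV (radial_cutoff 0 R) (radial_cutoff_grad 0 R)"
    using R2 by (auto intro: test_function_radial_cutoff)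
  have t': "test_function D (\<lambda>y. radial_cutoff 0 R2 y - radial_cutoff 0 R y)
      (\<lambda>j y. radial_cutoff_grad 0 R2 j y - radial_cutoff_grad 0 R j y)"
    unfolding D_def
    by (rule exterior_test_function[OF t R(1)]) (use R R2 in \<open>auto intro!: radial_cutoff_eq_1 simp: R2_def\<close>)
  have div: "div_free (D - {x}) F"
    unfolding F_def wronskian_def[abs_def]
  proof (rule helmholtz_pair_div_free)
    show "helmholtz_on (D - {x}) (\<lambda>x. of_real (k\<^sup>2)) W GW"
      by (rule helmholtz_on_subset[OF W(1)]) (auto simp: D_def)
    show "helmholtz_on (D - {x}) (\<lambda>x. of_real (k\<^sup>2)) (point_source k x) (point_source_grad k x)"
      by (rule helmholtz_on_subset[OF helmholtz_on_point_source]) auto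
  qed (use D in auto)
  have 1: "has_bochner_integral lborel
      (\<lambda>y. \<Sum>j\<in>UNIV. (radial_cutoff_grad 0 R2 j y - radial_cutoff_grad 0 R j y) *\<^sub>R F j y) (of_real source_const * W x)"
  \<comment> \<open>The second field is the bare point source, so the regular part is 0.\<close>
  proof (rule residue[OF D order_refl _ C1_grad_const[of _ 0] _ div t'])
    show "C1_grad D W GW" using helmholtz_on_C1[OF W(1)] by (simp add: D_def)
    show "0 < min 1 (norm x - 2 * R)" using R by simp
    show "radial_cutoff 0 R2 y - radial_cutoff 0 R y = 1" if "norm (y - x) < min 1 (norm x - 2 * R)" for y
    proof -
      have "norm y \<le> R2" "2 * R \<le> norm y"
        using that norm_triangle_ineq2[of y x] norm_triangle_ineq2[of x y] by (auto simp: R2_def norm_minus_commute)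
      then show ?thesis using radial_cutoff_eq_1[OF R2(1), of y 0] radial_cutoff_eq_0[OF R2(2), of y 0] by simp
    qed
  qed (simp add: F_def)
  \<comment> \<open>The transition of this cutoff lies beyond |x|, where the point source is a
    regular radiating solution like \<open>W\<close>.\<close>
  have 2: "has_bochner_integral lborel (\<lambda>y. \<Sum>j\<in>UNIV. radial_cutoff_grad 0 R2 j y *\<^sub>R F j y) 0"
    unfolding F_def
  proof (rule radiating_wronskian_integral_eq_0[OF k(1) norm_ge_zero[of x] _ W(2) _ radiates_point_source t(1)])
    show "helmholtz_on {y. norm x < norm y} (\<lambda>x. of_real (k\<^sup>2)) W GW"
      by (rule helmholtz_on_subset[OF W(1)]) (use R k in auto)
    show "helmholtz_on {y. norm x < norm y} (\<lambda>x. of_real (k\<^sup>2)) (point_source k x) (point_source_grad k x)"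
      by (rule helmholtz_on_subset[OF helmholtz_on_point_source]) auto
    show "norm x < R2" by (simp add: R2_def)
    show "\<And>y. norm y < R2 \<Longrightarrow> radial_cutoff 0 R2 y = 1" using R2 by (intro radial_cutoff_eq_1) auto
  qed (use k in auto)
  have "has_bochner_integral lborel (\<lambda>y. (\<Sum>j\<in>UNIV. (radial_cutoff_grad 0 R2 j y - radial_cutoff_grad 0 R j y) *\<^sub>R F j y)
      - (\<Sum>j\<in>UNIV. radial_cutoff_grad 0 R2 j y *\<^sub>R F j y)) (of_real source_const * W x - 0)"
    by (rule has_bochner_integral_diff[OF 1 2])
  moreover have "(\<Sum>j\<in>UNIV. (radial_cutoff_grad 0 R2 j y - radial_cutoff_grad 0 R j y) *\<^sub>R F j y)
      - (\<Sum>j\<in>UNIV. radial_cutoff_grad 0 R2 j y *\<^sub>R F j y)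
      = (\<Sum>j\<in>UNIV. radial_cutoff_grad 0 R j y *\<^sub>R wronskian (point_source k x) (point_source_grad k x) W GW j y)" for y
    unfolding sum_subtractf[symmetric] by (intro sum.cong) (auto simp: F_def wronskian_def algebra_simps)
  ultimately show ?thesis by simp
qed

text \<open>The representation at \<open>\<rho> d\<close> is multiplied by the normalising factor
  and taken to the limit on both sides. The far field of \<open>W\<close> enters through its values
  along a single ray.\<close>

lemma far_field_wronskian:
  assumes k: "k > 0" "0 \<le> r" and W: "helmholtz_on {y. r < norm y} (\<lambda>x. of_real (k\<^sup>2)) W GW" "radiates k W GW"
    and d: "norm d = 1" and R: "r < R"
    and \<rho>: "filterlim \<rho> at_top sequentially" "\<And>n. 4 * R < \<rho> n"
    and L: "(\<lambda>n. of_real (4 * pi * \<rho> n) * exp (- \<i> * of_real (k * \<rho> n)) * W (\<rho> n *\<^sub>R d)) \<longlonglongrightarrow> L"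
  shows "(\<integral>y. (\<Sum>j\<in>UNIV. radial_cutoff_grad 0 R j y *\<^sub>R
      wronskian (plane_wave k (- d)) (plane_wave_grad k (- d)) W GW j y) \<partial>lborel) = of_real source_const * L"
proof -
  have R0: "0 < R" using k R by linarith
  have "(\<lambda>n. of_real (4 * pi * \<rho> n) * exp (- \<i> * of_real (k * \<rho> n)) * (of_real source_const * W (\<rho> n *\<^sub>R d)))
    \<longlonglongrightarrow> (\<integral>y. (\<Sum>j\<in>UNIV. radial_cutoff_grad 0 R j y *\<^sub>R
        wronskian (plane_wave k (- d)) (plane_wave_grad k (- d)) W GW j y) \<partial>lborel)"
  proof -
    have "2 * R < norm (\<rho> n *\<^sub>R d)" for n using d \<rho>(2)[of n] R0 by simp
    note eq = has_bochner_integral_integral_eq[OF radiating_representation[OF k W R this]]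
    show ?thesis unfolding eq[symmetric]
      by (rule point_source_wronskian_far[OF d R0 R _ _ \<rho>])
         (auto intro: C1_grad_continuous[OF helmholtz_on_C1[OF W(1)]] C1_grad_continuous_grad[OF helmholtz_on_C1[OF W(1)]])
  qed
  moreover have "(\<lambda>n. of_real source_const * (of_real (4 * pi * \<rho> n) * exp (- \<i> * of_real (k * \<rho> n)) * W (\<rho> n *\<^sub>R d)))
    \<longlonglongrightarrow> of_real source_const * L" by (intro tendsto_mult tendsto_const L)
  ultimately show ?thesis by (intro LIMSEQ_unique) (simp_all add: mult_ac)
qed

section \<open>Reciprocity\<close>

lemma exterior_subset:
  assumes "scatterer_geometry \<Omega>0 \<Omega>1 \<Omega>2 S0 S1"
  obtains r where "0 \<le> r" "\<And>x. r < norm x \<Longrightarrow> x \<in> \<Omega>0"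
proof -
  note g = assms[unfolded scatterer_geometry_def]
  have "bounded (closure \<Omega>2 \<union> S0 \<union> \<Omega>1)"
    using g unfolding closed_C2_surface_def by (simp add: bounded_closure compact_imp_bounded)
  then obtain r where r: "r > 0" "\<And>x. x \<in> closure \<Omega>2 \<union> S0 \<union> \<Omega>1 \<Longrightarrow> norm x \<le> r"
    unfolding bounded_pos by blast
  have eq: "- closure \<Omega>2 - S0 = \<Omega>0 \<union> \<Omega>1" using g by auto
  show ?thesis
  proof (rule that)
    show "0 \<le> r" using r by simp
    fix x :: "real^3" assume "r < norm x"
    then have "x \<notin> closure \<Omega>2 \<union> S0 \<union> \<Omega>1" using r(2)[of x] by linarith
    then show "x \<in> \<Omega>0" using eq by blast
  qed
qed

text \<open>This covers both positions of the source. Near \<open>z\<close> the weighted Wronskian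
  is that of \<open>w\<close>, the field due to the plane wave, and of the point source plus the
  regular field \<open>R\<close>, times the weight \<open>a\<close> of the region of
  \<open>z\<close>. In the applications \<open>L\<close> is 4 \<pi> times the far field of the total
  field \<open>W 0\<close>.\<close>

lemma reciprocity:
  assumes geom: "scatterer_geometry \<Omega>0 \<Omega>1 \<Omega>2 S0 S1"
    and normals: "unit_normal_into S0 \<Omega>0 \<nu>" "unit_normal_into S1 \<Omega>1 \<nu>"
    and k: "k > 0" and d: "norm d = 1" and c0: "c 0 = (\<lambda>x. of_real (k\<^sup>2))"
    and U: "total_field \<Omega>0 \<Omega>1 \<Omega>2 S0 S1 \<nu> lam0 lam1 {z} c U GU"
    and W: "total_field \<Omega>0 \<Omega>1 \<Omega>2 S0 S1 \<nu> lam0 lam1 {z} c W GW"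
    and U0: "U 0 = (\<lambda>x. u x + plane_wave k (- d) x)" "GU 0 = (\<lambda>j x. G j x + plane_wave_grad k (- d) j x)"
    and u: "boundary_field \<Omega>0 {} (c 0) u G" "radiating k u"
    and W0: "radiates k (W 0) (GW 0)"
    and E: "open E" "z \<in> E" "C1_grad E w Gw" "C1_grad E R GR" "a \<noteq> 0"
    and near: "\<And>j y. y \<in> E - {z} \<Longrightarrow> total_wronskian \<Omega>0 \<Omega>1 \<Omega>2 lam0 lam1 U GU W GW j y
        = a * wronskian w Gw (\<lambda>y. R y + point_source k' z y) (\<lambda>j y. GR j y + point_source_grad k' z j y) j y"
    and L: "\<And>\<rho>. filterlim \<rho> at_top sequentially \<Longrightarrow>
        (\<lambda>n. of_real (4 * pi * \<rho> n) * exp (- \<i> * of_real (k * \<rho> n)) * W 0 (\<rho> n *\<^sub>R d)) \<longlonglongrightarrow> L"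
  shows "L = a * w z"
proof -
  obtain r0 where r0: "0 \<le> r0" "\<And>x. r0 < norm x \<Longrightarrow> x \<in> \<Omega>0" using exterior_subset[OF geom] by blast
  \<comment> \<open>Beyond \<open>r\<close> there is neither scatterer nor source.\<close>
  define r where "r = max r0 (norm z)"
  define X where "X = {x :: real^3. r < norm x}"
  have r: "0 \<le> r" "X \<subseteq> \<Omega>0 - {z}" using r0 by (auto simp: r_def X_def)
  have hW: "helmholtz_on X (\<lambda>x. of_real (k\<^sup>2)) (W 0) (GW 0)"
    using W r(2) c0 unfolding total_field_def boundary_field_def by (auto intro: helmholtz_on_subset)
  have hu: "helmholtz_on X (\<lambda>x. of_real (k\<^sup>2)) u G"
    using u(1) r(2) c0 unfolding boundary_field_def by (auto intro: helmholtz_on_subset)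
  have ru: "radiates k u G"
    by (rule radiating_imp_radiates[OF u(2) helmholtz_on_C1[OF hu[unfolded X_def]]])
  define Q where "Q = r + 1"
  have Q: "r < Q" "0 < Q" using r(1) by (auto simp: Q_def)
  define Y where "Y = radial_cutoff_grad (0::real^3) Q"
  have t: "test_function UNIV (radial_cutoff 0 Q) Y"
    unfolding Y_def by (rule test_function_radial_cutoff[OF Q(2)]) simp
  have one: "radial_cutoff 0 Q y = 1" if "norm y < Q" for y :: "real^3"
    using that Q(2) by (intro radial_cutoff_eq_1) auto
  define F where "F = total_wronskian \<Omega>0 \<Omega>1 \<Omega>2 lam0 lam1 U GU W GW"
  have divF: "div_free (UNIV - {z}) F"
    using total_wronskian_div_free[OF geom normals U W] by (simp add: F_def Compl_eq_Diff_UNIV)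
  \<comment> \<open>The weight is divided out first because \<open>residue\<close> speaks of an
    unweighted Wronskian.\<close>
  have "has_bochner_integral lborel (\<lambda>y. \<Sum>j\<in>UNIV. Y j y *\<^sub>R (inverse a * F j y)) (of_real source_const * w z)"
  proof (rule residue[OF E(1,2) subset_UNIV E(3,4) _ div_free_cmult[OF divF] t])
    show "inverse a * F j y = wronskian w Gw (\<lambda>y. R y + point_source k' z y)
        (\<lambda>j y. GR j y + point_source_grad k' z j y) j y" if "y \<in> E - {z}" for j y
      using near[OF that] E(5) by (simp add: F_def)
    show "0 < Q - norm z" by (simp add: Q_def r_def)
    show "radial_cutoff 0 Q y = 1" if "norm (y - z) < Q - norm z" for y
      using that norm_triangle_ineq2[of y z] by (intro one) linarith
  qed
  then have scaled: "has_bochner_integral lborel (\<lambda>y. a * (\<Sum>j\<in>UNIV. Y j y *\<^sub>R (inverse a * F j y)))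
      (a * (of_real source_const * w z))"
    by (intro has_bochner_integral_mult_right)
  have 1: "has_bochner_integral lborel (\<lambda>y. \<Sum>j\<in>UNIV. Y j y *\<^sub>R F j y) (a * (of_real source_const * w z))"
  proof -
    have cancel: "a * (inverse a * b) = b" for b using E(5) by (simp add: mult.assoc[symmetric])
    show ?thesis using scaled by (simp only: sum_distrib_left mult_scaleR_right cancel)
  qed
  have 2: "has_bochner_integral lborel (\<lambda>y. \<Sum>j\<in>UNIV. Y j y *\<^sub>R wronskian u G (W 0) (GW 0) j y) 0"
    by (rule radiating_wronskian_integral_eq_0[OF k r(1) hu[unfolded X_def] ru hW[unfolded X_def] W0 t Q(1) one])
  have "has_bochner_integral lborel (\<lambda>y. (\<Sum>j\<in>UNIV. Y j y *\<^sub>R F j y)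
      - (\<Sum>j\<in>UNIV. Y j y *\<^sub>R wronskian u G (W 0) (GW 0) j y)) (a * (of_real source_const * w z) - 0)"
    by (rule has_bochner_integral_diff[OF 1 2])
  moreover have "(\<Sum>j\<in>UNIV. Y j y *\<^sub>R F j y) - (\<Sum>j\<in>UNIV. Y j y *\<^sub>R wronskian u G (W 0) (GW 0) j y)
      = (\<Sum>j\<in>UNIV. Y j y *\<^sub>R wronskian (plane_wave k (- d)) (plane_wave_grad k (- d)) (W 0) (GW 0) j y)" for y
  \<comment> \<open>Up to radius \<open>Q\<close> the gradient of the cutoff vanishes; beyond it the
    point is in \<Omega>0 and the splitting of \<open>U 0\<close> applies.\<close>
  proof (cases "norm y \<le> Q")
    case True
    then have "Y j y = 0" for j unfolding Y_def using Q(2) by (intro radial_cutoff_grad_eq_0) auto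
    then show ?thesis by simp
  next
    case False
    then have "y \<in> X" using Q by (simp add: X_def)
    then have "y \<in> \<Omega>0" using r(2) by blast
    then have "F j y = wronskian u G (W 0) (GW 0) j y
        + wronskian (plane_wave k (- d)) (plane_wave_grad k (- d)) (W 0) (GW 0) j y" for j
      by (simp add: F_def total_wronskian_def wronskian_def U0 algebra_simps)
    then show ?thesis by (simp add: scaleR_add_right sum.distrib)
  qed
  ultimately have "(\<integral>y. (\<Sum>j\<in>UNIV. Y j y *\<^sub>R wronskian (plane_wave k (- d)) (plane_wave_grad k (- d)) (W 0) (GW 0) j y) \<partial>lborel)
      = a * (of_real source_const * w z)"
    by (simp add: has_bochner_integral_iff)
  moreover have "(\<integral>y. (\<Sum>j\<in>UNIV. Y j y *\<^sub>R wronskian (plane_wave k (- d)) (plane_wave_grad k (- d)) (W 0) (GW 0) j y) \<partial>lborel)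
      = of_real source_const * L"
    unfolding Y_def
  proof (rule far_field_wronskian[OF k r(1) hW[unfolded X_def] W0 d Q(1)])
    \<comment> \<open>Any sequence that tends to infinity and stays above \<open>4 * Q\<close> would
      serve.\<close>
    show lim: "filterlim (\<lambda>n. real n + (4 * Q + 1)) at_top sequentially"
      by (subst add.commute) (rule filterlim_tendsto_add_at_top[OF tendsto_const filterlim_real_sequentially])
    show "4 * Q < real n + (4 * Q + 1)" for n by simp
    show "(\<lambda>n. of_real (4 * pi * (real n + (4 * Q + 1))) * exp (- \<i> * of_real (k * (real n + (4 * Q + 1))))
       * W 0 ((real n + (4 * Q + 1)) *\<^sub>R d)) \<longlonglongrightarrow> L"
      by (rule L[OF lim])
  qed
  ultimately show ?thesis using source_const_nonzero by simp
qed

section \<open>Total fields of the scattering problems and their far fields\<close>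

definition squared_index :: "real \<Rightarrow> real \<Rightarrow> real \<Rightarrow> (real^3 \<Rightarrow> complex) \<Rightarrow> nat \<Rightarrow> real^3 \<Rightarrow> complex" where
  "squared_index k0 k1 k2 n m x =
     (if m = 0 then of_real (k0\<^sup>2) else if m = 1 then of_real (k1\<^sup>2) else of_real (k2\<^sup>2) * n x)"

text \<open>In the three scattering problems the data \<open>f\<close>, \<open>g\<close>, \<open>p\<close>, \<open>q\<close> are the jumps of incident fields
  \<open>A\<close> in \<open>\<Omega>\<^sub>0\<close> and \<open>B\<close> in \<open>\<Omega>\<^sub>1\<close>, one of which is zero.\<close>

lemma total_field_of_solution:
  assumes geom: "scatterer_geometry \<Omega>0 \<Omega>1 \<Omega>2 S0 S1" and \<alpha>: "\<alpha> > 0"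
    and sol: "transmission_solution \<alpha> k0 k1 k2 lam0 lam1 \<Omega>0 \<Omega>1 \<Omega>2 S0 S1 \<nu> n f g p q u v w"
    and A: "boundary_field \<Omega>0 Z (\<lambda>x. of_real (k0\<^sup>2)) A GA"
    and B: "boundary_field \<Omega>1 Z (\<lambda>x. of_real (k1\<^sup>2)) B GB"
    and fg: "\<And>x. x \<in> S0 \<Longrightarrow> f x = B x - A x"
      "\<And>x. x \<in> S0 \<Longrightarrow> g x = of_real lam0 * (\<Sum>j\<in>UNIV. \<nu> x $ j *\<^sub>R GB j x) - (\<Sum>j\<in>UNIV. \<nu> x $ j *\<^sub>R GA j x)"
    and pq: "\<And>x. x \<in> S1 \<Longrightarrow> p x = - B x" "\<And>x. x \<in> S1 \<Longrightarrow> q x = - (\<Sum>j\<in>UNIV. \<nu> x $ j *\<^sub>R GB j x)"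
  obtains G0 G1 G2 where
    "boundary_field \<Omega>0 {} (\<lambda>x. of_real (k0\<^sup>2)) u G0"
    "boundary_field \<Omega>1 {} (\<lambda>x. of_real (k1\<^sup>2)) v G1"
    "total_field \<Omega>0 \<Omega>1 \<Omega>2 S0 S1 \<nu> lam0 lam1 Z (squared_index k0 k1 k2 n)
       (\<lambda>m. if m = 0 then \<lambda>x. u x + A x else if m = 1 then \<lambda>x. v x + B x else w)
       (\<lambda>m. if m = 0 then \<lambda>j x. G0 j x + GA j x else if m = 1 then \<lambda>j x. G1 j x + GB j x else G2)"
    "radiating k0 u"
proof -
  note s = sol[unfolded transmission_solution_def]
  have op: "open \<Omega>0" "open \<Omega>1" "open \<Omega>2" "frontier \<Omega>0 = S0" "frontier \<Omega>1 = S0 \<union> S1" "frontier \<Omega>2 = S1"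
    using geom unfolding scatterer_geometry_def by auto
  obtain G0 where G0: "boundary_field \<Omega>0 {} (\<lambda>x. of_real (k0\<^sup>2)) u G0"
    "\<And>x. x \<in> frontier \<Omega>0 \<Longrightarrow> normal_deriv_from \<Omega>0 \<nu> u x = (\<Sum>j\<in>UNIV. \<nu> x $ j *\<^sub>R G0 j x)"
    by (rule boundary_field_ex[of \<Omega>0 u \<alpha> "\<lambda>x. of_real (k0\<^sup>2)"]) (use s op \<alpha> in auto)
  obtain G1 where G1: "boundary_field \<Omega>1 {} (\<lambda>x. of_real (k1\<^sup>2)) v G1"
    "\<And>x. x \<in> frontier \<Omega>1 \<Longrightarrow> normal_deriv_from \<Omega>1 \<nu> v x = (\<Sum>j\<in>UNIV. \<nu> x $ j *\<^sub>R G1 j x)"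
    by (rule boundary_field_ex[of \<Omega>1 v \<alpha> "\<lambda>x. of_real (k1\<^sup>2)"]) (use s op \<alpha> in auto)
  obtain G2 where G2: "boundary_field \<Omega>2 {} (\<lambda>x. of_real (k2\<^sup>2) * n x) w G2"
    "\<And>x. x \<in> frontier \<Omega>2 \<Longrightarrow> normal_deriv_from \<Omega>2 \<nu> w x = (\<Sum>j\<in>UNIV. \<nu> x $ j *\<^sub>R G2 j x)"
    by (rule boundary_field_ex[of \<Omega>2 w \<alpha> "\<lambda>x. of_real (k2\<^sup>2) * n x"]) (use s op \<alpha> in auto)
  have c: "squared_index k0 k1 k2 n 0 = (\<lambda>x. of_real (k0\<^sup>2))" "squared_index k0 k1 k2 n (Suc 0) = (\<lambda>x. of_real (k1\<^sup>2))"
    "squared_index k0 k1 k2 n 2 = (\<lambda>x. of_real (k2\<^sup>2) * n x)"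
    by (auto simp: squared_index_def)
  have S0: "u x + A x = v x + B x" "(\<Sum>j\<in>UNIV. \<nu> x $ j *\<^sub>R (G0 j x + GA j x))
      = of_real lam0 * (\<Sum>j\<in>UNIV. \<nu> x $ j *\<^sub>R (G1 j x + GB j x))" if "x \<in> S0" for x
  proof -
    have "u x - v x = f x" and n: "normal_deriv_from \<Omega>0 \<nu> u x - of_real lam0 * normal_deriv_from \<Omega>1 \<nu> v x = g x"
      using s that by blast+
    then show "u x + A x = v x + B x" using fg(1)[OF that] by (simp add: algebra_simps)
    have "normal_deriv_from \<Omega>0 \<nu> u x = (\<Sum>j\<in>UNIV. \<nu> x $ j *\<^sub>R G0 j x)"
      "normal_deriv_from \<Omega>1 \<nu> v x = (\<Sum>j\<in>UNIV. \<nu> x $ j *\<^sub>R G1 j x)"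
      using G0(2) G1(2) op that by auto
    with n fg(2)[OF that] show "(\<Sum>j\<in>UNIV. \<nu> x $ j *\<^sub>R (G0 j x + GA j x))
      = of_real lam0 * (\<Sum>j\<in>UNIV. \<nu> x $ j *\<^sub>R (G1 j x + GB j x))"
      by (simp add: scaleR_add_right sum.distrib algebra_simps)
  qed
  have S1: "v x + B x = w x" "(\<Sum>j\<in>UNIV. \<nu> x $ j *\<^sub>R (G1 j x + GB j x))
      = of_real lam1 * (\<Sum>j\<in>UNIV. \<nu> x $ j *\<^sub>R G2 j x)" if "x \<in> S1" for x
  proof -
    have "v x - w x = p x" and n: "normal_deriv_from \<Omega>1 \<nu> v x - of_real lam1 * normal_deriv_from \<Omega>2 \<nu> w x = q x"
      using s that by blast+
    then show "v x + B x = w x" using pq(1)[OF that] by (simp add: algebra_simps)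
    have "normal_deriv_from \<Omega>1 \<nu> v x = (\<Sum>j\<in>UNIV. \<nu> x $ j *\<^sub>R G1 j x)"
      "normal_deriv_from \<Omega>2 \<nu> w x = (\<Sum>j\<in>UNIV. \<nu> x $ j *\<^sub>R G2 j x)"
      using G1(2) G2(2) op that by auto
    with n pq(2)[OF that] show "(\<Sum>j\<in>UNIV. \<nu> x $ j *\<^sub>R (G1 j x + GB j x))
      = of_real lam1 * (\<Sum>j\<in>UNIV. \<nu> x $ j *\<^sub>R G2 j x)"
      by (simp add: scaleR_add_right sum.distrib algebra_simps)
  qed
  show ?thesis
  proof (rule that[OF G0(1) G1(1)])
    show "radiating k0 u" using s by blast
    show "total_field \<Omega>0 \<Omega>1 \<Omega>2 S0 S1 \<nu> lam0 lam1 Z (squared_index k0 k1 k2 n)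
       (\<lambda>m. if m = 0 then \<lambda>x. u x + A x else if m = 1 then \<lambda>x. v x + B x else w)
       (\<lambda>m. if m = 0 then \<lambda>j x. G0 j x + GA j x else if m = 1 then \<lambda>j x. G1 j x + GB j x else G2)"
      using boundary_field_add[OF boundary_field_mono[OF G0(1) empty_subsetI] A]
        boundary_field_add[OF boundary_field_mono[OF G1(1) empty_subsetI] B]
        boundary_field_mono[OF G2(1) empty_subsetI] S0 S1
      by (simp add: total_field_def c)
  qed
qed

lemma boundary_field_zero: "boundary_field D Z c (\<lambda>x. 0) (\<lambda>j x. 0)"
proof -
  have "helmholtz_on (- Z) c (\<lambda>x. 0) (\<lambda>j x. 0)"
    unfolding helmholtz_on_def by (intro conjI exI[of _ "\<lambda>j i x. 0"]) (simp_all add: C1_grad_const)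
  then show ?thesis by (rule boundary_field_outside)
qed

lemma exterior_radiates:
  assumes geom: "scatterer_geometry \<Omega>0 \<Omega>1 \<Omega>2 S0 S1" and "boundary_field \<Omega>0 {} c u G" "radiating k u"
  shows "radiates k u G"
proof -
  obtain r where r: "\<And>x. r < norm x \<Longrightarrow> x \<in> \<Omega>0" using exterior_subset[OF geom] by blast
  have "C1_grad {x. r < norm x} u G"
    using assms(2) r unfolding boundary_field_def by (auto intro: C1_grad_subset[OF helmholtz_on_C1])
  then show ?thesis by (rule radiating_imp_radiates[OF assms(3)])
qed

lemma normal_deriv_eq:
  assumes "C1_grad D u G" "x \<in> D"
  shows "normal_deriv \<nu> u x = (\<Sum>j\<in>UNIV. \<nu> x $ j *\<^sub>R G j x)"
  unfolding normal_deriv_def by (rule C1_grad_frechet[OF assms])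

text \<open>The prefactor of the expansion cancels against the normalisation, and the remainder
  tends to 0 along the ray.\<close>

lemma far_field_pattern_limit:
  fixes u u_inf :: "real^3 \<Rightarrow> complex"
  assumes "far_field_pattern k u u_inf" and d: "norm d = 1" and \<rho>: "filterlim \<rho> at_top sequentially"
  shows "(\<lambda>n. of_real (4 * pi * \<rho> n) * exp (- \<i> * of_real (k * \<rho> n)) * u (\<rho> n *\<^sub>R d)) \<longlonglongrightarrow> 4 * pi * u_inf d"
proof -
  obtain E where E: "E \<in> O[at_infinity](\<lambda>x. of_real (1 / norm x))"
    "\<forall>\<^sub>F x in at_infinity. u x = exp (\<i> * of_real (k * norm x)) / of_real (norm x) * (u_inf (x /\<^sub>R norm x) + E x)"
    using assms(1) unfolding far_field_pattern_def by blast
  have pos: "\<forall>\<^sub>F n in sequentially. \<rho> n > 0" using \<rho> by (simp add: filterlim_at_top_dense)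
  have inf: "filterlim (\<lambda>n. \<rho> n *\<^sub>R d) at_infinity sequentially"
    unfolding filterlim_at_infinity_conv_norm_at_top
    by (rule filterlim_at_top_mono[OF \<rho>]) (use d in \<open>auto intro!: always_eventually\<close>)
  have Elim: "(E \<longlongrightarrow> 0) at_infinity"
  proof -
    obtain C where "\<forall>\<^sub>F x in at_infinity. norm (E x) \<le> C * norm (complex_of_real (1 / norm x))"
      using E(1) by (rule landau_o.bigE) blast
    then have ev: "\<forall>\<^sub>F x in at_infinity. norm (E x) \<le> C * inverse (norm x)"
      by (simp add: inverse_eq_divide norm_divide)
    have "((\<lambda>x :: real^3. C * inverse (norm x)) \<longlongrightarrow> C * 0) at_infinity"
      by (intro tendsto_mult tendsto_const tendsto_inverse_0_at_top filterlim_norm_at_top)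
    then show ?thesis using ev by (intro Lim_null_comparison[of E "\<lambda>x. C * inverse (norm x)"]) auto
  qed
  have "(\<lambda>n. 4 * pi * (u_inf d + E (\<rho> n *\<^sub>R d))) \<longlonglongrightarrow> 4 * pi * (u_inf d + 0)"
    by (intro tendsto_intros filterlim_compose[OF Elim inf])
  moreover have "\<forall>\<^sub>F n in sequentially. 4 * pi * (u_inf d + E (\<rho> n *\<^sub>R d))
      = of_real (4 * pi * \<rho> n) * exp (- \<i> * of_real (k * \<rho> n)) * u (\<rho> n *\<^sub>R d)"
    using pos eventually_compose_filterlim[OF E(2) inf]
  proof eventually_elim
    case (elim n)
    have e: "exp (- \<i> * of_real (k * \<rho> n)) * exp (\<i> * of_real (k * \<rho> n)) = 1"
      by (simp flip: exp_add)
    have nrm: "norm (\<rho> n *\<^sub>R d) = \<rho> n" "(\<rho> n *\<^sub>R d) /\<^sub>R norm (\<rho> n *\<^sub>R d) = d" using elim(1) d by auto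
    have "of_real (4 * pi * \<rho> n) * exp (- \<i> * of_real (k * \<rho> n)) * u (\<rho> n *\<^sub>R d)
      = (exp (- \<i> * of_real (k * \<rho> n)) * exp (\<i> * of_real (k * \<rho> n))) * (4 * pi * (u_inf d + E (\<rho> n *\<^sub>R d)))"
      unfolding elim(2) nrm using elim(1) by (simp add: field_simps)
    then show ?case unfolding e by simp
  qed
  ultimately have "(\<lambda>n. of_real (4 * pi * \<rho> n) * exp (- \<i> * of_real (k * \<rho> n)) * u (\<rho> n *\<^sub>R d))
      \<longlonglongrightarrow> 4 * pi * (u_inf d + 0)"
    by (rule Lim_transform_eventually)
  then show ?thesis by (simp only: add_0_right)
qed

text \<open>Source and observation point may be exchanged, so this is the limit at \<open>z\<close>
  of sources that recede to infinity.\<close>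

lemma point_source_far_limit:
  assumes d: "norm d = 1" and \<rho>: "filterlim \<rho> at_top sequentially"
  shows "(\<lambda>n. of_real (4 * pi * \<rho> n) * exp (- \<i> * of_real (k * \<rho> n)) * point_source k z (\<rho> n *\<^sub>R d))
    \<longlonglongrightarrow> plane_wave k (- d) z"
proof -
  have "(\<lambda>n. 1 / \<rho> n) \<longlonglongrightarrow> 0" using tendsto_inverse_0_at_top[OF \<rho>] by (simp add: inverse_eq_divide)
  from far_source_tendsto[OF d this]
  have "(\<lambda>n. far_source k d (1 / \<rho> n) z) \<longlonglongrightarrow> plane_wave k (- d) z" .
  moreover have "\<forall>\<^sub>F n in sequentially. norm z < \<rho> n" using \<rho> by (simp add: filterlim_at_top_dense)
  then have "\<forall>\<^sub>F n in sequentially. far_source k d (1 / \<rho> n) z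
      = of_real (4 * pi * \<rho> n) * exp (- \<i> * of_real (k * \<rho> n)) * point_source k z (\<rho> n *\<^sub>R d)"
  proof eventually_elim
    case (elim n)
    have "\<rho> n > 0" using elim norm_ge_zero[of z] by linarith
    moreover have "point_source k z (\<rho> n *\<^sub>R d) = point_source k (\<rho> n *\<^sub>R d) z"
      by (simp add: point_source_def norm_minus_commute)
    ultimately show ?case using far_source_eq(1)[OF d _ elim, of k] by simp
  qed
  ultimately show ?thesis by (rule Lim_transform_eventually)
qed

theorem lemma2p5:
  fixes \<alpha> k0 k1 k2 lam0 lam1 :: real
    and \<Omega>0 \<Omega>1 \<Omega>2 S0 S1 :: "(real^3) set"
    and \<nu> :: "real^3 \<Rightarrow> real^3"
    and n :: "real^3 \<Rightarrow> complex"
    and us v w :: "real^3 \<Rightarrow> real^3 \<Rightarrow> complex"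
    and us_pt v_pt w_pt :: "real^3 \<Rightarrow> real^3 \<Rightarrow> complex"
    and \<Phi>_inf :: "real^3 \<Rightarrow> real^3 \<Rightarrow> complex"
  assumes "0 < \<alpha>" "\<alpha> < 1"
    and "0 < k0" "0 < k1" "0 < k2" "0 < lam0" "0 < lam1"
    and "scatterer_geometry \<Omega>0 \<Omega>1 \<Omega>2 S0 S1"
    and "unit_normal_into S0 \<Omega>0 \<nu>" "unit_normal_into S1 \<Omega>1 \<nu>"
    and "holder_on \<alpha> (closure \<Omega>2) n"
    and "\<forall>x\<in>closure \<Omega>2. 0 < Re (n x) \<and> 0 \<le> Im (n x)"
    and "not_neumann_eigenvalue \<alpha> \<Omega>2 \<nu> n k2"
    and plane_waves: "\<forall>d\<in>sphere 0 1.
          transmission_solution \<alpha> k0 k1 k2 lam0 lam1 \<Omega>0 \<Omega>1 \<Omega>2 S0 S1 \<nu> n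
            (\<lambda>x. - plane_wave k0 d x) (\<lambda>x. - normal_deriv \<nu> (plane_wave k0 d) x)
            (\<lambda>x. 0) (\<lambda>x. 0)
            (us d) (v d) (w d)"
    and point_sources_0: "\<forall>z\<in>\<Omega>0.
          transmission_solution \<alpha> k0 k1 k2 lam0 lam1 \<Omega>0 \<Omega>1 \<Omega>2 S0 S1 \<nu> n
            (\<lambda>x. - point_source k0 z x) (\<lambda>x. - normal_deriv \<nu> (point_source k0 z) x)
            (\<lambda>x. 0) (\<lambda>x. 0)
            (us_pt z) (v_pt z) (w_pt z)"
    and point_sources_1: "\<forall>z\<in>\<Omega>1.
          transmission_solution \<alpha> k0 k1 k2 lam0 lam1 \<Omega>0 \<Omega>1 \<Omega>2 S0 S1 \<nu> n
            (\<lambda>x. point_source k1 z x) (\<lambda>x. of_real lam0 * normal_deriv \<nu> (point_source k1 z) x)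
            (\<lambda>x. - point_source k1 z x) (\<lambda>x. - normal_deriv \<nu> (point_source k1 z) x)
            (us_pt z) (v_pt z) (w_pt z)"
    and far_fields: "\<forall>z\<in>\<Omega>0 \<union> \<Omega>1. far_field_pattern k0 (us_pt z) (\<Phi>_inf z)"
  shows "\<forall>xh\<in>sphere 0 1.
           (\<forall>z\<in>\<Omega>0. \<Phi>_inf z xh = of_real (1 / (4 * pi)) * us (- xh) z) \<and>
           (\<forall>z\<in>\<Omega>1. \<Phi>_inf z xh = of_real (lam0 / (4 * pi)) * v (- xh) z)"
proof (intro ballI conjI)
  fix xh :: "real^3" assume "xh \<in> sphere 0 1"
  then have d: "norm xh = 1" "- xh \<in> sphere 0 1" by auto
  note geom = assms(8) and normals = assms(9,10)
  have op: "open \<Omega>0" "open \<Omega>1" using geom unfolding scatterer_geometry_def by auto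
  note dis = scatterer_geometry_disjoint[OF geom]
  define c where "c = squared_index k0 k1 k2 n"
  have c0: "c 0 = (\<lambda>x. of_real (k0\<^sup>2))" by (auto simp: c_def squared_index_def)
  \<comment> \<open>A source receding in direction \<open>xh\<close> sends its wave back along
    \<open>- xh\<close>, hence this incident direction.\<close>
  define e Ge where "e = plane_wave k0 (- xh)" and "Ge = plane_wave_grad k0 (- xh)"
  have be: "boundary_field D {} (\<lambda>x. of_real (k0\<^sup>2)) e Ge" for D
    unfolding e_def Ge_def
    by (rule boundary_field_outside) (use helmholtz_on_plane_wave[of "- xh" k0] d in simp)
  have ne: "normal_deriv \<nu> e x = (\<Sum>j\<in>UNIV. \<nu> x $ j *\<^sub>R Ge j x)" for x
    unfolding e_def Ge_def by (rule normal_deriv_eq[OF C1_grad_plane_wave]) simp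
  have sol: "transmission_solution \<alpha> k0 k1 k2 lam0 lam1 \<Omega>0 \<Omega>1 \<Omega>2 S0 S1 \<nu> n
      (\<lambda>x. - e x) (\<lambda>x. - normal_deriv \<nu> e x) (\<lambda>x. 0) (\<lambda>x. 0) (us (- xh)) (v (- xh)) (w (- xh))"
    using plane_waves d(2) unfolding e_def by blast
  obtain G0 G1 G2 where P: "boundary_field \<Omega>0 {} (\<lambda>x. of_real (k0\<^sup>2)) (us (- xh)) G0"
    "boundary_field \<Omega>1 {} (\<lambda>x. of_real (k1\<^sup>2)) (v (- xh)) G1"
    "total_field \<Omega>0 \<Omega>1 \<Omega>2 S0 S1 \<nu> lam0 lam1 {} c
       (\<lambda>m. if m = 0 then \<lambda>x. us (- xh) x + e x else if m = 1 then \<lambda>x. v (- xh) x + 0 else w (- xh))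
       (\<lambda>m. if m = 0 then \<lambda>j x. G0 j x + Ge j x else if m = 1 then \<lambda>j x. G1 j x + 0 else G2)"
    "radiating k0 (us (- xh))"
    by (rule total_field_of_solution[OF geom assms(1) sol be boundary_field_zero, folded c_def]) (simp_all add: ne)
  \<comment> \<open>The fields of \<open>P(3)\<close> without the summand 0 that stands for the
    missing incident field in \<Omega>1.\<close>
  define U where "U m = (if m = 0 then \<lambda>x. us (- xh) x + e x else if m = 1 then v (- xh) else w (- xh))" for m :: nat
  define GU where "GU m = (if m = 0 then \<lambda>j x. G0 j x + Ge j x else if m = 1 then G1 else G2)" for m :: nat
  have U: "total_field \<Omega>0 \<Omega>1 \<Omega>2 S0 S1 \<nu> lam0 lam1 {z} c U GU" for z
    by (rule total_field_mono[OF _ empty_subsetI]) (use P(3) in \<open>simp add: U_def[abs_def] GU_def[abs_def] cong: if_cong\<close>)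
  have U0: "U 0 = (\<lambda>x. us (- xh) x + plane_wave k0 (- xh) x)" "GU 0 = (\<lambda>j x. G0 j x + plane_wave_grad k0 (- xh) j x)"
    by (simp_all add: U_def GU_def e_def Ge_def)
  have bu: "boundary_field \<Omega>0 {} (c 0) (us (- xh)) G0" using P(1) by (simp add: c0)
  have C1: "C1_grad D u G" if "boundary_field D {} b u G" for D b u G
    using helmholtz_on_C1 that unfolding boundary_field_def by fastforce
  note reciprocity = reciprocity[OF geom normals \<open>0 < k0\<close> d(1) c0 U _ U0 bu P(4)]

  show "\<Phi>_inf z xh = of_real (1 / (4 * pi)) * us (- xh) z" if z: "z \<in> \<Omega>0" for z
  proof -
    define \<phi> G\<phi> where "\<phi> = point_source k0 z" and "G\<phi> = point_source_grad k0 z"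
    have b\<phi>: "boundary_field D {z} (\<lambda>x. of_real (k0\<^sup>2)) \<phi> G\<phi>" for D
      unfolding \<phi>_def G\<phi>_def by (rule boundary_field_outside[OF helmholtz_on_point_source])
    have n\<phi>: "normal_deriv \<nu> \<phi> x = (\<Sum>j\<in>UNIV. \<nu> x $ j *\<^sub>R G\<phi> j x)" if "x \<in> S0" for x
      unfolding \<phi>_def G\<phi>_def by (rule normal_deriv_eq[OF C1_grad_point_source]) (use that z dis in auto)
    have sol: "transmission_solution \<alpha> k0 k1 k2 lam0 lam1 \<Omega>0 \<Omega>1 \<Omega>2 S0 S1 \<nu> n
        (\<lambda>x. - \<phi> x) (\<lambda>x. - normal_deriv \<nu> \<phi> x) (\<lambda>x. 0) (\<lambda>x. 0) (us_pt z) (v_pt z) (w_pt z)"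
      using point_sources_0 z unfolding \<phi>_def by blast
    obtain H0 H1 H2 where H: "boundary_field \<Omega>0 {} (\<lambda>x. of_real (k0\<^sup>2)) (us_pt z) H0"
      "total_field \<Omega>0 \<Omega>1 \<Omega>2 S0 S1 \<nu> lam0 lam1 {z} c
       (\<lambda>m. if m = 0 then \<lambda>x. us_pt z x + \<phi> x else if m = 1 then \<lambda>x. v_pt z x + 0 else w_pt z)
       (\<lambda>m. if m = 0 then \<lambda>j x. H0 j x + G\<phi> j x else if m = 1 then \<lambda>j x. H1 j x + 0 else H2)"
      "radiating k0 (us_pt z)"
      by (rule total_field_of_solution[OF geom assms(1) sol b\<phi> boundary_field_zero, folded c_def]) (simp_all add: n\<phi>)
    \<comment> \<open>On the left \<open>e z\<close> comes from the far field of the point source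
      itself, on the right from the incident plane wave; the two cancel.\<close>
    have "4 * pi * \<Phi>_inf z xh + e z = 1 * (us (- xh) z + e z)"
    proof (rule reciprocity[OF H(2) _ op(1) z C1_grad_add[OF C1[OF P(1)] C1[OF be]] C1[OF H(1)]])
      show "radiates k0 ((\<lambda>m. if m = 0 then \<lambda>x. us_pt z x + \<phi> x else if m = 1 then \<lambda>x. v_pt z x + 0 else w_pt z) (0::nat))
         ((\<lambda>m. if m = 0 then \<lambda>j x. H0 j x + G\<phi> j x else if m = 1 then \<lambda>j x. H1 j x + 0 else H2) (0::nat))"
        using radiates_add[OF exterior_radiates[OF geom H(1,3)] radiates_point_source[of k0 z]] \<open>0 < k0\<close>
        by (simp add: \<phi>_def G\<phi>_def)
      fix \<rho> :: "nat \<Rightarrow> real" assume \<rho>: "filterlim \<rho> at_top sequentially"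
      have "far_field_pattern k0 (us_pt z) (\<Phi>_inf z)" using far_fields z by blast
      from tendsto_add[OF far_field_pattern_limit[OF this d(1) \<rho>] point_source_far_limit[OF d(1) \<rho>, of k0 z]]
      show "(\<lambda>n. of_real (4 * pi * \<rho> n) * exp (- \<i> * of_real (k0 * \<rho> n)) *
          (\<lambda>m. if m = 0 then \<lambda>x. us_pt z x + \<phi> x else if m = 1 then \<lambda>x. v_pt z x + 0 else w_pt z) (0::nat) (\<rho> n *\<^sub>R xh))
          \<longlonglongrightarrow> 4 * pi * \<Phi>_inf z xh + e z"
        by (simp add: \<phi>_def e_def ring_distribs)
    qed (auto simp: total_wronskian_def U_def GU_def \<phi>_def G\<phi>_def)
    then show ?thesis by (simp add: field_simps)
  qed

  show "\<Phi>_inf z xh = of_real (lam0 / (4 * pi)) * v (- xh) z" if z: "z \<in> \<Omega>1" for z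
  proof -
    define \<phi> G\<phi> where "\<phi> = point_source k1 z" and "G\<phi> = point_source_grad k1 z"
    have b\<phi>: "boundary_field D {z} (\<lambda>x. of_real (k1\<^sup>2)) \<phi> G\<phi>" for D
      unfolding \<phi>_def G\<phi>_def by (rule boundary_field_outside[OF helmholtz_on_point_source])
    have n\<phi>: "normal_deriv \<nu> \<phi> x = (\<Sum>j\<in>UNIV. \<nu> x $ j *\<^sub>R G\<phi> j x)" if "x \<in> S0 \<union> S1" for x
      unfolding \<phi>_def G\<phi>_def by (rule normal_deriv_eq[OF C1_grad_point_source]) (use that z dis in auto)
    have sol: "transmission_solution \<alpha> k0 k1 k2 lam0 lam1 \<Omega>0 \<Omega>1 \<Omega>2 S0 S1 \<nu> n
        \<phi> (\<lambda>x. of_real lam0 * normal_deriv \<nu> \<phi> x) (\<lambda>x. - \<phi> x) (\<lambda>x. - normal_deriv \<nu> \<phi> x) (us_pt z) (v_pt z) (w_pt z)"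
      using point_sources_1 z unfolding \<phi>_def by blast
    obtain H0 H1 H2 where H: "boundary_field \<Omega>0 {} (\<lambda>x. of_real (k0\<^sup>2)) (us_pt z) H0"
      "boundary_field \<Omega>1 {} (\<lambda>x. of_real (k1\<^sup>2)) (v_pt z) H1"
      "total_field \<Omega>0 \<Omega>1 \<Omega>2 S0 S1 \<nu> lam0 lam1 {z} c
       (\<lambda>m. if m = 0 then \<lambda>x. us_pt z x + 0 else if m = 1 then \<lambda>x. v_pt z x + \<phi> x else w_pt z)
       (\<lambda>m. if m = 0 then \<lambda>j x. H0 j x + 0 else if m = 1 then \<lambda>j x. H1 j x + G\<phi> j x else H2)"
      "radiating k0 (us_pt z)"
      by (rule total_field_of_solution[OF geom assms(1) sol boundary_field_zero b\<phi>, folded c_def]) (simp_all add: n\<phi>)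
    \<comment> \<open>No incident field lives in \<Omega>0 here, so the left side is the scattered
      far field alone; the factor on the right is the weight of \<Omega>1.\<close>
    have "4 * pi * \<Phi>_inf z xh = of_real lam0 * v (- xh) z"
    proof (rule reciprocity[OF H(3) _ op(2) z C1[OF P(2)] C1[OF H(2)]])
      show "radiates k0 ((\<lambda>m. if m = 0 then \<lambda>x. us_pt z x + 0 else if m = 1 then \<lambda>x. v_pt z x + \<phi> x else w_pt z) (0::nat))
         ((\<lambda>m. if m = 0 then \<lambda>j x. H0 j x + 0 else if m = 1 then \<lambda>j x. H1 j x + G\<phi> j x else H2) (0::nat))"
        using exterior_radiates[OF geom H(1,4)] by simp
      fix \<rho> :: "nat \<Rightarrow> real" assume \<rho>: "filterlim \<rho> at_top sequentially"
      have "far_field_pattern k0 (us_pt z) (\<Phi>_inf z)" using far_fields z by blast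
      from far_field_pattern_limit[OF this d(1) \<rho>]
      show "(\<lambda>n. of_real (4 * pi * \<rho> n) * exp (- \<i> * of_real (k0 * \<rho> n)) *
          (\<lambda>m. if m = 0 then \<lambda>x. us_pt z x + 0 else if m = 1 then \<lambda>x. v_pt z x + \<phi> x else w_pt z) (0::nat) (\<rho> n *\<^sub>R xh))
          \<longlonglongrightarrow> 4 * pi * \<Phi>_inf z xh"
        by simp
    qed (use dis(1) \<open>0 < lam0\<close> in \<open>auto simp: total_wronskian_def U_def GU_def \<phi>_def G\<phi>_def\<close>)
    then show ?thesis by (simp add: field_simps)
  qed
qed

end
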